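(* Let $G$ be a connected semisimple real Lie group, $\Gamma\subset G$ a lattice, $K\subset G$ a maximal compact subgroup, $\mathfrak{g}$ the Lie algebra of $G$ with a fixed norm $\|\cdot\|$, and $H\in\mathfrak{g}$ a semisimple element. Let $\mathfrak{u}$ be the sum of the negative root spaces of $H$ and $U = \exp(\mathfrak{u})$. Let $x_0\in\Gamma\backslash G$ be such that $x_0U$ is compact; put $x_t = x_0\exp(tH)$ and let $\Delta_t$ be the stabilizer of $x_t$ in $U$. For $T\ge 0$, a character $\psi$ of $U$ trivial on $\Delta_T$, and $f\in C^\infty(\Gamma\backslash G)$, set $$\mu_{T,\psi}(f) = \frac{\int_{\Delta_T\backslash U} f(x_T u)\psi(u)\,du}{\mathrm{vol}(\Delta_T\backslash U)},\qquad \nu_T(f) = \frac{\int_{\Delta_T\backslash U} f(x_T u)\,du}{\mathrm{vol}(\Delta_T\backslash U)}.$$ Suppose $\kappa_1\in(0,1]$ and $\kappa_2>0$ are such that, for all $f,g\in C^\infty(\Gamma\backslash G)$, all $E\in\mathfrak{u}$ with $\|E\|=1$, all $s\in\mathbb{R}$ and all $T\ge 0$, $$\Big|\langle \exp(sE)\cdot f, g\rangle_{L^2(\Gamma\backslash G)} - \int f\int g\Big| \ll (1+|s|)^{-\kappa_1} S_{\infty,\dim K}(f)S_{\infty,\dim K}(g),\qquad \Big|\nu_T(f)-\int f\Big|\ll e^{-\kappa_2 T}S_{\infty,\dim K}(f).$$ Let $o$ be the (maximal, over $E\in\mathfrak{u}$) degree of the polynomial map $\mathbb{R}\to\mathrm{End}(\mathfrak{g})$,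 $s\mapsto \mathrm{Ad}(\exp(sE))$. Then for every $\kappa_3 < \frac{\kappa_1\kappa_2}{2(2o\dim K+\kappa_1)}$ (in particular for some $\kappa_3>0$) we have, for all $f\in C^\infty(\Gamma\backslash G)$ with $\int_{\Gamma\backslash G} f = 0$, all $T\ge 0$ and all characters $\psi$ of $U$ trivial on $\Delta_T$, $$|\mu_{T,\psi}(f)| \ll \exp(-T\kappa_3)\, S_{\infty,\dim K}(f).$$
   Context: The Haar measure on $G$ is normalized so that $\Gamma\backslash G$ has volume $1$; integrals $\int f$ are over $\Gamma\backslash G$. $du$ is a Haar measure on $U$. For $g\in G$, $(g\cdot f)(x) = f(xg)$. Fix a basis $\mathcal{B}$ of $\mathfrak{g}$ acting by right differentiation; $S_{\infty,d}(f) = \sum_{\mathcal{D}}\sup|\mathcal{D}f|$ over monomials $\mathcal{D}$ in $\mathcal{B}$ of order $\le d$. Implied constants are independent of $f,g,T,s,\psi,E$. *)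

theory Defs
  imports "HOL-Analysis.Analysis" "HOL-Algebra.Coset"
begin

section \<open>Smooth maps\<close>

primrec Ck_on :: "nat \<Rightarrow> 'a::euclidean_space set \<Rightarrow> ('a \<Rightarrow> 'b::real_normed_vector) \<Rightarrow> bool" where
  "Ck_on 0 S f \<longleftrightarrow> continuous_on S f"
| "Ck_on (Suc k) S f \<longleftrightarrow>
     f differentiable_on S \<and> (\<forall>v. Ck_on k S (\<lambda>x. frechet_derivative f (at x) v))"

text \<open>Only used for open sets \<open>S\<close>.\<close>

definition smooth_on :: "'a::euclidean_space set \<Rightarrow> ('a \<Rightarrow> 'b::real_normed_vector) \<Rightarrow> bool" where
  "smooth_on S f \<longleftrightarrow> (\<forall>k. Ck_on k S f)"

text \<open>A chart is a pair of an open set and a coordinate map; the values of the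
  coordinate map outside the open set are irrelevant.\<close>

type_synonym ('g, 'l) chart = "'g set \<times> ('g \<Rightarrow> 'l)"

definition smooth_map ::
    "('g::topological_space, 'l::euclidean_space) chart set
      \<Rightarrow> ('h::topological_space, 'm::euclidean_space) chart set \<Rightarrow> ('g \<Rightarrow> 'h) \<Rightarrow> bool" where
  "smooth_map A B f \<longleftrightarrow> continuous_on UNIV f \<and>
     (\<forall>(V, \<phi>)\<in>A. \<forall>(W, \<theta>)\<in>B. smooth_on (\<phi> ` (V \<inter> f -` W)) (\<theta> \<circ> f \<circ> inv_into V \<phi>))"

definition smooth_atlas :: "('g::topological_space, 'l::euclidean_space) chart set \<Rightarrow> bool" where
  "smooth_atlas A \<longleftrightarrow>
     (\<Union>(V, \<phi>)\<in>A. V) = UNIV \<and>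
     (\<forall>(V, \<phi>)\<in>A. open V \<and> open (\<phi> ` V) \<and> homeomorphism V (\<phi> ` V) \<phi> (inv_into V \<phi>)) \<and>
     smooth_map A A id"

definition prod_atlas ::
    "('g, 'l) chart set \<Rightarrow> ('h, 'm) chart set \<Rightarrow> ('g \<times> 'h, 'l \<times> 'm) chart set" where
  "prod_atlas A B = {(V \<times> W, map_prod \<phi> \<theta>) | V \<phi> W \<theta>. (V, \<phi>) \<in> A \<and> (W, \<theta>) \<in> B}"


section \<open>Lie groups and their Lie algebras\<close>

text \<open>The Lie algebra is the tangent space at the identity, written in the coordinates
  of a fixed chart \<open>id_chart\<close> around the identity; its elements are thus the elements of the
  model space \<open>'l\<close>. A curve through the identity represents the derivative of its image in
  this chart.

  The field \<open>Exp\<close> is the exponential map: the predicate \<open>lie_group\<close> below requires that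
  \<open>s \<mapsto> Exp (s X)\<close> is the one-parameter subgroup with velocity \<open>X\<close>, which determines \<open>Exp\<close>
  uniquely from the other fields.\<close>

record ('g, 'l) lie_structure = "'g monoid" +
  atlas :: "('g, 'l) chart set"
  id_chart :: "('g, 'l) chart"
  Exp :: "'l \<Rightarrow> 'g"

definition coord :: "('g, 'l) lie_structure \<Rightarrow> 'g \<Rightarrow> 'l" where
  "coord G = snd (id_chart G)"

definition coord_inv :: "('g, 'l) lie_structure \<Rightarrow> 'l \<Rightarrow> 'g" where
  "coord_inv G = inv_into (fst (id_chart G)) (snd (id_chart G))"

definition lie_group ::
    "('g::{t2_space,second_countable_topology}, 'l::euclidean_space) lie_structure \<Rightarrow> bool" where
  "lie_group G \<longleftrightarrow>
     group G \<and> carrier G = UNIV \<and> smooth_atlas (atlas G) \<and>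
     smooth_map (prod_atlas (atlas G) (atlas G)) (atlas G) (\<lambda>(x, y). x \<otimes>\<^bsub>G\<^esub> y) \<and>
     smooth_map (atlas G) (atlas G) (\<lambda>x. inv\<^bsub>G\<^esub> x) \<and>
     id_chart G \<in> atlas G \<and> \<one>\<^bsub>G\<^esub> \<in> fst (id_chart G) \<and>
     (\<forall>X. continuous_on UNIV (\<lambda>s::real. Exp G (s *\<^sub>R X)) \<and>
          (\<forall>s t. Exp G ((s + t) *\<^sub>R X) = Exp G (s *\<^sub>R X) \<otimes>\<^bsub>G\<^esub> Exp G (t *\<^sub>R X)) \<and>
          ((\<lambda>s. coord G (Exp G (s *\<^sub>R X))) has_vector_derivative X) (at 0))"

definition Ad :: "('g, 'l::euclidean_space) lie_structure \<Rightarrow> 'g \<Rightarrow> 'l \<Rightarrow> 'l" where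
  "Ad G g = frechet_derivative
     (\<lambda>v. coord G (g \<otimes>\<^bsub>G\<^esub> coord_inv G v \<otimes>\<^bsub>G\<^esub> inv\<^bsub>G\<^esub> g)) (at (coord G \<one>\<^bsub>G\<^esub>))"

definition lie_bracket :: "('g, 'l::euclidean_space) lie_structure \<Rightarrow> 'l \<Rightarrow> 'l \<Rightarrow> 'l" where
  "lie_bracket G X Y = vector_derivative (\<lambda>s. Ad G (Exp G (s *\<^sub>R X)) Y) (at 0)"

definition lie_ideal :: "('g, 'l::euclidean_space) lie_structure \<Rightarrow> 'l set \<Rightarrow> bool" where
  "lie_ideal G I \<longleftrightarrow> subspace I \<and> (\<forall>X. \<forall>Y\<in>I. lie_bracket G X Y \<in> I)"

primrec derived_series ::
    "('g, 'l::euclidean_space) lie_structure \<Rightarrow> 'l set \<Rightarrow> nat \<Rightarrow> 'l set" where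
  "derived_series G I 0 = I"
| "derived_series G I (Suc k) =
     span {lie_bracket G X Y | X Y. X \<in> derived_series G I k \<and> Y \<in> derived_series G I k}"

definition semisimple_lie_group ::
    "('g::{t2_space,second_countable_topology}, 'l::euclidean_space) lie_structure \<Rightarrow> bool" where
  "semisimple_lie_group G \<longleftrightarrow> lie_group G \<and>
     (\<forall>I. lie_ideal G I \<and> (\<exists>k. derived_series G I k = {0}) \<longrightarrow> I = {0})"

definition maximal_compact_subgroup ::
    "('g::topological_space, 'l) lie_structure \<Rightarrow> 'g set \<Rightarrow> bool" where
  "maximal_compact_subgroup G K \<longleftrightarrow> subgroup K G \<and> compact K \<and>
     (\<forall>L. subgroup L G \<and> compact L \<and> K \<subseteq> L \<longrightarrow> L = K)"

text \<open>The dimension of a closed subgroup is that of its Lie algebra.\<close>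

definition subgroup_dim :: "('g, 'l::euclidean_space) lie_structure \<Rightarrow> 'g set \<Rightarrow> nat" where
  "subgroup_dim G K = dim {X. \<forall>s::real. Exp G (s *\<^sub>R X) \<in> K}"

definition is_norm :: "('l::real_vector \<Rightarrow> real) \<Rightarrow> bool" where
  "is_norm N \<longleftrightarrow> (\<forall>x. 0 \<le> N x \<and> (N x = 0 \<longleftrightarrow> x = 0)) \<and>
     (\<forall>c x. N (c *\<^sub>R x) = \<bar>c\<bar> * N x) \<and> (\<forall>x y. N (x + y) \<le> N x + N y)"


subsection \<open>Root spaces\<close>

text \<open>\<open>X + \<i> Y\<close> in the complexified Lie algebra satisfies
  \<open>[H, X + \<i> Y] = (a + \<i> b) (X + \<i> Y)\<close>.\<close>

definition ad_eigen ::
    "('g, 'l::euclidean_space) lie_structure \<Rightarrow> 'l \<Rightarrow> real \<Rightarrow> real \<Rightarrow> 'l \<Rightarrow> 'l \<Rightarrow> bool" where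
  "ad_eigen G H a b X Y \<longleftrightarrow>
     lie_bracket G H X = a *\<^sub>R X - b *\<^sub>R Y \<and> lie_bracket G H Y = b *\<^sub>R X + a *\<^sub>R Y"

text \<open>The real parts of the complex eigenvectors span the Lie algebra iff \<open>ad H\<close> is
  diagonalizable over the complex numbers, because the eigenvectors are closed under
  multiplication by \<open>\<i>\<close> and complex conjugation. For the same reason \<open>neg_root_sum\<close> is the set of
  real points of the sum of the eigenspaces whose eigenvalue has negative real part.\<close>

definition semisimple_element :: "('g, 'l::euclidean_space) lie_structure \<Rightarrow> 'l \<Rightarrow> bool" where
  "semisimple_element G H \<longleftrightarrow> span {X. \<exists>a b Y. ad_eigen G H a b X Y} = UNIV"

definition neg_root_sum :: "('g, 'l::euclidean_space) lie_structure \<Rightarrow> 'l \<Rightarrow> 'l set" where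
  "neg_root_sum G H = span {X. \<exists>a b Y. a < 0 \<and> ad_eigen G H a b X Y}"

definition Ad_exp_degree :: "('g, 'l::euclidean_space) lie_structure \<Rightarrow> 'l \<Rightarrow> nat \<Rightarrow> bool" where
  "Ad_exp_degree G E d \<longleftrightarrow>
     (\<exists>A :: nat \<Rightarrow> 'l \<Rightarrow> 'l. (\<forall>i\<le>d. linear (A i)) \<and> A d \<noteq> (\<lambda>_. 0) \<and>
        (\<forall>s X. Ad G (Exp G (s *\<^sub>R E)) X = (\<Sum>i\<le>d. s ^ i *\<^sub>R A i X)))"

definition max_Ad_exp_degree ::
    "('g, 'l::euclidean_space) lie_structure \<Rightarrow> 'l set \<Rightarrow> nat \<Rightarrow> bool" where
  "max_Ad_exp_degree G \<uu> d \<longleftrightarrow>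
     (\<forall>E\<in>\<uu>. \<exists>d'\<le>d. Ad_exp_degree G E d') \<and> (\<exists>E\<in>\<uu>. Ad_exp_degree G E d)"


section \<open>Haar measures and quotients\<close>

text \<open>In this section a subgroup \<open>U\<close> of \<open>G\<close> is viewed as the group \<open>G\<lparr>carrier := U\<rparr>\<close> with the
  subspace topology. The space \<open>\<Delta>\<backslash>G\<close> of right cosets \<open>\<Delta> g\<close> is \<open>rcosets\<^bsub>G\<^esub> \<Delta>\<close>, and \<open>g\<close> acts
  on it from the right by \<open>x \<mapsto> x #>\<^bsub>G\<^esub> g\<close>.

  The Haar measure appropriate to spaces of right cosets is right invariant; for unimodular
  groups (in particular semisimple and nilpotent ones) it is also left invariant.
  Regularity is automatic, as the groups are second countable.\<close>

definition haar_measure :: "('g::topological_space, 'm) monoid_scheme \<Rightarrow> 'g measure \<Rightarrow> bool" where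
  "haar_measure G h \<longleftrightarrow>
     sets h = sets (restrict_space borel (carrier G)) \<and>
     emeasure h (carrier G) \<noteq> 0 \<and>
     (\<forall>C. compact C \<and> C \<subseteq> carrier G \<longrightarrow> emeasure h C < \<infinity>) \<and>
     (\<forall>A\<in>sets h. \<forall>g\<in>carrier G. emeasure h (A #>\<^bsub>G\<^esub> g) = emeasure h A)"

text \<open>The quotient topology; \<open>\<Union>W\<close> is the preimage of \<open>W\<close> under the projection \<open>g \<mapsto> \<Delta> g\<close>.\<close>

definition coset_topology ::
    "('g::topological_space, 'm) monoid_scheme \<Rightarrow> 'g set \<Rightarrow> 'g set topology" where
  "coset_topology G \<Delta> = topology (\<lambda>W. W \<subseteq> rcosets\<^bsub>G\<^esub> \<Delta> \<and> openin (top_of_set (carrier G)) (\<Union>W))"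

lemma openin_coset_topology:
  assumes "group G" "subgroup \<Delta> G"
  shows "openin (coset_topology G \<Delta>) W \<longleftrightarrow>
           W \<subseteq> rcosets\<^bsub>G\<^esub> \<Delta> \<and> openin (top_of_set (carrier G)) (\<Union>W)"
proof -
  have disj: "x = y" if "x \<in> rcosets\<^bsub>G\<^esub> \<Delta>" "y \<in> rcosets\<^bsub>G\<^esub> \<Delta>" "g \<in> x" "g \<in> y" for x y g
    using group.rcos_disjoint[OF assms] that by (auto simp: pairwise_def disjnt_def)
  have int: "\<Union>(S \<inter> T) = \<Union>S \<inter> \<Union>T" if "S \<subseteq> rcosets\<^bsub>G\<^esub> \<Delta>" "T \<subseteq> rcosets\<^bsub>G\<^esub> \<Delta>" for S T
  proof
    show "\<Union>S \<inter> \<Union>T \<subseteq> \<Union>(S \<inter> T)"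
      using disj that by (smt (verit) Int_iff UnionE UnionI subset_iff)
  qed auto
  have un: "\<Union>(\<Union>\<K>) = \<Union>(Union ` \<K>)" for \<K> :: "'a set set set"
    by auto
  have "istopology (\<lambda>W. W \<subseteq> rcosets\<^bsub>G\<^esub> \<Delta> \<and> openin (top_of_set (carrier G)) (\<Union>W))"
    unfolding istopology_def
  proof (intro conjI allI impI; (elim conjE)?)
    fix S T
    assume "S \<subseteq> rcosets\<^bsub>G\<^esub> \<Delta>" "T \<subseteq> rcosets\<^bsub>G\<^esub> \<Delta>"
      "openin (top_of_set (carrier G)) (\<Union>S)" "openin (top_of_set (carrier G)) (\<Union>T)"
    then show "openin (top_of_set (carrier G)) (\<Union>(S \<inter> T))"
      by (simp add: int openin_Int)
  next
    fix \<K> :: "'a set set set"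
    assume "\<forall>K\<in>\<K>. K \<subseteq> rcosets\<^bsub>G\<^esub> \<Delta> \<and> openin (top_of_set (carrier G)) (\<Union>K)"
    then show "openin (top_of_set (carrier G)) (\<Union>(\<Union>\<K>))"
      unfolding un by (intro openin_Union) auto
  qed auto
  then show ?thesis
    by (simp add: coset_topology_def topology_inverse')
qed

definition coset_borel ::
    "('g::topological_space, 'm) monoid_scheme \<Rightarrow> 'g set \<Rightarrow> 'g set measure" where
  "coset_borel G \<Delta> = sigma (rcosets\<^bsub>G\<^esub> \<Delta>) {W. openin (coset_topology G \<Delta>) W}"

text \<open>The measure on \<open>\<Delta>\<backslash>G\<close>, for discrete \<open>\<Delta>\<close>, induced by a Haar measure on \<open>G\<close>. It is characterized
  by the unfolding formula \<open>\<integral>\<^sub>G F = \<integral>\<^sub>\<Delta>\<^sub>\<backslash>\<^sub>G (\<Sum>\<delta>\<in>\<Delta>. F (\<delta> g))\<close> for indicator functions \<open>F\<close> of sets \<open>A\<close>: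
  the number of \<open>\<delta>\<close> with \<open>\<delta> g \<in> A\<close> is the number of elements of \<open>\<Delta> g \<inter> A\<close>.\<close>

definition quotient_measure ::
    "('g::topological_space, 'm) monoid_scheme \<Rightarrow> 'g set \<Rightarrow> 'g measure \<Rightarrow> 'g set measure \<Rightarrow> bool" where
  "quotient_measure G \<Delta> h m \<longleftrightarrow>
     sets m = sets (coset_borel G \<Delta>) \<and>
     (\<forall>A\<in>sets h. emeasure h A = (\<integral>\<^sup>+c. emeasure (count_space UNIV) (c \<inter> A) \<partial>m))"

definition lattice_subgroup :: "('g::topological_space, 'm) monoid_scheme \<Rightarrow> 'g set \<Rightarrow> bool" where
  "lattice_subgroup G \<Gamma> \<longleftrightarrow> subgroup \<Gamma> G \<and> discrete \<Gamma> \<and>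
     (\<exists>h m. haar_measure G h \<and> quotient_measure G \<Gamma> h m \<and> emeasure m (space m) < \<infinity>)"

text \<open>For a left \<open>\<Delta>\<close>-invariant function \<open>\<phi>\<close> on the group, the mean over \<open>\<Delta>\<backslash>G\<close> of the function it
  induces there; by invariance the choice of representatives does not matter.\<close>

definition quotient_mean :: "'g set measure \<Rightarrow> ('g \<Rightarrow> complex) \<Rightarrow> complex" where
  "quotient_mean m \<phi> = (\<integral>c. \<phi> (SOME u. u \<in> c) \<partial>m) / of_real (measure m (space m))"

definition unitary_character ::
    "('g::topological_space, 'm) monoid_scheme \<Rightarrow> ('g \<Rightarrow> complex) \<Rightarrow> bool" where
  "unitary_character G \<psi> \<longleftrightarrow> continuous_on (carrier G) \<psi> \<and>
     (\<forall>u\<in>carrier G. norm (\<psi> u) = 1) \<and>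
     (\<forall>u\<in>carrier G. \<forall>v\<in>carrier G. \<psi> (u \<otimes>\<^bsub>G\<^esub> v) = \<psi> u * \<psi> v)"


section \<open>Functions on \<open>\<Gamma>\<backslash>G\<close>\<close>

text \<open>Functions on \<open>\<Gamma>\<backslash>G\<close> are total functions on \<open>'g set\<close>, of which only the values at right
  cosets matter. As \<open>\<Gamma>\<close> is discrete, smoothness can be tested after composing with the covering
  map \<open>g \<mapsto> \<Gamma> g\<close>.\<close>

definition smooth_functions ::
    "('g::topological_space, 'l::euclidean_space) lie_structure \<Rightarrow> 'g set \<Rightarrow> ('g set \<Rightarrow> complex) set" where
  "smooth_functions G \<Gamma> = {f. smooth_map (atlas G) {(UNIV, id)} (\<lambda>g. f (\<Gamma> #>\<^bsub>G\<^esub> g))}"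

definition translate ::
    "('g, 'm) monoid_scheme \<Rightarrow> 'g \<Rightarrow> ('g set \<Rightarrow> complex) \<Rightarrow> 'g set \<Rightarrow> complex" where
  "translate G g f x = f (x #>\<^bsub>G\<^esub> g)"

definition right_deriv ::
    "('g, 'l::real_vector) lie_structure \<Rightarrow> 'l \<Rightarrow> ('g set \<Rightarrow> complex) \<Rightarrow> 'g set \<Rightarrow> complex" where
  "right_deriv G X f x = vector_derivative (\<lambda>s. f (x #>\<^bsub>G\<^esub> Exp G (s *\<^sub>R X))) (at 0)"

text \<open>Monomials in the basis \<open>B\<close> are words; the value is infinite if some derivative is unbounded.\<close>

definition sobolev_sup ::
    "('g, 'l::real_vector) lie_structure \<Rightarrow> 'g set \<Rightarrow> 'l set \<Rightarrow> nat \<Rightarrow> ('g set \<Rightarrow> complex) \<Rightarrow> ennreal" where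
  "sobolev_sup G \<Gamma> B d f =
     (\<Sum>w | set w \<subseteq> B \<and> length w \<le> d.
        SUP x\<in>rcosets\<^bsub>G\<^esub> \<Gamma>. ennreal (norm (foldr (right_deriv G) w f x)))"

definition inner_L2 :: "'x measure \<Rightarrow> ('x \<Rightarrow> complex) \<Rightarrow> ('x \<Rightarrow> complex) \<Rightarrow> complex" where
  "inner_L2 m f g = (\<integral>x. f x * cnj (g x) \<partial>m)"

definition orbit_stabilizer :: "('g, 'm) monoid_scheme \<Rightarrow> 'g set \<Rightarrow> 'g set \<Rightarrow> 'g set" where
  "orbit_stabilizer G U x = {u\<in>U. x #>\<^bsub>G\<^esub> u = x}"

end

theory Submission
  imports Defs
begin

text \<open>Fix \<open>E \<in> \<uu>\<close> with \<open>N E = 1\<close>, put \<open>u\<^sub>j = Exp (j E)\<close> and average \<open>f\<close> over finitely many translates,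
  \<open>F = 1/n \<Sum>\<^bsub>j<n\<^esub> \<psi>(u\<^sub>j) (u\<^sub>j \<cdot> f)\<close>. Since \<open>\<mu>\<close> is a \<open>\<psi>\<close>-twisted mean over a right invariant measure,
  \<open>\<mu>(F) = \<mu>(f)\<close>, and by Cauchy--Schwarz and equidistribution \<open>|\<mu>(f)|\<^sup>2 \<le> \<nu>(|F|\<^sup>2)\<close> is at most
  \<open>\<integral>|F|\<^sup>2 + O(exp (- \<kappa>\<^sub>2 T) S(|F|\<^sup>2))\<close>. Mixing bounds the integral by \<open>O(n powr (- \<kappa>) S(f)\<^sup>2)\<close> for every
  \<open>\<kappa> < \<kappa>\<^sub>1\<close> (the loss avoids a logarithm at \<open>\<kappa>\<^sub>1 = 1\<close>). Differentiating \<open>u\<^sub>j \<cdot> f\<close> along \<open>X\<close> amounts to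
  differentiating \<open>f\<close> along \<open>Ad(u\<^sub>j\<^sup>-\<^sup>1) X\<close>, which is polynomial in \<open>j\<close> of degree at most \<open>o\<close>; hence
  \<open>S(|F|\<^sup>2)\<close> is \<open>O(n ^ (2 o dim K) S(f)\<^sup>2)\<close>. The theorem follows with \<open>n\<close> of size
  \<open>exp (\<kappa>\<^sub>2 T / (2 o dim K + \<kappa>))\<close>. A finite average in place of an integral over \<open>[0, n]\<close> makes the
  smoothness of \<open>F\<close> immediate.\<close>

section \<open>Calculus of \<open>C\<^sup>k\<close> maps\<close>

text \<open>The exponent \<open>p = 2 o dim K\<close> arises as follows: each of up to
  \<open>dim K\<close> derivatives of a translate costs a factor of order \<open>n ^ o\<close>, and
  \<open>|F|\<^sup>2\<close> is a product of two such functions. The chosen size of \<open>n\<close>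
  is where \<open>n powr (- \<kappa>)\<close> and \<open>exp (- \<kappa>\<^sub>2 T) * n ^ p\<close>
  agree; passing from the square of the mean to the mean halves the resulting exponent, hence the 2
  in the denominator. The strict bound on \<open>\<kappa>\<^sub>3\<close> leaves the room to replace
  \<open>\<kappa>\<^sub>1\<close> by a smaller \<open>\<kappa>\<close>. Uniformity in
  \<open>\<psi>\<close> comes from unimodularity: the coefficients \<open>\<psi>(u\<^sub>j)\<close>
  disappear under absolute values. Since one direction \<open>E\<close> serves throughout, constants
  may depend on it. The main obstacle is measure-theoretic. The measure on a quotient is known only
  through the counting formula, while right invariance is used twice: for
  \<open>\<mu>(F) = \<mu>(f)\<close> on the quotient of \<open>U\<close>, and on the quotient of
  \<open>G\<close> to reduce correlations of two translates to one relative translate. It is proved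
  locally, on sets that meet each coset at most once.\<close>

lemma Ck_on_cong:
  assumes "open S" "\<And>x. x \<in> S \<Longrightarrow> f x = g x"
  shows "Ck_on k S f \<longleftrightarrow> Ck_on k S g"
  using assms(2)
proof (induction k arbitrary: f g)
  case 0
  then show ?case by (simp cong: continuous_on_cong)
next
  case (Suc k)
  have "f differentiable_on S \<longleftrightarrow> g differentiable_on S"
    using Suc.prems by (metis differentiable_on_def differentiable_transform_within zero_less_one)
  moreover have "frechet_derivative f (at x) = frechet_derivative g (at x)" if "x \<in> S" for x
  proof -
    have "(f has_derivative D) (at x) \<longleftrightarrow> (g has_derivative D) (at x)" for D
      using Suc.prems assms(1) that
      by (metis has_derivative_transform_within_open)
    then show ?thesis
      by (simp add: frechet_derivative_def)
  qed
  then have "Ck_on k S (\<lambda>x. frechet_derivative f (at x) v) \<longleftrightarrow> Ck_on k S (\<lambda>x. frechet_derivative g (at x) v)" for v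
    by (intro Suc.IH) simp
  ultimately show ?case by simp
qed

lemma Ck_on_subset: "Ck_on k T f \<Longrightarrow> S \<subseteq> T \<Longrightarrow> Ck_on k S f"
  by (induction k arbitrary: f) (auto intro: continuous_on_subset differentiable_on_subset)

lemma Ck_on_SucD: "Ck_on (Suc k) S f \<Longrightarrow> Ck_on k S f"
proof (induction k arbitrary: f)
  case 0
  then show ?case by (simp add: differentiable_imp_continuous_on)
next
  case (Suc k)
  then show ?case by (metis Ck_on.simps(2))
qed

text \<open>\<open>Ck_on\<close> differentiates with the filter \<open>at x\<close>, not within the
  set, so the derivatives seen on a neighbourhood \<open>T\<close> are literally those seen on
  \<open>S\<close> and the induction passes through.\<close>

lemma Ck_on_local:
  assumes "\<And>x. x \<in> S \<Longrightarrow> \<exists>T. open T \<and> x \<in> T \<and> Ck_on k T f"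
  shows "Ck_on k S f"
  using assms
proof (induction k arbitrary: f)
  case 0
  then show ?case
    by (metis Ck_on.simps(1) continuous_at_imp_continuous_on continuous_on_eq_continuous_at)
next
  case (Suc k)
  have "f differentiable_on S"
    unfolding differentiable_on_def
    using Suc.prems by (metis Ck_on.simps(2) differentiable_at_withinI differentiable_on_eq_differentiable_at)
  moreover have "Ck_on k S (\<lambda>x. frechet_derivative f (at x) v)" for v
    by (intro Suc.IH) (use Suc.prems in fastforce)
  ultimately show ?case by simp
qed

text \<open>Together with the elimination rule below, this lets the inductions work with any
  explicit family \<open>D\<close> of derivatives in place of
  \<open>frechet_derivative\<close>.\<close>

lemma Ck_on_SucI:
  assumes "open S" "\<And>x. x \<in> S \<Longrightarrow> (f has_derivative D x) (at x)" "\<And>v. Ck_on k S (\<lambda>x. D x v)"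
  shows "Ck_on (Suc k) S f"
proof -
  have "frechet_derivative f (at x) = D x" if "x \<in> S" for x
    using assms(2)[OF that] by (metis frechet_derivative_at)
  then have "Ck_on k S (\<lambda>x. frechet_derivative f (at x) v)" for v
    using assms(1,3) by (subst Ck_on_cong[where g = "\<lambda>x. D x v"]) auto
  moreover have "f differentiable_on S"
    using assms(1,2) by (auto simp: differentiable_on_eq_differentiable_at differentiable_def)
  ultimately show ?thesis by simp
qed

lemma Ck_on_SucE:
  assumes "open S" "Ck_on (Suc k) S f"
  obtains D where "\<And>x. x \<in> S \<Longrightarrow> (f has_derivative D x) (at x)" "\<And>v. Ck_on k S (\<lambda>x. D x v)"
  using assms that[of "\<lambda>x. frechet_derivative f (at x)"]
  by (auto simp: differentiable_on_eq_differentiable_at frechet_derivative_works)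

lemma Ck_on_const: "open S \<Longrightarrow> Ck_on k S (\<lambda>x. c)"
  by (induction k arbitrary: c) (auto intro!: Ck_on_SucI)

lemma Ck_on_bounded_linear_compose:
  assumes "bounded_linear h" "open S" "Ck_on k S f"
  shows "Ck_on k S (\<lambda>x. h (f x))"
  using assms(3)
proof (induction k arbitrary: f)
  case 0
  then show ?case
    using assms(1) by (simp add: bounded_linear.continuous_on)
next
  case (Suc k)
  from Ck_on_SucE[OF assms(2) Suc.prems] obtain D where
    D: "\<And>x. x \<in> S \<Longrightarrow> (f has_derivative D x) (at x)" "\<And>v. Ck_on k S (\<lambda>x. D x v)" by metis
  show ?case
    by (rule Ck_on_SucI[where D = "\<lambda>x v. h (D x v)"])
      (use D Suc.IH assms in \<open>auto intro: bounded_linear.has_derivative\<close>)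
qed

lemma Ck_on_bounded_linear:
  assumes "bounded_linear h" "open S"
  shows "Ck_on k S h"
proof (cases k)
  case 0
  then show ?thesis
    using assms by (simp add: linear_continuous_on)
next
  case (Suc k')
  show ?thesis
    unfolding Suc
    by (rule Ck_on_SucI[where D = "\<lambda>x. h"])
      (use assms in \<open>auto intro: bounded_linear_imp_has_derivative Ck_on_const\<close>)
qed

lemma Ck_on_add:
  assumes "open S" "Ck_on k S f" "Ck_on k S g"
  shows "Ck_on k S (\<lambda>x. f x + g x)"
  using assms(2,3)
proof (induction k arbitrary: f g)
  case 0
  then show ?case by (simp add: continuous_on_add)
next
  case (Suc k)
  from Ck_on_SucE[OF assms(1) Suc.prems(1)] obtain D where
    D: "\<And>x. x \<in> S \<Longrightarrow> (f has_derivative D x) (at x)" "\<And>v. Ck_on k S (\<lambda>x. D x v)" by metis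
  from Ck_on_SucE[OF assms(1) Suc.prems(2)] obtain D' where
    D': "\<And>x. x \<in> S \<Longrightarrow> (g has_derivative D' x) (at x)" "\<And>v. Ck_on k S (\<lambda>x. D' x v)" by metis
  show ?case
    by (rule Ck_on_SucI[where D = "\<lambda>x v. D x v + D' x v"])
      (use D D' Suc.IH assms(1) in \<open>auto intro: has_derivative_add\<close>)
qed

lemma Ck_on_sum:
  assumes "open S" "finite I" "\<And>i. i \<in> I \<Longrightarrow> Ck_on k S (f i)"
  shows "Ck_on k S (\<lambda>x. \<Sum>i\<in>I. f i x)"
  using assms(2,3) by induction (auto intro: Ck_on_const Ck_on_add assms(1))

lemma Ck_on_bilinear:
  assumes "bounded_bilinear bop" "open S" "Ck_on k S f" "Ck_on k S g"
  shows "Ck_on k S (\<lambda>x. bop (f x) (g x))"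
  using assms(3,4)
proof (induction k arbitrary: f g)
  case 0
  then show ?case
    using assms(1) by (simp add: bounded_bilinear.continuous_on)
next
  case (Suc k)
  from Ck_on_SucE[OF assms(2) Suc.prems(1)] obtain D where
    D: "\<And>x. x \<in> S \<Longrightarrow> (f has_derivative D x) (at x)" "\<And>v. Ck_on k S (\<lambda>x. D x v)" by metis
  from Ck_on_SucE[OF assms(2) Suc.prems(2)] obtain D' where
    D': "\<And>x. x \<in> S \<Longrightarrow> (g has_derivative D' x) (at x)" "\<And>v. Ck_on k S (\<lambda>x. D' x v)" by metis
  show ?case
    by (rule Ck_on_SucI[where D = "\<lambda>x v. bop (f x) (D' x v) + bop (D x v) (g x)"])
      (use D D' Suc.IH Suc.prems[THEN Ck_on_SucD] assms(2)
        in \<open>auto intro!: bounded_bilinear.FDERIV[OF assms(1)] Ck_on_add simp del: Ck_on.simps\<close>)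
qed

text \<open>The chain rule yields \<open>D' (f x) (D x v)\<close>, where the operator and its
  argument both vary with \<open>x\<close>. Expanding \<open>D x v\<close> in \<open>Basis\<close>
  leaves products of a scalar with \<open>D' (f x) b\<close>, and the latter is again a composition
  with \<open>f\<close>, of one order less.\<close>

lemma Ck_on_compose:
  fixes f :: "'a::euclidean_space \<Rightarrow> 'b::euclidean_space" and g :: "'b \<Rightarrow> 'c::real_normed_vector"
  assumes "open S" "open T" "f ` S \<subseteq> T" "Ck_on k S f" "Ck_on k T g"
  shows "Ck_on k S (\<lambda>x. g (f x))"
  using assms(4,5)
proof (induction k arbitrary: g)
  case 0
  then show ?case
    using assms(3) by (auto intro: continuous_on_compose2)
next
  case (Suc k)
  from Ck_on_SucE[OF assms(1) Suc.prems(1)] obtain D where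
    D: "\<And>x. x \<in> S \<Longrightarrow> (f has_derivative D x) (at x)" "\<And>v. Ck_on k S (\<lambda>x. D x v)" by metis
  from Ck_on_SucE[OF assms(2) Suc.prems(2)] obtain D' where
    D': "\<And>x. x \<in> T \<Longrightarrow> (g has_derivative D' x) (at x)" "\<And>v. Ck_on k T (\<lambda>x. D' x v)" by metis
  have eq: "D' (f x) (D x v) = (\<Sum>b\<in>Basis. (D x v \<bullet> b) *\<^sub>R D' (f x) b)" if "x \<in> S" for x v
  proof -
    have "linear (D' (f x))"
      using D'(1) assms(3) that has_derivative_linear by blast
    then have "D' (f x) (\<Sum>b\<in>Basis. (D x v \<bullet> b) *\<^sub>R b) = (\<Sum>b\<in>Basis. (D x v \<bullet> b) *\<^sub>R D' (f x) b)"
      by (simp add: linear_sum linear_cmul)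
    then show ?thesis by (simp add: euclidean_representation)
  qed
  show ?case
  proof (rule Ck_on_SucI[where D = "\<lambda>x v. D' (f x) (D x v)"])
    show "((\<lambda>x. g (f x)) has_derivative (\<lambda>v. D' (f x) (D x v))) (at x)" if "x \<in> S" for x
      using has_derivative_compose[OF D(1)[OF that] D'(1)] assms(3) that by blast
    have "Ck_on k S (\<lambda>x. D' (f x) b)" for b
      by (rule Suc.IH[OF Ck_on_SucD[OF Suc.prems(1)] D'(2)])
    then have "Ck_on k S (\<lambda>x. \<Sum>b\<in>Basis. (D x v \<bullet> b) *\<^sub>R D' (f x) b)" for v
      using D D' Suc.IH Suc.prems[THEN Ck_on_SucD] assms(1)
      by (intro Ck_on_sum Ck_on_bilinear[OF bounded_bilinear_scaleR]
          Ck_on_bounded_linear_compose[OF bounded_linear_inner_left]) auto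
    then show "Ck_on k S (\<lambda>x. D' (f x) (D x v))" for v
      using assms(1) eq by (subst Ck_on_cong[OF assms(1) eq]) auto
  qed (fact assms)
qed

lemma Ck_on_Pair:
  assumes "open S" "Ck_on k S f" "Ck_on k S g"
  shows "Ck_on k S (\<lambda>x. (f x, g x))"
proof -
  have "bounded_linear (\<lambda>y. (y, 0))" "bounded_linear (\<lambda>y. (0, y))"
    by (simp_all add: bounded_linear_Pair bounded_linear_ident)
  then have "Ck_on k S (\<lambda>x. (f x, 0) + (0, g x))"
    using assms by (intro Ck_on_add) (auto intro: Ck_on_bounded_linear_compose[where h="\<lambda>y. (y, 0)"] Ck_on_bounded_linear_compose[where h="\<lambda>y. (0, y)"])
  then show ?thesis by simp
qed

lemma smooth_on_imp_has_derivative: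
  assumes "open S" "smooth_on S f" "x \<in> S"
  shows "(f has_derivative frechet_derivative f (at x)) (at x)"
proof -
  have "Ck_on (Suc 0) S f"
    using assms(2) by (simp only: smooth_on_def)
  then show ?thesis
    using assms by (simp add: differentiable_on_eq_differentiable_at frechet_derivative_works)
qed

lemma smooth_on_frechet_derivative:
  assumes "smooth_on S f"
  shows "smooth_on S (\<lambda>x. frechet_derivative f (at x) v)"
proof -
  have "Ck_on (Suc k) S f" for k
    using assms by (simp only: smooth_on_def)
  then show ?thesis by (simp add: smooth_on_def)
qed

lemma smooth_on_cong: "open S \<Longrightarrow> (\<And>x. x \<in> S \<Longrightarrow> f x = g x) \<Longrightarrow> smooth_on S f \<longleftrightarrow> smooth_on S g"
  unfolding smooth_on_def by (metis Ck_on_cong)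

lemma smooth_on_subset: "smooth_on T f \<Longrightarrow> S \<subseteq> T \<Longrightarrow> smooth_on S f"
  unfolding smooth_on_def using Ck_on_subset by blast

lemma smooth_on_compose:
  fixes f :: "'a::euclidean_space \<Rightarrow> 'b::euclidean_space" and g :: "'b \<Rightarrow> 'c::real_normed_vector"
  assumes "open S" "open T" "f ` S \<subseteq> T" "smooth_on S f" "smooth_on T g"
  shows "smooth_on S (\<lambda>x. g (f x))"
  using Ck_on_compose[OF assms(1-3)] assms(4,5) by (auto simp: smooth_on_def)

lemma smooth_on_local:
  assumes "\<And>x. x \<in> S \<Longrightarrow> \<exists>T. open T \<and> x \<in> T \<and> smooth_on T f"
  shows "smooth_on S f"
  unfolding smooth_on_def
proof
  show "Ck_on k S f" for k
    by (rule Ck_on_local) (use assms in \<open>auto simp: smooth_on_def\<close>)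
qed

section \<open>Smooth maps between manifolds\<close>

text \<open>This is \<open>smooth_atlas\<close> without compatibility of charts.
  \<open>smooth_map\<close> quantifies over all pairs of charts, so compositions need only this
  much, and it is readily checked for products and for the trivial atlas.\<close>

definition topological_atlas :: "('g::topological_space, 'l::euclidean_space) chart set \<Rightarrow> bool" where
  "topological_atlas A \<longleftrightarrow>
     (\<Union>(V, \<phi>)\<in>A. V) = UNIV \<and>
     (\<forall>(V, \<phi>)\<in>A. open V \<and> open (\<phi> ` V) \<and> homeomorphism V (\<phi> ` V) \<phi> (inv_into V \<phi>))"

lemma topological_atlas_covers:
  assumes "topological_atlas A"
  obtains V \<phi> where "(V, \<phi>) \<in> A" "p \<in> V"
  using assms by (force simp: topological_atlas_def)

lemma topological_atlasD:
  assumes "topological_atlas A" "(V, \<phi>) \<in> A"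
  shows "open V" "open (\<phi> ` V)" "homeomorphism V (\<phi> ` V) \<phi> (inv_into V \<phi>)"
  using assms by (auto simp: topological_atlas_def)

lemma topological_atlas_inv:
  assumes "topological_atlas A" "(V, \<phi>) \<in> A" "p \<in> V"
  shows "inv_into V \<phi> (\<phi> p) = p"
  using topological_atlasD(3)[OF assms(1,2)] assms(3) by (simp add: homeomorphism_apply1)

lemma topological_atlas_open_image:
  assumes "topological_atlas A" "(V, \<phi>) \<in> A" "open O'"
  shows "open (\<phi> ` (V \<inter> O'))"
proof -
  have "openin (top_of_set (\<phi> ` V)) (\<phi> ` (V \<inter> O'))"
    using topological_atlasD(3)[OF assms(1,2)] assms(3)
    by (intro homeomorphism_imp_open_map[where S = V]) (auto simp: openin_open_Int)
  then show ?thesis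
    using topological_atlasD(2)[OF assms(1,2)] openin_open_trans by blast
qed

lemma smooth_mapD:
  assumes "smooth_map A B f" "(V, \<phi>) \<in> A" "(W, \<theta>) \<in> B"
  shows "smooth_on (\<phi> ` (V \<inter> f -` W)) (\<lambda>v. \<theta> (f (inv_into V \<phi> v)))"
  using assms by (fastforce simp: smooth_map_def o_def)

lemma smooth_mapI:
  assumes "continuous_on UNIV f"
    and "\<And>V \<phi> W \<theta>. (V, \<phi>) \<in> A \<Longrightarrow> (W, \<theta>) \<in> B \<Longrightarrow>
      smooth_on (\<phi> ` (V \<inter> f -` W)) (\<lambda>v. \<theta> (f (inv_into V \<phi> v)))"
  shows "smooth_map A B f"
  using assms by (auto simp: smooth_map_def o_def)

lemma smooth_map_continuous: "smooth_map A B f \<Longrightarrow> continuous_on UNIV f"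
  by (simp add: smooth_map_def)

text \<open>Near \<open>p\<close> the composite factors through any chart of \<open>B\<close> around
  \<open>f p\<close>; both factors are smooth in that chart, and smoothness is local.\<close>

lemma smooth_map_compose:
  assumes A: "topological_atlas A" and B: "topological_atlas B"
    and C: "topological_atlas C"
    and f: "smooth_map A B f" and g: "smooth_map B C g"
  shows "smooth_map A C (\<lambda>x. g (f x))"
proof (rule smooth_mapI)
  show "continuous_on UNIV (\<lambda>x. g (f x))"
    using continuous_on_compose2[OF smooth_map_continuous[OF g] smooth_map_continuous[OF f]] by simp
  fix V \<phi> W \<xi> assume V: "(V, \<phi>) \<in> A" and W: "(W, \<xi>) \<in> C"
  show "smooth_on (\<phi> ` (V \<inter> (\<lambda>x. g (f x)) -` W)) (\<lambda>v. \<xi> (g (f (inv_into V \<phi> v))))"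
  proof (rule smooth_on_local)
      fix x assume "x \<in> \<phi> ` (V \<inter> (\<lambda>x. g (f x)) -` W)"
      then obtain p where p: "x = \<phi> p" "p \<in> V" "g (f p) \<in> W" by auto
      obtain Y \<theta> where Y: "(Y, \<theta>) \<in> B" "f p \<in> Y"
        using topological_atlas_covers[OF B] .
      let ?T = "\<phi> ` (V \<inter> f -` (Y \<inter> g -` W))" and ?T' = "\<theta> ` (Y \<inter> g -` W)"
      have o1: "open (Y \<inter> g -` W)"
        using topological_atlasD(1)[OF B Y(1)] topological_atlasD(1)[OF C W] smooth_map_continuous[OF g]
        by (simp add: open_Int open_vimage)
      then have T: "open ?T"
        using smooth_map_continuous[OF f] by (intro topological_atlas_open_image[OF A V] open_vimage)
      have T': "open ?T'"
        using smooth_map_continuous[OF g] topological_atlasD(1)[OF C W] by (intro topological_atlas_open_image[OF B Y(1)] open_vimage)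
      have "smooth_on ?T (\<lambda>v. \<theta> (f (inv_into V \<phi> v)))"
        using smooth_mapD[OF f V Y(1)] by (rule smooth_on_subset) auto
      moreover have "smooth_on ?T' (\<lambda>w. \<xi> (g (inv_into Y \<theta> w)))"
        using smooth_mapD[OF g Y(1) W] .
      moreover have "(\<lambda>v. \<theta> (f (inv_into V \<phi> v))) ` ?T \<subseteq> ?T'"
        by (auto simp: topological_atlas_inv[OF A V])
      ultimately have "smooth_on ?T (\<lambda>v. \<xi> (g (inv_into Y \<theta> (\<theta> (f (inv_into V \<phi> v))))))"
        by (rule smooth_on_compose[OF T T', rotated 1])
      then have "smooth_on ?T (\<lambda>v. \<xi> (g (f (inv_into V \<phi> v))))"
        by (rule smooth_on_cong[OF T, THEN iffD1, rotated])
          (auto simp: topological_atlas_inv[OF A V] topological_atlas_inv[OF B Y(1)])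
      then show "\<exists>T. open T \<and> x \<in> T \<and> smooth_on T (\<lambda>v. \<xi> (g (f (inv_into V \<phi> v))))"
        using T p Y(2) by blast
    qed
qed

lemma topological_atlas_UNIV: "topological_atlas {(UNIV, id)}"
  by (auto simp: topological_atlas_def homeomorphism_def inv_id)

section \<open>Products of atlases and maps into them\<close>

lemma continuous_on_map_prod:
  assumes "continuous_on A p" "continuous_on B q"
  shows "continuous_on (A \<times> B) (map_prod p q)"
  unfolding map_prod_def case_prod_unfold
  by (intro continuous_on_Pair continuous_on_compose2[OF assms(1)] continuous_on_compose2[OF assms(2)]
      continuous_on_fst continuous_on_snd continuous_on_id) auto

lemma homeomorphism_map_prod:
  assumes "homeomorphism V V' f f'" "homeomorphism W W' g g'"
  shows "homeomorphism (V \<times> W) (V' \<times> W') (map_prod f g) (map_prod f' g')"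
  using assms by (auto simp: homeomorphism_def map_prod_surj_on continuous_on_map_prod)

lemma inv_into_map_prod:
  assumes "inj_on f V" "inj_on g W" "y \<in> f ` V" "z \<in> g ` W"
  shows "inv_into (V \<times> W) (map_prod f g) (y, z) = (inv_into V f y, inv_into W g z)"
proof -
  have "map_prod f g (inv_into V f y, inv_into W g z) = (y, z)"
    using assms by (simp add: f_inv_into_f)
  moreover have "(inv_into V f y, inv_into W g z) \<in> V \<times> W"
    using assms by (simp add: inv_into_into)
  ultimately show ?thesis
    using map_prod_inj_on[OF assms(1,2)] by (metis inv_into_f_f)
qed

lemma topological_atlas_inj:
  assumes "topological_atlas A" "(V, \<phi>) \<in> A"
  shows "inj_on \<phi> V"
  using topological_atlas_inv[OF assms] by (metis inj_onI)

lemma topological_atlas_prod: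
  assumes A: "topological_atlas A" and B: "topological_atlas B"
  shows "topological_atlas (prod_atlas A B)"
  unfolding topological_atlas_def
proof (intro conjI ballI, goal_cases)
  case 1
  have "\<exists>C\<in>prod_atlas A B. (p, q) \<in> fst C" for p q
  proof -
    obtain V \<phi> where "(V, \<phi>) \<in> A" "p \<in> V" using topological_atlas_covers[OF A] .
    moreover obtain W \<theta> where "(W, \<theta>) \<in> B" "q \<in> W" using topological_atlas_covers[OF B] .
    ultimately have "(V \<times> W, map_prod \<phi> \<theta>) \<in> prod_atlas A B \<and> (p, q) \<in> V \<times> W"
      by (auto simp: prod_atlas_def)
    then show ?thesis by (metis fst_conv)
  qed
  then show ?case by (auto simp: case_prod_unfold)
next
  case (2 C)
  then obtain V \<phi> W \<theta> where C: "C = (V \<times> W, map_prod \<phi> \<theta>)" "(V, \<phi>) \<in> A" "(W, \<theta>) \<in> B"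
    by (auto simp: prod_atlas_def)
  note a = topological_atlasD[OF A C(2)] and b = topological_atlasD[OF B C(3)]
  have img: "map_prod \<phi> \<theta> ` (V \<times> W) = \<phi> ` V \<times> \<theta> ` W"
    by (simp add: map_prod_surj_on)
  have "homeomorphism (V \<times> W) (\<phi> ` V \<times> \<theta> ` W) (map_prod \<phi> \<theta>) (inv_into (V \<times> W) (map_prod \<phi> \<theta>))"
    using homeomorphism_map_prod[OF a(3) b(3)]
    by (rule homeomorphism_cong)
      (auto simp: inv_into_map_prod topological_atlas_inj[OF A C(2)] topological_atlas_inj[OF B C(3)])
  then show ?case
    using a b by (simp add: C img open_Times)
qed

lemma smooth_map_Pair:
  assumes A: "topological_atlas A" and B: "topological_atlas B" and C: "topological_atlas C"
    and f: "smooth_map A B f" and g: "smooth_map A C g"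
  shows "smooth_map A (prod_atlas B C) (\<lambda>x. (f x, g x))"
proof (rule smooth_mapI)
  show "continuous_on UNIV (\<lambda>x. (f x, g x))"
    using f g by (intro continuous_on_Pair smooth_map_continuous)
  fix V \<phi> W \<theta> assume V: "(V, \<phi>) \<in> A" and W: "(W, \<theta>) \<in> prod_atlas B C"
  then obtain Y \<eta> Z \<zeta> where Y: "W = Y \<times> Z" "\<theta> = map_prod \<eta> \<zeta>" "(Y, \<eta>) \<in> B" "(Z, \<zeta>) \<in> C"
    by (auto simp: prod_atlas_def)
  let ?T = "\<phi> ` (V \<inter> (\<lambda>x. (f x, g x)) -` W)"
  have eq: "(\<lambda>x. (f x, g x)) -` W = f -` Y \<inter> g -` Z" by (auto simp: Y)
  have T: "open ?T"
    unfolding eq using topological_atlasD(1)[OF B Y(3)] topological_atlasD(1)[OF C Y(4)]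
    by (intro topological_atlas_open_image[OF A V] open_Int open_vimage smooth_map_continuous[OF f] smooth_map_continuous[OF g])
  have "smooth_on ?T (\<lambda>v. \<eta> (f (inv_into V \<phi> v)))"
    using smooth_mapD[OF f V Y(3)] by (rule smooth_on_subset) (auto simp: Y)
  moreover have "smooth_on ?T (\<lambda>v. \<zeta> (g (inv_into V \<phi> v)))"
    using smooth_mapD[OF g V Y(4)] by (rule smooth_on_subset) (auto simp: Y)
  ultimately have "smooth_on ?T (\<lambda>v. (\<eta> (f (inv_into V \<phi> v)), \<zeta> (g (inv_into V \<phi> v))))"
    using T by (simp add: smooth_on_def Ck_on_Pair)
  then show "smooth_on ?T (\<lambda>v. \<theta> (f (inv_into V \<phi> v), g (inv_into V \<phi> v)))"
    by (simp add: Y(2))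
qed

lemma smooth_map_const:
  assumes A: "topological_atlas A" and B: "topological_atlas B"
  shows "smooth_map A B (\<lambda>_. c)"
proof (rule smooth_mapI)
  fix V \<phi> W \<theta> assume V: "(V, \<phi>) \<in> A" and W: "(W, \<theta>) \<in> B"
  have "open (\<phi> ` (V \<inter> (\<lambda>_. c) -` W))"
    by (intro topological_atlas_open_image[OF A V] open_vimage topological_atlasD(1)[OF B W]) simp
  then show "smooth_on (\<phi> ` (V \<inter> (\<lambda>_. c) -` W)) (\<lambda>v. \<theta> c)"
    by (simp add: smooth_on_def Ck_on_const)
qed simp

text \<open>Continuity, a separate clause of \<open>smooth_map\<close>, follows from order 0 in the
  charts, which are open and cover. Closure properties of smooth functions can then be checked chart
  by chart.\<close>

lemma smooth_map_UNIV_iff: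
  assumes A: "topological_atlas A"
  shows "smooth_map A {(UNIV, id)} F \<longleftrightarrow> (\<forall>(V, \<phi>)\<in>A. smooth_on (\<phi> ` V) (\<lambda>v. F (inv_into V \<phi> v)))"
    (is "_ \<longleftrightarrow> ?R")
proof
  assume R: ?R
  have "continuous_on V F" if V: "(V, \<phi>) \<in> A" for V \<phi>
  proof -
    have "Ck_on 0 (\<phi> ` V) (\<lambda>v. F (inv_into V \<phi> v))"
      using R V unfolding smooth_on_def by blast
    then have "continuous_on V (\<lambda>x. F (inv_into V \<phi> (\<phi> x)))"
      using topological_atlasD(3)[OF A V]
      by (intro continuous_on_compose2[of "\<phi> ` V" "\<lambda>v. F (inv_into V \<phi> v)" V \<phi>])
        (auto simp: homeomorphism_def)
    then show ?thesis
      by (simp add: topological_atlas_inv[OF A V] cong: continuous_on_cong)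
  qed
  then have "continuous_on (\<Union>C\<in>A. fst C) F"
    using topological_atlasD(1)[OF A] by (intro continuous_on_open_UN) auto
  moreover have "(\<Union>C\<in>A. fst C) = UNIV"
    using A by (simp add: topological_atlas_def case_prod_unfold)
  ultimately have "continuous_on UNIV F" by simp
  then show "smooth_map A {(UNIV, id)} F"
    using R by (auto simp: smooth_map_def o_def)
qed (auto simp: smooth_map_def o_def)

lemma smooth_map_UNIVD:
  "topological_atlas A \<Longrightarrow> smooth_map A {(UNIV, id)} F \<Longrightarrow> (V, \<phi>) \<in> A \<Longrightarrow>
    smooth_on (\<phi> ` V) (\<lambda>v. F (inv_into V \<phi> v))"
  using smooth_map_UNIV_iff by blast

lemma smooth_map_UNIV_bounded_linear:
  assumes A: "topological_atlas A" and h: "bounded_linear h" and F: "smooth_map A {(UNIV, id)} F"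
  shows "smooth_map A {(UNIV, id)} (\<lambda>x. h (F x))"
proof -
  have "smooth_on (\<phi> ` V) (\<lambda>v. h (F (inv_into V \<phi> v)))" if "(V, \<phi>) \<in> A" for V \<phi>
    using smooth_map_UNIVD[OF A F that] Ck_on_bounded_linear_compose[OF h topological_atlasD(2)[OF A that]]
    unfolding smooth_on_def by blast
  then show ?thesis by (auto simp: smooth_map_UNIV_iff[OF A])
qed

lemma smooth_map_UNIV_bilinear:
  assumes A: "topological_atlas A" and bop: "bounded_bilinear bop"
    and F: "smooth_map A {(UNIV, id)} F" "smooth_map A {(UNIV, id)} F'"
  shows "smooth_map A {(UNIV, id)} (\<lambda>x. bop (F x) (F' x))"
proof -
  have "smooth_on (\<phi> ` V) (\<lambda>v. bop (F (inv_into V \<phi> v)) (F' (inv_into V \<phi> v)))" if "(V, \<phi>) \<in> A" for V \<phi>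
    using F[THEN smooth_map_UNIVD[OF A _ that]] Ck_on_bilinear[OF bop topological_atlasD(2)[OF A that]]
    unfolding smooth_on_def by blast
  then show ?thesis by (auto simp: smooth_map_UNIV_iff[OF A])
qed

lemma smooth_map_UNIV_add:
  assumes A: "topological_atlas A"
    and F: "smooth_map A {(UNIV, id)} F" "smooth_map A {(UNIV, id)} F'"
  shows "smooth_map A {(UNIV, id)} (\<lambda>x. F x + F' x)"
proof -
  have "smooth_on (\<phi> ` V) (\<lambda>v. F (inv_into V \<phi> v) + F' (inv_into V \<phi> v))" if "(V, \<phi>) \<in> A" for V \<phi>
    using F[THEN smooth_map_UNIVD[OF A _ that]] Ck_on_add[OF topological_atlasD(2)[OF A that]]
    unfolding smooth_on_def by blast
  then show ?thesis by (auto simp: smooth_map_UNIV_iff[OF A])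
qed

section \<open>Derivatives along the Lie algebra\<close>

abbreviation smooth_fun :: "('g::topological_space, 'l::euclidean_space) lie_structure \<Rightarrow> ('g \<Rightarrow> complex) \<Rightarrow> bool" where
  "smooth_fun G F \<equiv> smooth_map (atlas G) {(UNIV, id)} F"

text \<open>The counterpart of \<open>right_deriv\<close> on the group itself: all calculus is done
  there, on pullbacks along the projection to cosets.\<close>

definition lie_deriv :: "('g, 'l::real_vector) lie_structure \<Rightarrow> 'l \<Rightarrow> ('g \<Rightarrow> complex) \<Rightarrow> 'g \<Rightarrow> complex" where
  "lie_deriv G X F g = vector_derivative (\<lambda>s. F (g \<otimes>\<^bsub>G\<^esub> Exp G (s *\<^sub>R X))) (at 0)"

section \<open>Lie groups: operations, curves through the identity, left-invariant
  derivatives\<close>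

locale lie_grp =
  fixes G :: "('g::{t2_space,second_countable_topology}, 'l::euclidean_space) lie_structure" (structure)
  assumes lie: "lie_group G"
begin

sublocale group G
  using lie by (simp add: lie_group_def)

lemma carrier_UNIV [simp]: "carrier G = UNIV"
  using lie by (simp add: lie_group_def)

lemma in_carrier [simp, intro]: "x \<in> carrier G"
  by simp

lemma topological_atlas: "topological_atlas (atlas G)"
  using lie by (simp add: lie_group_def smooth_atlas_def topological_atlas_def)

lemma smooth_map_ident: "smooth_map (atlas G) (atlas G) (\<lambda>x. x)"
  using lie by (simp add: lie_group_def smooth_atlas_def id_def)

lemma smooth_map_mult: "smooth_map (prod_atlas (atlas G) (atlas G)) (atlas G) (\<lambda>p. fst p \<otimes> snd p)"
  using lie by (simp add: lie_group_def case_prod_unfold)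

lemma continuous_mult: "continuous_on S (\<lambda>p. fst p \<otimes> snd p)"
  using smooth_map_continuous[OF smooth_map_mult] by (rule continuous_on_subset) simp

lemma continuous_inv: "continuous_on S (\<lambda>x. inv x)"
  using lie by (intro continuous_on_subset[OF smooth_map_continuous]) (auto simp: lie_group_def)

lemma smooth_map_lmult: "smooth_map (atlas G) (atlas G) (\<lambda>x. g \<otimes> x)"
  using smooth_map_compose[OF topological_atlas topological_atlas_prod[OF topological_atlas topological_atlas] topological_atlas
      smooth_map_Pair[OF topological_atlas topological_atlas topological_atlas
        smooth_map_const[OF topological_atlas topological_atlas] smooth_map_ident] smooth_map_mult]
  by simp

lemma smooth_map_rmult: "smooth_map (atlas G) (atlas G) (\<lambda>x. x \<otimes> g)"
  using smooth_map_compose[OF topological_atlas topological_atlas_prod[OF topological_atlas topological_atlas] topological_atlas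
      smooth_map_Pair[OF topological_atlas topological_atlas topological_atlas
        smooth_map_ident smooth_map_const[OF topological_atlas topological_atlas]] smooth_map_mult]
  by simp

lemma id_chart: "(fst (id_chart G), coord G) \<in> atlas G" "\<one> \<in> fst (id_chart G)"
  using lie by (simp_all add: lie_group_def coord_def)

lemma coord_inv_eq: "coord_inv G = inv_into (fst (id_chart G)) (coord G)"
  by (simp add: coord_inv_def coord_def)

lemma coord_inv_coord: "x \<in> fst (id_chart G) \<Longrightarrow> coord_inv G (coord G x) = x"
  unfolding coord_inv_eq by (rule topological_atlas_inv[OF topological_atlas id_chart(1)])

lemma open_id_chart: "open (fst (id_chart G))" "open (coord G ` fst (id_chart G))"
  using topological_atlasD[OF topological_atlas id_chart(1)] by simp_all

lemma
  shows continuous_Exp: "continuous_on UNIV (\<lambda>s::real. Exp G (s *\<^sub>R X))"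
    and Exp_add: "Exp G ((s + t) *\<^sub>R X) = Exp G (s *\<^sub>R X) \<otimes> Exp G (t *\<^sub>R X)"
    and Exp_deriv: "((\<lambda>s. coord G (Exp G (s *\<^sub>R X))) has_vector_derivative X) (at 0)"
  using lie by (auto simp: lie_group_def)

lemma Exp_0 [simp]: "Exp G 0 = \<one>"
proof -
  have "Exp G 0 = Exp G 0 \<otimes> Exp G 0"
    using Exp_add[of 0 0 0] by simp
  then show ?thesis
    by (metis in_carrier l_cancel_one')
qed

lemma Exp_uminus: "inv (Exp G X) = Exp G (- X)"
proof -
  have "Exp G (- X) \<otimes> Exp G X = \<one>"
    using Exp_add[of "-1" 1 X] by simp
  then show ?thesis
    by (intro inv_equality) auto
qed

lemma smooth_fun_lmult: "smooth_fun G F \<Longrightarrow> smooth_fun G (\<lambda>x. F (g \<otimes> x))"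
  using smooth_map_compose[OF topological_atlas topological_atlas topological_atlas_UNIV smooth_map_lmult] .

lemma smooth_fun_rmult: "smooth_fun G F \<Longrightarrow> smooth_fun G (\<lambda>x. F (x \<otimes> g))"
  using smooth_map_compose[OF topological_atlas topological_atlas topological_atlas_UNIV smooth_map_rmult] .

text \<open>Only the velocity of the curve in the identity chart matters. This makes derivatives
  along different curves with the same velocity interchangeable, whether or not they are
  one-parameter subgroups.\<close>

lemma curve_has_derivative:
  assumes kk: "smooth_on T (\<lambda>v. f (coord_inv G v))" "open T" "coord G \<one> \<in> T"
    and c: "continuous_on UNIV c" "c 0 = \<one>" "((\<lambda>s. coord G (c s)) has_vector_derivative X) (at 0)"
  shows "((\<lambda>s. f (c s)) has_vector_derivative frechet_derivative (\<lambda>v. f (coord_inv G v)) (at (coord G \<one>)) X) (at 0)"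
proof -
  let ?D = "frechet_derivative (\<lambda>v. f (coord_inv G v)) (at (coord G \<one>))"
  have D: "((\<lambda>v. f (coord_inv G v)) has_derivative ?D) (at (coord G (c 0)))"
    using smooth_on_imp_has_derivative[OF kk(2,1,3)] by (simp add: c(2))
  have "((\<lambda>s. f (coord_inv G (coord G (c s)))) has_derivative (\<lambda>s. ?D (s *\<^sub>R X))) (at 0)"
    using has_derivative_compose[OF c(3)[unfolded has_vector_derivative_def] D] by simp
  \<comment> \<open>\<open>coord_inv\<close> undoes \<open>coord\<close> only inside the chart; by
    continuity the curve stays there for small \<open>s\<close>.\<close>
  then have "((\<lambda>s. f (c s)) has_derivative (\<lambda>s. ?D (s *\<^sub>R X))) (at 0)"
    by (rule has_derivative_transform_within_open[where s = "c -` fst (id_chart G)"])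
      (use c id_chart(2) in \<open>auto simp: coord_inv_coord intro!: open_vimage open_id_chart\<close>)
  moreover have "linear ?D"
    by (rule has_derivative_linear[OF D])
  ultimately show ?thesis
    by (simp add: has_vector_derivative_def linear_cmul)
qed

lemma coord_one: "coord G \<one> \<in> coord G ` fst (id_chart G)"
  using id_chart by simp

lemma smooth_on_id_chart:
  assumes "smooth_fun G F"
  shows "smooth_on (coord G ` fst (id_chart G)) (\<lambda>v. F (coord_inv G v))"
  using smooth_map_UNIVD[OF topological_atlas assms id_chart(1)] by (simp add: coord_inv_eq)

text \<open>The differential at the identity of \<open>x \<mapsto> F (g x)\<close>, evaluated at
  \<open>X\<close>. In this form linearity in \<open>X\<close> and smoothness in \<open>g\<close>
  become accessible.\<close>

lemma lie_deriv_eq: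
  assumes "smooth_fun G F"
  shows "lie_deriv G X F g = frechet_derivative (\<lambda>v. F (g \<otimes> coord_inv G v)) (at (coord G \<one>)) X"
  unfolding lie_deriv_def
proof (rule vector_derivative_at)
  show "((\<lambda>s. F (g \<otimes> Exp G (s *\<^sub>R X))) has_vector_derivative
      frechet_derivative (\<lambda>v. F (g \<otimes> coord_inv G v)) (at (coord G \<one>)) X) (at 0)"
    by (rule curve_has_derivative[where f = "\<lambda>x. F (g \<otimes> x)", OF smooth_on_id_chart[OF smooth_fun_lmult[OF assms]]
        open_id_chart(2) coord_one continuous_Exp _ Exp_deriv]) simp
qed

lemma lie_deriv_curve:
  assumes F: "smooth_fun G F" 
    and c: "continuous_on UNIV c" "c 0 = \<one>" "((\<lambda>s. coord G (c s)) has_vector_derivative X) (at 0)"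
  shows "((\<lambda>s. F (g \<otimes> c s)) has_vector_derivative lie_deriv G X F g) (at 0)"
  unfolding lie_deriv_eq[OF F]
  using curve_has_derivative[where f = "\<lambda>x. F (g \<otimes> x)", OF smooth_on_id_chart[OF smooth_fun_lmult[OF F]]
        open_id_chart(2) coord_one c] .

lemma lie_deriv_Exp:
  assumes F: "smooth_fun G F"
  shows "((\<lambda>s. F (g \<otimes> Exp G (s *\<^sub>R X))) has_vector_derivative lie_deriv G X F g) (at 0)"
  by (rule lie_deriv_curve[OF F continuous_Exp _ Exp_deriv]) simp

text \<open>\<open>Ad G g\<close> is by definition the differential of conjugation in the chart, so
  it sends the velocity of \<open>Exp G (s X)\<close> to that of the conjugated curve.\<close>

lemma Ad_curve:
  "((\<lambda>s. coord G (g \<otimes> Exp G (s *\<^sub>R X) \<otimes> inv g)) has_vector_derivative Ad G g X) (at 0)"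
proof -
  let ?V = "fst (id_chart G)"
  let ?c = "\<lambda>x. g \<otimes> x \<otimes> inv g"
  have c: "smooth_map (atlas G) (atlas G) ?c"
    by (rule smooth_map_compose[OF topological_atlas topological_atlas topological_atlas smooth_map_lmult smooth_map_rmult])
  have "smooth_on (coord G ` (?V \<inter> ?c -` ?V)) (\<lambda>v. coord G (?c (coord_inv G v)))"
    using smooth_mapD[OF c id_chart(1) id_chart(1)] by (simp add: coord_inv_eq)
  moreover have "open (coord G ` (?V \<inter> ?c -` ?V))"
    by (intro topological_atlas_open_image[OF topological_atlas id_chart(1)] open_vimage open_id_chart
        smooth_map_continuous[OF c])
  moreover have "coord G \<one> \<in> coord G ` (?V \<inter> ?c -` ?V)"
    using id_chart(2) by (intro imageI) simp
  ultimately show ?thesis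
    unfolding Ad_def
    by (rule curve_has_derivative[where f = "\<lambda>x. coord G (?c x)", OF _ _ _ continuous_Exp _ Exp_deriv]) simp
qed

text \<open>The identity \<open>g Exp(sX) h = (g h) (inv h Exp(sX) h)\<close> turns the derivative
  of a translate into a derivative of \<open>F\<close> along the conjugated curve, whose velocity is
  \<open>Ad (inv h) X\<close>.\<close>

lemma lie_deriv_rmult:
  assumes F: "smooth_fun G F"
  shows "lie_deriv G X (\<lambda>x. F (x \<otimes> h)) g = lie_deriv G (Ad G (inv h) X) F (g \<otimes> h)"
proof -
  let ?c = "\<lambda>s. inv h \<otimes> Exp G (s *\<^sub>R X) \<otimes> inv (inv h)"
  have "continuous_on UNIV (\<lambda>x. inv h \<otimes> x \<otimes> inv (inv h))"
    by (rule smooth_map_continuous[OF smooth_map_compose[OF topological_atlas topological_atlas topological_atlas smooth_map_lmult smooth_map_rmult]])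
  then have "continuous_on UNIV ?c"
    by (rule continuous_on_compose2[OF _ continuous_Exp]) simp
  from lie_deriv_curve[OF F this _ Ad_curve, of "g \<otimes> h"]
  have "((\<lambda>s. F ((g \<otimes> h) \<otimes> ?c s)) has_vector_derivative lie_deriv G (Ad G (inv h) X) F (g \<otimes> h)) (at 0)"
    by simp
  moreover have "(g \<otimes> h) \<otimes> ?c s = g \<otimes> Exp G (s *\<^sub>R X) \<otimes> h" for s
  proof -
    have "(g \<otimes> h) \<otimes> ?c s = g \<otimes> (h \<otimes> inv h) \<otimes> Exp G (s *\<^sub>R X) \<otimes> h"
      by (simp only: m_assoc in_carrier m_closed inv_closed inv_inv)
    then show ?thesis by simp
  qed
  ultimately show ?thesis
    unfolding lie_deriv_def[of G X] by (simp add: vector_derivative_at)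
qed

text \<open>In charts the Lie derivative is a partial derivative, in direction \<open>(0, X)\<close>
  at second argument \<open>coord G 1\<close>, of the function \<open>k\<close> of two variables
  obtained from \<open>F (x y)\<close>. Joint smoothness of the multiplication makes
  \<open>k\<close> smooth, and restricting to the slice preserves this.\<close>

lemma smooth_fun_lie_deriv:
  assumes F: "smooth_fun G F"
  shows "smooth_fun G (lie_deriv G X F)"
  unfolding smooth_map_UNIV_iff[OF topological_atlas]
proof safe
  fix V \<phi> assume V: "(V, \<phi>) \<in> atlas G"
  let ?V = "fst (id_chart G)" and ?e = "coord G \<one>"
  define k where "k = (\<lambda>p. F (inv_into V \<phi> (fst p) \<otimes> coord_inv G (snd p)))"
  note o = topological_atlasD(2)[OF topological_atlas V] open_id_chart(2)
  have oo: "open (\<phi> ` V \<times> coord G ` ?V)"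
    using o by (rule open_Times)
  have "smooth_map (prod_atlas (atlas G) (atlas G)) {(UNIV, id)} (\<lambda>p. F (fst p \<otimes> snd p))"
    using topological_atlas_prod[OF topological_atlas topological_atlas] topological_atlas
      topological_atlas_UNIV smooth_map_mult F by (rule smooth_map_compose)
  from smooth_map_UNIVD[OF topological_atlas_prod[OF topological_atlas topological_atlas] this,
      of "V \<times> ?V" "map_prod \<phi> (coord G)"]
  have "smooth_on (map_prod \<phi> (coord G) ` (V \<times> ?V)) (\<lambda>v. F (fst (inv_into (V \<times> ?V) (map_prod \<phi> (coord G)) v) \<otimes>
                 snd (inv_into (V \<times> ?V) (map_prod \<phi> (coord G)) v)))"
    using V id_chart(1) by (auto simp: prod_atlas_def)
  then have k: "smooth_on (\<phi> ` V \<times> coord G ` ?V) k"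
    unfolding map_prod_surj_on[OF refl refl]
    by (rule smooth_on_cong[OF oo, THEN iffD1, rotated])
      (auto simp: k_def inv_into_map_prod topological_atlas_inj[OF topological_atlas V]
        topological_atlas_inj[OF topological_atlas id_chart(1)] coord_inv_eq)
  have "smooth_on (\<phi> ` V) (\<lambda>v. (v, ?e))"
    using o by (simp add: smooth_on_def Ck_on_Pair Ck_on_const Ck_on_bounded_linear bounded_linear_ident)
  then have "smooth_on (\<phi> ` V) (\<lambda>v. frechet_derivative k (at (v, ?e)) (0, X))"
    using coord_one by (intro smooth_on_compose[OF o(1) oo _ _ smooth_on_frechet_derivative[OF k]]) auto
  then show "smooth_on (\<phi> ` V) (\<lambda>v. lie_deriv G X F (inv_into V \<phi> v))"
  proof (rule smooth_on_cong[OF o(1), THEN iffD1, rotated])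
    fix v assume v: "v \<in> \<phi> ` V"
    have "(k has_derivative frechet_derivative k (at (v, ?e))) (at (v, ?e))"
      using v coord_one by (intro smooth_on_imp_has_derivative[OF oo k]) auto
    then have "((\<lambda>w. k (v, w)) has_derivative (\<lambda>w. frechet_derivative k (at (v, ?e)) (0, w))) (at ?e)"
      by (rule has_derivative_compose[rotated]) (auto intro!: derivative_eq_intros)
    from frechet_derivative_at[OF this]
    show "frechet_derivative k (at (v, ?e)) (0, X) = lie_deriv G X F (inv_into V \<phi> v)"
      unfolding lie_deriv_eq[OF F] by (simp add: k_def fun_eq_iff)
  qed
qed

lemma smooth_fun_add: "smooth_fun G F \<Longrightarrow> smooth_fun G F' \<Longrightarrow> smooth_fun G (\<lambda>x. F x + F' x)"
  by (rule smooth_map_UNIV_add[OF topological_atlas])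

lemma smooth_fun_mult: "smooth_fun G F \<Longrightarrow> smooth_fun G F' \<Longrightarrow> smooth_fun G (\<lambda>x. F x * F' x)"
  by (rule smooth_map_UNIV_bilinear[OF topological_atlas bounded_bilinear_mult])

lemma smooth_fun_cmult: "smooth_fun G F \<Longrightarrow> smooth_fun G (\<lambda>x. c * F x)"
  by (rule smooth_map_UNIV_bounded_linear[OF topological_atlas bounded_linear_mult_right])

lemma smooth_fun_cnj: "smooth_fun G F \<Longrightarrow> smooth_fun G (\<lambda>x. cnj (F x))"
  by (rule smooth_map_UNIV_bounded_linear[OF topological_atlas bounded_linear_cnj])

lemma smooth_fun_0: "smooth_fun G (\<lambda>x. 0)"
  by (rule smooth_map_const[OF topological_atlas topological_atlas_UNIV])

lemma lie_deriv_add: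
  assumes "smooth_fun G F" "smooth_fun G F'"
  shows "lie_deriv G X (\<lambda>x. F x + F' x) g = lie_deriv G X F g + lie_deriv G X F' g"
  unfolding lie_deriv_def[of G X "\<lambda>x. F x + F' x"]
  by (intro vector_derivative_at has_vector_derivative_add lie_deriv_Exp assms)

lemma lie_deriv_mult:
  assumes "smooth_fun G F" "smooth_fun G F'"
  shows "lie_deriv G X (\<lambda>x. F x * F' x) g = F g * lie_deriv G X F' g + lie_deriv G X F g * F' g"
  unfolding lie_deriv_def[of G X "\<lambda>x. F x * F' x"]
  using has_vector_derivative_mult[OF lie_deriv_Exp[OF assms(1)] lie_deriv_Exp[OF assms(2)], of g X g X]
  by (intro vector_derivative_at) simp

lemma lie_deriv_bounded_linear:
  assumes "smooth_fun G F" "bounded_linear h"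
  shows "lie_deriv G X (\<lambda>x. h (F x)) g = h (lie_deriv G X F g)"
  unfolding lie_deriv_def[of G X "\<lambda>x. h (F x)"]
  by (rule vector_derivative_at[OF bounded_linear.has_vector_derivative[OF assms(2) lie_deriv_Exp[OF assms(1)]]])

lemma lie_deriv_0: "lie_deriv G X (\<lambda>x. 0) g = 0"
  unfolding lie_deriv_def by (rule vector_derivative_at[OF has_vector_derivative_const])

lemma linear_lie_deriv:
  assumes "smooth_fun G F"
  shows "linear (\<lambda>X. lie_deriv G X F g)"
  unfolding lie_deriv_eq[OF assms]
  by (rule has_derivative_linear[OF smooth_on_imp_has_derivative[OF open_id_chart(2)
        smooth_on_id_chart[OF smooth_fun_lmult[OF assms]] coord_one], simplified])

end

text \<open>All monomials of order at most \<open>k\<close> in \<open>B\<close>, applied to \<open>F\<close>, are bounded by \<open>a\<close>. The recursion peels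
  off the derivative that is applied first, so that it matches \<open>foldr\<close> on words extended at the end.\<close>

primrec deriv_bounded ::
    "('g::topological_space, 'l::euclidean_space) lie_structure \<Rightarrow> 'l set \<Rightarrow> nat \<Rightarrow> real \<Rightarrow> ('g \<Rightarrow> complex) \<Rightarrow> bool" where
  "deriv_bounded G B 0 a F \<longleftrightarrow> smooth_fun G F \<and> (\<forall>g. norm (F g) \<le> a)"
| "deriv_bounded G B (Suc k) a F \<longleftrightarrow> smooth_fun G F \<and> (\<forall>g. norm (F g) \<le> a) \<and>
     (\<forall>X\<in>B. deriv_bounded G B k a (lie_deriv G X F))"

lemma deriv_bounded_smooth: "deriv_bounded G B k a F \<Longrightarrow> smooth_fun G F"
  by (cases k) auto

lemma deriv_bounded_norm_le: "deriv_bounded G B k a F \<Longrightarrow> norm (F g) \<le> a"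
  by (cases k) auto

lemma deriv_bounded_nonneg: "deriv_bounded G B k a F \<Longrightarrow> 0 \<le> a"
  using deriv_bounded_norm_le norm_ge_zero order_trans by blast

lemma deriv_bounded_mono: "deriv_bounded G B k a F \<Longrightarrow> a \<le> a' \<Longrightarrow> deriv_bounded G B k a' F"
  by (induction k arbitrary: F) (auto intro: order_trans)

lemma deriv_bounded_SucD: "deriv_bounded G B (Suc k) a F \<Longrightarrow> deriv_bounded G B k a F"
proof (induction k arbitrary: F)
  case (Suc k)
  then show ?case by (metis deriv_bounded.simps(2))
qed simp

lemma deriv_bounded_imp_monomial_le:
  assumes "deriv_bounded G B k a F" "set w \<subseteq> B" "length w \<le> k"
  shows "norm (foldr (lie_deriv G) w F g) \<le> a"
  using assms
proof (induction k arbitrary: F w)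
  case 0
  then show ?case by simp
next
  case (Suc k)
  show ?case
  proof (cases w rule: rev_cases)
    case Nil
    then show ?thesis using Suc.prems by simp
  next
    case (snoc w' X)
    then show ?thesis using Suc by simp
  qed
qed

section \<open>Derivative bounds under sums, products and translation\<close>

context lie_grp
begin

lemma monomial_le_imp_deriv_bounded:
  assumes "smooth_fun G F" "\<And>w g. set w \<subseteq> B \<Longrightarrow> length w \<le> k \<Longrightarrow> norm (foldr (lie_deriv G) w F g) \<le> a"
  shows "deriv_bounded G B k a F"
  using assms
proof (induction k arbitrary: F)
  case 0
  have "norm (F g) \<le> a" for g
    using 0(2)[of "[]"] by simp
  then show ?case
    unfolding deriv_bounded.simps by (intro conjI allI 0(1))
next
  case (Suc k)
  have "deriv_bounded G B k a (lie_deriv G X F)" if "X \<in> B" for X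
  proof (rule Suc.IH)
    \<comment> \<open>\<open>foldr\<close> applies the last letter first, so the derivative along
      \<open>X\<close> is prefixed to the monomial by appending \<open>X\<close> to the
      word.\<close>
    show "norm (foldr (lie_deriv G) w (lie_deriv G X F) g) \<le> a" if "set w \<subseteq> B" "length w \<le> k" for w g
      using Suc.prems(2)[of "w @ [X]" g] that \<open>X \<in> B\<close> by simp
  qed (rule smooth_fun_lie_deriv[OF Suc.prems(1)])
  moreover have "norm (F g) \<le> a" for g
    using Suc.prems(2)[of "[]"] by simp
  ultimately show ?case
    unfolding deriv_bounded.simps by (intro conjI allI ballI Suc.prems(1))
qed

lemma deriv_bounded_add:
  assumes "deriv_bounded G B k a F" "deriv_bounded G B k b F'"
  shows "deriv_bounded G B k (a + b) (\<lambda>x. F x + F' x)"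
  using assms
proof (induction k arbitrary: F F')
  case 0
  then show ?case
    by (auto intro: smooth_fun_add norm_triangle_mono)
next
  case (Suc k)
  then have "lie_deriv G X (\<lambda>x. F x + F' x) = (\<lambda>g. lie_deriv G X F g + lie_deriv G X F' g)" for X
    by (auto simp: lie_deriv_add)
  with Suc show ?case
    by (auto intro: smooth_fun_add norm_triangle_mono)
qed

lemma deriv_bounded_0: "0 \<le> a \<Longrightarrow> deriv_bounded G B k a (\<lambda>x. 0)"
proof (induction k)
  case (Suc k)
  moreover have "lie_deriv G X (\<lambda>x. 0) = (\<lambda>x. 0)" for X
    by (simp add: fun_eq_iff lie_deriv_0)
  ultimately show ?case
    by (simp add: smooth_fun_0)
qed (simp add: smooth_fun_0)

lemma deriv_bounded_sum:
  assumes "finite I" "\<And>i. i \<in> I \<Longrightarrow> deriv_bounded G B k (a i) (F i)"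
  shows "deriv_bounded G B k (\<Sum>i\<in>I. a i) (\<lambda>x. \<Sum>i\<in>I. F i x)"
  using assms by induction (auto intro: deriv_bounded_add deriv_bounded_0)

lemma deriv_bounded_cmult:
  assumes "deriv_bounded G B k a F"
  shows "deriv_bounded G B k (norm c * a) (\<lambda>x. c * F x)"
  using assms
proof (induction k arbitrary: F)
  case 0
  then show ?case
    by (auto intro: smooth_fun_cmult mult_left_mono simp: norm_mult)
next
  case (Suc k)
  then have "lie_deriv G X (\<lambda>x. c * F x) = (\<lambda>g. c * lie_deriv G X F g)" for X
    using lie_deriv_bounded_linear[OF _ bounded_linear_mult_right] by auto
  with Suc show ?case
    by (auto intro: smooth_fun_cmult mult_left_mono simp: norm_mult)
qed

lemma deriv_bounded_cnj:
  assumes "deriv_bounded G B k a F"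
  shows "deriv_bounded G B k a (\<lambda>x. cnj (F x))"
  using assms
proof (induction k arbitrary: F)
  case 0
  then show ?case
    by (auto intro: smooth_fun_cnj)
next
  case (Suc k)
  then have "lie_deriv G X (\<lambda>x. cnj (F x)) = (\<lambda>g. cnj (lie_deriv G X F g))" for X
    using lie_deriv_bounded_linear[OF _ bounded_linear_cnj] by auto
  with Suc show ?case
    by (auto intro: smooth_fun_cnj)
qed

text \<open>By the Leibniz rule each further order at most doubles the number of terms, each bounded
  by \<open>a * b\<close>; this is the factor \<open>2 ^ k\<close>.\<close>

lemma deriv_bounded_mult:
  assumes "deriv_bounded G B k a F" "deriv_bounded G B k b F'"
  shows "deriv_bounded G B k (2 ^ k * (a * b)) (\<lambda>x. F x * F' x)"
  using assms
proof (induction k arbitrary: F F')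
  case 0
  then show ?case
    using deriv_bounded_nonneg[OF 0(1)]
    by (auto intro: smooth_fun_mult mult_mono simp: norm_mult)
next
  case (Suc k)
  have F: "smooth_fun G F" "smooth_fun G F'"
    using Suc.prems by auto
  have ab: "0 \<le> a" "0 \<le> b"
    using Suc.prems deriv_bounded_nonneg by blast+
  have "norm (F g * F' g) \<le> 2 ^ Suc k * (a * b)" for g
  proof -
    have "norm (F g * F' g) \<le> 1 * (a * b)"
      using Suc.prems ab by (simp add: norm_mult mult_mono)
    also have "\<dots> \<le> 2 ^ Suc k * (a * b)"
      using ab by (intro mult_right_mono one_le_power) auto
    finally show ?thesis .
  qed
  moreover have "deriv_bounded G B k (2 ^ Suc k * (a * b)) (lie_deriv G X (\<lambda>x. F x * F' x))" if "X \<in> B" for X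
  proof -
    have "deriv_bounded G B k (2 ^ k * (a * b) + 2 ^ k * (a * b)) (\<lambda>g. F g * lie_deriv G X F' g + lie_deriv G X F g * F' g)"
      using Suc.prems that Suc.prems[THEN deriv_bounded_SucD] by (intro deriv_bounded_add Suc.IH) auto
    moreover have "lie_deriv G X (\<lambda>x. F x * F' x) = (\<lambda>g. F g * lie_deriv G X F' g + lie_deriv G X F g * F' g)"
      using F by (simp add: fun_eq_iff lie_deriv_mult)
    ultimately show ?thesis by (simp add: mult_ac)
  qed
  ultimately show ?case
    using F by (simp add: smooth_fun_mult)
qed

text \<open>Each derivative of the translate is a combination of derivatives of \<open>F\<close>,
  again translated, with coefficients of total size at most \<open>M\<close>; iterating gives
  \<open>M ^ k\<close>. The condition \<open>1 \<le> M\<close> lets the monomials of lower order fit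
  under the same bound.\<close>

lemma deriv_bounded_rmult:
  assumes "finite B" "1 \<le> M"
    and Ad: "\<And>X. X \<in> B \<Longrightarrow> Ad G (inv h) X = (\<Sum>b\<in>B. c X b *\<^sub>R b)"
    and M: "\<And>X. X \<in> B \<Longrightarrow> (\<Sum>b\<in>B. \<bar>c X b\<bar>) \<le> M"
    and F: "deriv_bounded G B k a F"
  shows "deriv_bounded G B k (M ^ k * a) (\<lambda>x. F (x \<otimes> h))"
  using F
proof (induction k arbitrary: F)
  case 0
  then show ?case by (simp add: smooth_fun_rmult)
next
  case (Suc k)
  have F: "smooth_fun G F" using Suc.prems by simp
  have a: "0 \<le> a"
    using Suc.prems deriv_bounded_nonneg by blast
  have "norm (F g) \<le> M ^ Suc k * a" for g
  proof -
    have "norm (F g) \<le> 1 * a" using Suc.prems by simp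
    also have "\<dots> \<le> M ^ Suc k * a"
      using a assms(2) by (intro mult_right_mono one_le_power) auto
    finally show ?thesis .
  qed
  moreover have "deriv_bounded G B k (M ^ Suc k * a) (lie_deriv G X (\<lambda>x. F (x \<otimes> h)))" if "X \<in> B" for X
  proof -
    have "lie_deriv G X (\<lambda>x. F (x \<otimes> h)) = (\<lambda>g. \<Sum>b\<in>B. of_real (c X b) * lie_deriv G b F (g \<otimes> h))"
    proof
      fix g
      show "lie_deriv G X (\<lambda>x. F (x \<otimes> h)) g = (\<Sum>b\<in>B. of_real (c X b) * lie_deriv G b F (g \<otimes> h))"
        unfolding lie_deriv_rmult[OF F] Ad[OF that] linear_sum[OF linear_lie_deriv[OF F]]
        by (intro sum.cong refl) (simp only: linear_cmul[OF linear_lie_deriv[OF F]] scaleR_conv_of_real)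
    qed
    moreover have "deriv_bounded G B k (\<Sum>b\<in>B. norm (complex_of_real (c X b)) * (M ^ k * a))
        (\<lambda>g. \<Sum>b\<in>B. of_real (c X b) * lie_deriv G b F (g \<otimes> h))"
      using Suc.prems by (intro deriv_bounded_sum deriv_bounded_cmult Suc.IH assms) auto
    moreover have "(\<Sum>b\<in>B. norm (complex_of_real (c X b)) * (M ^ k * a)) \<le> M ^ Suc k * a"
      using mult_right_mono[OF M[OF that], of "M ^ k * a"] a assms(2)
      by (simp add: sum_distrib_right[symmetric] mult.assoc)
    ultimately show ?thesis
      by (simp add: deriv_bounded_mono)
  qed
  ultimately show ?case
    using F by (simp add: smooth_fun_rmult)
qed

end

section \<open>Measures on quotients by discrete subgroups\<close>

text \<open>Serves both for \<open>\<Gamma>\<close> in the whole group and for the stabilizer of a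
  point in \<open>U\<close>. The second group is a restriction to the carrier \<open>U\<close>, so
  topological statements are relative to \<open>carrier G\<close>.\<close>

locale discrete_quotient = group G
  for G :: "('g::{t2_space,second_countable_topology}, 'm) monoid_scheme" (structure) +
  fixes \<Delta> :: "'g set"
  assumes continuous_mult_on: "continuous_on (carrier G \<times> carrier G) (\<lambda>p. fst p \<otimes> snd p)"
    and continuous_inv_on: "continuous_on (carrier G) (\<lambda>x. inv x)"
    and subgroup: "subgroup \<Delta> G"
    and discrete: "\<exists>O'. open O' \<and> O' \<inter> \<Delta> = {\<one>}"
begin

lemma \<Delta>_carrier: "x \<in> \<Delta> \<Longrightarrow> x \<in> carrier G"
  using subgroup subgroup.subset by blast

lemma \<Delta>_subset: "\<Delta> \<subseteq> carrier G"
  using \<Delta>_carrier by blast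

lemma continuous_rmult_on: "u \<in> carrier G \<Longrightarrow> continuous_on (carrier G) (\<lambda>x. x \<otimes> u)"
  using continuous_on_compose2[OF continuous_mult_on, of "carrier G" "\<lambda>x. (x, u)"]
  by (force intro: continuous_intros)

lemma continuous_lmult_on: "u \<in> carrier G \<Longrightarrow> continuous_on (carrier G) (\<lambda>x. u \<otimes> x)"
  using continuous_on_compose2[OF continuous_mult_on, of "carrier G" "\<lambda>x. (u, x)"]
  by (force intro: continuous_intros)

lemma in_rcosetsE:
  assumes "c \<in> rcosets \<Delta>"
  obtains x where "x \<in> carrier G" "c = \<Delta> #> x"
  using assms by (auto simp: RCOSETS_def)

lemma rcosetsI': "x \<in> carrier G \<Longrightarrow> \<Delta> #> x \<in> rcosets \<Delta>"
  using rcosetsI[OF \<Delta>_subset] .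

lemma mem_self: "x \<in> carrier G \<Longrightarrow> x \<in> \<Delta> #> x"
  by (rule rcos_self[OF _ subgroup])

lemma rcoset_eq: "c \<in> rcosets \<Delta> \<Longrightarrow> x \<in> c \<Longrightarrow> \<Delta> #> x = c"
  using repr_independence[OF _ _ subgroup] by (metis in_rcosetsE)

lemma rcoset_subset: "c \<in> rcosets \<Delta> \<Longrightarrow> c \<subseteq> carrier G"
  by (rule subgroup.rcosets_carrier[OF subgroup is_group])

lemma rcoset_in_iff:
  assumes "W \<subseteq> rcosets \<Delta>" "x \<in> carrier G"
  shows "\<Delta> #> x \<in> W \<longleftrightarrow> x \<in> \<Union>W"
  using assms mem_self rcoset_eq by blast

lemma Union_subset_carrier: "W \<subseteq> rcosets \<Delta> \<Longrightarrow> \<Union>W \<subseteq> carrier G"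
  using rcoset_subset by blast

lemma rcoset_vimage:
  assumes "W \<subseteq> rcosets \<Delta>"
  shows "(\<lambda>x. \<Delta> #> x) -` W \<inter> carrier G = \<Union>W"
  using rcoset_in_iff[OF assms] Union_subset_carrier[OF assms] by blast

lemma rcoset_diff:
  assumes "c \<in> rcosets \<Delta>" "x \<in> c" "y \<in> c"
  shows "x \<otimes> inv y \<in> \<Delta>"
proof -
  have y: "y \<in> carrier G" using assms rcoset_subset by blast
  then have "x \<in> \<Delta> #> y" using assms rcoset_eq by metis
  then obtain d where "d \<in> \<Delta>" "x = d \<otimes> y" by (auto simp: r_coset_def)
  then show ?thesis using y \<Delta>_carrier by (simp add: m_assoc)
qed

lemma rcoset_rmult:
  assumes "x \<in> carrier G" "u \<in> carrier G"
  shows "(\<Delta> #> x) #> u = \<Delta> #> (x \<otimes> u)"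
  using coset_mult_assoc[OF \<Delta>_subset assms] .

lemma rmult_rcosets: "c \<in> rcosets \<Delta> \<Longrightarrow> u \<in> carrier G \<Longrightarrow> c #> u \<in> rcosets \<Delta>"
  by (metis in_rcosetsE rcoset_rmult rcosetsI' m_closed)

lemma openin_coset_iff:
  "openin (coset_topology G \<Delta>) W \<longleftrightarrow> W \<subseteq> rcosets \<Delta> \<and> openin (top_of_set (carrier G)) (\<Union>W)"
  by (rule openin_coset_topology[OF is_group subgroup])

lemma space_coset_borel: "space (coset_borel G \<Delta>) = rcosets \<Delta>"
  unfolding coset_borel_def by (intro space_measure_of) (auto simp: openin_coset_iff)

lemma sets_coset_borel:
  "sets (coset_borel G \<Delta>) = sigma_sets (rcosets \<Delta>) {W. openin (coset_topology G \<Delta>) W}"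
  unfolding coset_borel_def by (intro sets_measure_of) (auto simp: openin_coset_iff)

lemma sets_restrict_openin:
  assumes "openin (top_of_set S) A"
  shows "A \<in> sets (restrict_space borel S)"
  using assms by (auto simp: openin_open sets_restrict_space)

lemma measurable_into_coset_borel:
  assumes "f \<in> space N \<rightarrow> rcosets \<Delta>"
    and "\<And>W. openin (coset_topology G \<Delta>) W \<Longrightarrow> f -` W \<inter> space N \<in> sets N"
  shows "f \<in> measurable N (coset_borel G \<Delta>)"
  unfolding coset_borel_def
  using assms by (intro measurable_measure_of) (auto simp: openin_coset_iff)

lemma measurable_rcoset: "(\<lambda>x. \<Delta> #> x) \<in> measurable (restrict_space borel (carrier G)) (coset_borel G \<Delta>)"
proof (rule measurable_into_coset_borel)
  fix W assume W: "openin (coset_topology G \<Delta>) W"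
  then have "(\<lambda>x. \<Delta> #> x) -` W \<inter> carrier G = \<Union>W"
    by (intro rcoset_vimage) (simp add: openin_coset_iff)
  then show "(\<lambda>x. \<Delta> #> x) -` W \<inter> space (restrict_space borel (carrier G)) \<in> sets (restrict_space borel (carrier G))"
    using W by (simp add: space_restrict_space openin_coset_iff sets_restrict_openin)
qed (auto simp: space_restrict_space intro: rcosetsI')

lemma Union_measurable:
  assumes "W \<in> sets (coset_borel G \<Delta>)"
  shows "\<Union>W \<in> sets (restrict_space borel (carrier G))"
proof -
  have W: "W \<subseteq> rcosets \<Delta>"
    using sets.sets_into_space[OF assms] by (simp add: space_coset_borel)
  have "(\<lambda>x. \<Delta> #> x) -` W \<inter> space (restrict_space borel (carrier G)) = \<Union>W"
    using rcoset_vimage[OF W] by (simp add: space_restrict_space)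
  then show ?thesis
    using measurable_sets[OF measurable_rcoset assms] by simp
qed

text \<open>The projection intertwines the two right multiplications, so the union of the cosets
  sent into \<open>W\<close> is the preimage of \<open>\<Union>W\<close> under
  \<open>x \<mapsto> x u\<close>, which is relatively open.\<close>

lemma measurable_coset_rmult:
  assumes u: "u \<in> carrier G"
  shows "(\<lambda>c. c #> u) \<in> measurable (coset_borel G \<Delta>) (coset_borel G \<Delta>)"
proof (rule measurable_into_coset_borel)
  show "(\<lambda>c. c #> u) \<in> space (coset_borel G \<Delta>) \<rightarrow> rcosets \<Delta>"
    using rmult_rcosets u by (auto simp: space_coset_borel)
  fix W assume W: "openin (coset_topology G \<Delta>) W"
  let ?W = "{c \<in> rcosets \<Delta>. c #> u \<in> W}"
  have Ws: "W \<subseteq> rcosets \<Delta>" using W by (simp add: openin_coset_iff)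
  have eq: "x \<in> \<Union>?W \<longleftrightarrow> x \<in> carrier G \<and> x \<otimes> u \<in> \<Union>W" for x
  proof (cases "x \<in> carrier G")
    case True
    have "x \<in> \<Union>?W \<longleftrightarrow> \<Delta> #> x \<in> ?W"
      by (rule rcoset_in_iff[symmetric]) (auto intro: True)
    also have "\<dots> \<longleftrightarrow> \<Delta> #> (x \<otimes> u) \<in> W"
      using True u by (simp add: rcosetsI' rcoset_rmult)
    also have "\<dots> \<longleftrightarrow> x \<otimes> u \<in> \<Union>W"
      using True u Ws by (intro rcoset_in_iff) auto
    finally show ?thesis using True by simp
  qed (use Union_subset_carrier[of ?W] in blast)
  have "\<Union>?W = carrier G \<inter> (\<lambda>x. x \<otimes> u) -` \<Union>W"
    by (rule Set.set_eqI) (simp only: eq Int_iff vimage_eq)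
  also have "openin (top_of_set (carrier G)) \<dots>"
    using W u continuous_rmult_on[OF u]
    by (intro continuous_openin_preimage[where T = "carrier G"]) (auto simp: openin_coset_iff)
  finally have "openin (coset_topology G \<Delta>) ?W"
    by (auto simp: openin_coset_iff)
  then have "?W \<in> sets (coset_borel G \<Delta>)"
    unfolding sets_coset_borel by blast
  moreover have "(\<lambda>c. c #> u) -` W \<inter> space (coset_borel G \<Delta>) = ?W"
    by (auto simp: space_coset_borel)
  ultimately show "(\<lambda>c. c #> u) -` W \<inter> space (coset_borel G \<Delta>) \<in> sets (coset_borel G \<Delta>)"
    by simp
qed

lemma measurable_from_coset_borel:
  fixes f :: "'g set \<Rightarrow> 'b::topological_space"
  assumes "continuous_on (carrier G) (\<lambda>x. f (\<Delta> #> x))"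
  shows "f \<in> borel_measurable (coset_borel G \<Delta>)"
proof (rule borel_measurableI)
  fix S :: "'b set" assume S: "open S"
  let ?W = "{c \<in> rcosets \<Delta>. f c \<in> S}"
  have eq: "x \<in> \<Union>?W \<longleftrightarrow> x \<in> carrier G \<and> f (\<Delta> #> x) \<in> S" for x
  proof (cases "x \<in> carrier G")
    case True
    have "x \<in> \<Union>?W \<longleftrightarrow> \<Delta> #> x \<in> ?W"
      by (rule rcoset_in_iff[symmetric]) (auto intro: True)
    then show ?thesis using True by (simp add: rcosetsI')
  qed (use Union_subset_carrier[of ?W] in blast)
  have "\<Union>?W = carrier G \<inter> (\<lambda>x. f (\<Delta> #> x)) -` S"
    by (rule Set.set_eqI) (simp only: eq Int_iff vimage_eq)
  also have "openin (top_of_set (carrier G)) \<dots>"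
    using assms S by (rule continuous_openin_preimage_gen)
  finally have "openin (coset_topology G \<Delta>) ?W"
    by (auto simp: openin_coset_iff)
  then have "?W \<in> sets (coset_borel G \<Delta>)"
    unfolding sets_coset_borel by blast
  moreover have "f -` S \<inter> space (coset_borel G \<Delta>) = ?W"
    by (auto simp: space_coset_borel)
  ultimately show "f -` S \<inter> space (coset_borel G \<Delta>) \<in> sets (coset_borel G \<Delta>)"
    by simp
qed

lemma openin_rcoset_image:
  assumes S: "openin (top_of_set (carrier G)) S"
  shows "openin (coset_topology G \<Delta>) ((\<lambda>x. \<Delta> #> x) ` S)"
  unfolding openin_coset_iff
proof
  have sub: "S \<subseteq> carrier G" using S openin_imp_subset by blast
  then show "(\<lambda>x. \<Delta> #> x) ` S \<subseteq> rcosets \<Delta>" using rcosetsI' by blast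
  have "\<Union>((\<lambda>x. \<Delta> #> x) ` S) = (\<Union>d\<in>\<Delta>. carrier G \<inter> (\<lambda>x. d \<otimes> x) -` S)"
  proof (intro equalityI subsetI)
    fix x assume "x \<in> \<Union>((\<lambda>x. \<Delta> #> x) ` S)"
    then obtain s d where s: "s \<in> S" "d \<in> \<Delta>" "x = d \<otimes> s" by (auto simp: r_coset_def)
    then have "x \<in> carrier G" "inv d \<otimes> x = s"
      using sub \<Delta>_carrier by (auto simp: m_assoc[symmetric])
    then show "x \<in> (\<Union>d\<in>\<Delta>. carrier G \<inter> (\<lambda>x. d \<otimes> x) -` S)"
      using s subgroup.m_inv_closed[OF subgroup s(2)] by (intro UN_I[of "inv d"]) auto
  next
    fix x assume "x \<in> (\<Union>d\<in>\<Delta>. carrier G \<inter> (\<lambda>x. d \<otimes> x) -` S)"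
    then obtain d where d: "d \<in> \<Delta>" "x \<in> carrier G" "d \<otimes> x \<in> S" by auto
    then have "x = inv d \<otimes> (d \<otimes> x)" using \<Delta>_carrier by (simp add: m_assoc[symmetric])
    then have "x \<in> \<Delta> #> (d \<otimes> x)"
      using subgroup.m_inv_closed[OF subgroup d(1)] by (auto simp: r_coset_def)
    then show "x \<in> \<Union>((\<lambda>x. \<Delta> #> x) ` S)" using d by blast
  qed
  also have "openin (top_of_set (carrier G)) \<dots>"
  proof (rule openin_Union, safe)
    fix d assume "d \<in> \<Delta>"
    then show "openin (top_of_set (carrier G)) (carrier G \<inter> (\<lambda>x. d \<otimes> x) -` S)"
      using continuous_lmult_on S \<Delta>_carrier
      by (intro continuous_openin_preimage[where T = "carrier G"]) auto
  qed
  finally show "openin (top_of_set (carrier G)) (\<Union>((\<lambda>x. \<Delta> #> x) ` S))" .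
qed

text \<open>Two points lie in the same coset iff \<open>x \<otimes> inv y\<close> is in
  \<open>\<Delta>\<close>, so this says that the projection is injective on the part of
  \<open>O'\<close> in the group.\<close>

definition evenly_covers :: "'g set \<Rightarrow> bool" where
  "evenly_covers O' \<longleftrightarrow> (\<forall>x\<in>O' \<inter> carrier G. \<forall>y\<in>O' \<inter> carrier G. x \<otimes> inv y \<in> \<Delta> \<longrightarrow> x = y)"

text \<open>The map \<open>(x, y) \<mapsto> x \<otimes> inv y\<close> sends \<open>(a, a)\<close> to
  the identity. By continuity it sends pairs from a small neighbourhood into a set whose only
  element of \<open>\<Delta>\<close> is the identity.\<close>

lemma evenly_covering_neighbourhood:
  assumes a: "a \<in> carrier G"
  shows "\<exists>O'. open O' \<and> a \<in> O' \<and> evenly_covers O'"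
proof -
  obtain N where N: "open N" "N \<inter> \<Delta> = {\<one>}" using discrete by blast
  have "continuous_on (carrier G \<times> carrier G) (\<lambda>p. (fst p, inv (snd p)))"
    by (intro continuous_intros continuous_on_compose2[OF continuous_inv_on]) auto
  moreover have "(\<lambda>p. (fst p, inv (snd p))) ` (carrier G \<times> carrier G) \<subseteq> carrier G \<times> carrier G"
    by auto
  ultimately have "continuous_on (carrier G \<times> carrier G) (\<lambda>p. fst p \<otimes> inv (snd p))"
    using continuous_on_compose2[OF continuous_mult_on] by fastforce
  then have "openin (top_of_set (carrier G \<times> carrier G)) ((carrier G \<times> carrier G) \<inter> (\<lambda>p. fst p \<otimes> inv (snd p)) -` N)"
    using N(1) by (rule continuous_openin_preimage_gen)
  then obtain T where T: "open T" "(carrier G \<times> carrier G) \<inter> (\<lambda>p. fst p \<otimes> inv (snd p)) -` N = (carrier G \<times> carrier G) \<inter> T"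
    by (auto simp: openin_open)
  have "(a, a) \<in> (carrier G \<times> carrier G) \<inter> (\<lambda>p. fst p \<otimes> inv (snd p)) -` N"
    using a N by auto
  then have "(a, a) \<in> T" using T(2) by blast
  then obtain A B where AB: "open A" "open B" "(a, a) \<in> A \<times> B" "A \<times> B \<subseteq> T"
    using open_prod_elim[OF T(1)] by metis
  have "evenly_covers (A \<inter> B)"
    unfolding evenly_covers_def
  proof (intro ballI impI)
    fix x y assume x: "x \<in> A \<inter> B \<inter> carrier G" and y: "y \<in> A \<inter> B \<inter> carrier G" and d: "x \<otimes> inv y \<in> \<Delta>"
    then have "(x, y) \<in> (carrier G \<times> carrier G) \<inter> T" using AB by auto
    then have "x \<otimes> inv y \<in> N" unfolding T(2)[symmetric] by simp
    then have "x \<otimes> inv y = \<one>" using d N by blast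
    then show "x = y" using x y by (metis IntD2 inv_closed inv_equality inv_inv)
  qed
  then show ?thesis using AB by (intro exI[of _ "A \<inter> B"]) auto
qed

lemma countable_even_cover:
  obtains O' :: "nat \<Rightarrow> 'g set" where "\<And>i. open (O' i)" "\<And>i. evenly_covers (O' i)" "carrier G \<subseteq> (\<Union>i. O' i)"
proof -
  let ?F = "{O'. open O' \<and> evenly_covers O'}"
  obtain F where F: "F \<subseteq> ?F" "countable F" "\<Union>F = \<Union>?F"
    using Lindelof[of ?F] by auto
  have c: "carrier G \<subseteq> \<Union>F"
    unfolding F(3) using evenly_covering_neighbourhood by blast
  then have "F \<noteq> {}" using one_closed by auto
  then have "range (from_nat_into F) = F"
    using F(2) by (rule range_from_nat_into)
  moreover from this have "from_nat_into F i \<in> ?F" for i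
    using F(1) by blast
  ultimately show ?thesis
    using c by (intro that[of "from_nat_into F"]) auto
qed

section \<open>Right invariance of the measure on the quotient\<close>

context
  fixes h :: "'g measure" and m :: "'g set measure"
  assumes h: "haar_measure G h" and m: "quotient_measure G \<Delta> h m"
begin

lemma sets_h: "sets h = sets (restrict_space borel (carrier G))"
  using h by (simp add: haar_measure_def)

lemma sets_m: "sets m = sets (coset_borel G \<Delta>)"
  using m by (simp add: quotient_measure_def)

lemma space_m: "space m = rcosets \<Delta>"
  using sets_eq_imp_space_eq[OF sets_m] by (simp add: space_coset_borel)

lemma measurable_rmult_m: "u \<in> carrier G \<Longrightarrow> (\<lambda>c. c #> u) \<in> measurable m m"
  unfolding measurable_cong_sets[OF sets_m sets_m] by (rule measurable_coset_rmult)

text \<open>Over a set that meets every coset at most once, the counting formula recovers \<open>m\<close> from the Haar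
  measure, whose invariance then passes to \<open>m\<close>.\<close>

lemma emeasure_rmult_small:
  assumes W: "W \<in> sets m" "W \<subseteq> (\<lambda>x. \<Delta> #> x) ` (O' \<inter> carrier G)"
    and O': "open O'" "evenly_covers O'" and u: "u \<in> carrier G"
  shows "emeasure m ((\<lambda>c. c #> u) -` W \<inter> space m) = emeasure m W"
proof -
  have Ws: "W \<subseteq> rcosets \<Delta>" using sets.sets_into_space[OF W(1)] by (simp add: space_m)
  \<comment> \<open>A measurable section over \<open>W\<close>: every coset in \<open>W\<close>
    meets \<open>?A\<close> in exactly one point and every other coset misses it. The counting
    integrand is thus the indicator of \<open>W\<close>.\<close>
  let ?A = "O' \<inter> \<Union>W"
  have Asub: "?A \<subseteq> carrier G" using Union_subset_carrier[OF Ws] by blast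
  have "?A = (O' \<inter> carrier G) \<inter> \<Union>W" using Asub by blast
  then have A: "?A \<in> sets h"
    using O'(1) Union_measurable[of W] W(1) unfolding sets_h sets_m
    by (metis sets.Int sets_restrict_openin Int_commute openin_open_Int)
  have unique: "x = y" if "c \<in> rcosets \<Delta>" "x \<in> c \<inter> ?A" "y \<in> c \<inter> ?A" for c x y
    using that rcoset_diff[of c x y] O'(2) Asub unfolding evenly_covers_def by blast
  have card: "emeasure (count_space UNIV) (c \<inter> ?A) = indicator W c" if c: "c \<in> rcosets \<Delta>" for c
  proof (cases "c \<in> W")
    case True
    then obtain x where x: "x \<in> O' \<inter> carrier G" "c = \<Delta> #> x" using W(2) by blast
    then have "x \<in> c \<inter> ?A" using mem_self True by blast
    then have "c \<inter> ?A = {x}" using unique[OF c] by blast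
    then show ?thesis using True by simp
  next
    case False
    then have "c \<inter> ?A = {}"
      using rcoset_eq c Ws by blast
    then show ?thesis using False by simp
  qed
  have hA: "emeasure h ?A = emeasure m W"
  proof -
    have "emeasure h ?A = (\<integral>\<^sup>+c. emeasure (count_space UNIV) (c \<inter> ?A) \<partial>m)"
      using m A by (simp add: quotient_measure_def)
    also have "\<dots> = (\<integral>\<^sup>+c. indicator W c \<partial>m)"
      by (intro nn_integral_cong card) (simp add: space_m)
    finally show ?thesis using W(1) by simp
  qed
  \<comment> \<open>The translated section. It plays the role of \<open>?A\<close> for the preimage
    of \<open>W\<close> under right multiplication by \<open>u\<close>.\<close>
  let ?A' = "?A #> inv u"
  have mem: "x \<in> ?A' \<longleftrightarrow> x \<in> carrier G \<and> x \<otimes> u \<in> ?A" for x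
  proof
    assume "x \<in> ?A'"
    then obtain y where "y \<in> ?A" "x = y \<otimes> inv u" by (auto simp: r_coset_def)
    moreover from this have "y \<in> carrier G" using Asub by blast
    ultimately show "x \<in> carrier G \<and> x \<otimes> u \<in> ?A" using u by (simp add: m_assoc)
  next
    assume x: "x \<in> carrier G \<and> x \<otimes> u \<in> ?A"
    then have "x = (x \<otimes> u) \<otimes> inv u" using u by (simp add: m_assoc)
    then show "x \<in> ?A'" using x unfolding r_coset_def by blast
  qed
  have "(\<lambda>x. x \<otimes> u) \<in> measurable (restrict_space borel (carrier G)) (restrict_space borel (carrier G))"
    using u by (intro measurable_restrict_space2 borel_measurable_continuous_on_restrict continuous_rmult_on)
      (auto simp: space_restrict_space)
  from measurable_sets[OF this A[unfolded sets_h]]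
  have "(\<lambda>x. x \<otimes> u) -` ?A \<inter> carrier G \<in> sets h"
    by (simp add: sets_h space_restrict_space)
  moreover have "(\<lambda>x. x \<otimes> u) -` ?A \<inter> carrier G = ?A'"
    by (rule Set.set_eqI) (simp only: mem Int_iff vimage_eq conj_commute)
  ultimately have A': "?A' \<in> sets h" by simp
  have card': "emeasure (count_space UNIV) (c \<inter> ?A') = indicator ((\<lambda>c. c #> u) -` W \<inter> space m) c" if c: "c \<in> rcosets \<Delta>" for c
  proof -
    have cu: "c #> u \<in> rcosets \<Delta>" using rmult_rcosets c u .
    \<comment> \<open>Counting \<open>?A'\<close> in the coset \<open>c\<close> is counting
      \<open>?A\<close> in \<open>c #> u\<close>, which is already known to give the indicator of
      \<open>W\<close>.\<close>
    have "bij_betw (\<lambda>x. x \<otimes> u) (c \<inter> ?A') ((c #> u) \<inter> ?A)"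
    proof (rule bij_betw_imageI)
      show "inj_on (\<lambda>x. x \<otimes> u) (c \<inter> ?A')"
      proof (rule inj_onI)
        fix x y assume "x \<in> c \<inter> ?A'" "y \<in> c \<inter> ?A'" "x \<otimes> u = y \<otimes> u"
        moreover from this have "x \<in> carrier G" "y \<in> carrier G"
          using rcoset_subset[OF c] by blast+
        ultimately show "x = y" using u by simp
      qed
      show "(\<lambda>x. x \<otimes> u) ` (c \<inter> ?A') = (c #> u) \<inter> ?A"
      proof (rule Set.set_eqI)
        fix y
        have "y \<in> (\<lambda>x. x \<otimes> u) ` (c \<inter> ?A') \<longleftrightarrow> (\<exists>x\<in>c. y = x \<otimes> u \<and> x \<in> ?A')"
          by blast
        also have "\<dots> \<longleftrightarrow> (\<exists>x\<in>c. y = x \<otimes> u \<and> y \<in> ?A)"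
          using rcoset_subset[OF c] by (intro bex_cong refl) (auto simp only: mem)
        also have "\<dots> \<longleftrightarrow> y \<in> (c #> u) \<inter> ?A"
          unfolding r_coset_def by blast
        finally show "y \<in> (\<lambda>x. x \<otimes> u) ` (c \<inter> ?A') \<longleftrightarrow> y \<in> (c #> u) \<inter> ?A" .
      qed
    qed
    then have "emeasure (count_space UNIV) (c \<inter> ?A') = emeasure (count_space UNIV) ((c #> u) \<inter> ?A)"
      by (simp add: emeasure_count_space bij_betw_same_card bij_betw_finite)
    then show ?thesis
      using card[OF cu] c by (auto simp: indicator_def space_m)
  qed
  have "emeasure h ?A' = (\<integral>\<^sup>+c. emeasure (count_space UNIV) (c \<inter> ?A') \<partial>m)"
    using m A' unfolding quotient_measure_def by blast
  also have "\<dots> = (\<integral>\<^sup>+c. indicator ((\<lambda>c. c #> u) -` W \<inter> space m) c \<partial>m)"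
    by (intro nn_integral_cong card') (simp add: space_m)
  also have "\<dots> = emeasure m ((\<lambda>c. c #> u) -` W \<inter> space m)"
    by (intro nn_integral_indicator measurable_sets[OF measurable_rmult_m[OF u] W(1)])
  finally have "emeasure h ?A' = emeasure m ((\<lambda>c. c #> u) -` W \<inter> space m)" .
  moreover have "emeasure h ?A' = emeasure h ?A"
    using h A u unfolding haar_measure_def by blast
  ultimately show ?thesis using hA by simp
qed

text \<open>Countably many evenly covered pieces exhaust the quotient. Made disjoint, they cut
  \<open>W\<close> into parts to which the local statement applies, and countable additivity
  reassembles them.\<close>

lemma distr_rmult:
  assumes u: "u \<in> carrier G"
  shows "distr m m (\<lambda>c. c #> u) = m"
proof (rule measure_eqI)
  let ?m = "distr m m (\<lambda>c. c #> u)"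
  fix W assume "W \<in> sets ?m"
  then have W: "W \<in> sets m" by simp
  then have Ws: "W \<subseteq> rcosets \<Delta>" using sets.sets_into_space by (force simp: space_m)
  obtain O' :: "nat \<Rightarrow> 'g set" where O': "\<And>i. open (O' i)" "\<And>i. evenly_covers (O' i)" "carrier G \<subseteq> (\<Union>i. O' i)"
    using countable_even_cover by metis
  define Q where "Q = (\<lambda>i. (\<lambda>x. \<Delta> #> x) ` (O' i \<inter> carrier G))"
  have Q: "Q i \<in> sets m" for i
  proof -
    have "openin (coset_topology G \<Delta>) (Q i)"
      unfolding Q_def using O'(1) by (intro openin_rcoset_image) (metis Int_commute openin_open_Int)
    then show ?thesis unfolding sets_m sets_coset_borel by (intro sigma_sets.Basic) simp
  qed
  have "rcosets \<Delta> \<subseteq> (\<Union>i. Q i)"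
  proof
    fix c assume "c \<in> rcosets \<Delta>"
    then obtain x where x: "x \<in> carrier G" "c = \<Delta> #> x" by (rule in_rcosetsE)
    then obtain i where "x \<in> O' i" using O'(3) by blast
    then show "c \<in> (\<Union>i. Q i)" using x unfolding Q_def by blast
  qed
  then have WD: "W = (\<Union>i. W \<inter> disjointed Q i)"
    using Ws by (simp only: UN_disjointed_eq Int_UN_distrib[symmetric]) (simp add: Int_absorb2 subset_trans)
  have sets: "W \<inter> disjointed Q i \<in> sets m" for i
    using W Q sets.range_disjointed_sets[of Q m] by (intro sets.Int) auto
  have dis: "disjoint_family (\<lambda>i. W \<inter> disjointed Q i)"
    using disjoint_family_disjointed[of Q] by (auto simp: disjoint_family_on_def)
  have "emeasure ?m W = (\<Sum>i. emeasure ?m (W \<inter> disjointed Q i))"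
    using sets dis by (subst WD, intro suminf_emeasure[symmetric]) auto
  also have "\<dots> = (\<Sum>i. emeasure m (W \<inter> disjointed Q i))"
  proof (intro suminf_cong)
    fix i
    have "W \<inter> disjointed Q i \<subseteq> Q i" using disjointed_subset[of Q i] by blast
    then show "emeasure ?m (W \<inter> disjointed Q i) = emeasure m (W \<inter> disjointed Q i)"
      unfolding emeasure_distr[OF measurable_rmult_m[OF u] sets]
      by (intro emeasure_rmult_small[OF sets _ O'(1,2) u]) (simp add: Q_def)
  qed
  also have "\<dots> = emeasure m W"
    using sets dis by (subst (2) WD, intro suminf_emeasure) auto
  finally show "emeasure ?m W = emeasure m W" .
qed simp

lemma integral_rmult:
  fixes f :: "'g set \<Rightarrow> complex"
  assumes "u \<in> carrier G" "continuous_on (carrier G) (\<lambda>x. f (\<Delta> #> x))"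
  shows "(\<integral>c. f (c #> u) \<partial>m) = (\<integral>c. f c \<partial>m)"
proof -
  have "f \<in> borel_measurable m"
    unfolding measurable_cong_sets[OF sets_m refl] by (rule measurable_from_coset_borel[OF assms(2)])
  from integral_distr[OF measurable_rmult_m[OF assms(1)] this] show ?thesis
    by (simp add: distr_rmult[OF assms(1)])
qed

end

end

section \<open>Averages over translates\<close>

text \<open>Comparison with the integral of \<open>z powr (- \<kappa>)\<close>, one unit step at a
  time by the mean value theorem. The first step is separate because the power function need not be
  differentiable at 0.\<close>

lemma sum_powr_le:
  fixes \<kappa> :: real
  assumes "0 < \<kappa>" "\<kappa> < 1"
  shows "(\<Sum>k<n. (1 + real k) powr (- \<kappa>)) \<le> real n powr (1 - \<kappa>) / (1 - \<kappa>)"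
proof (induction n)
  case 0
  then show ?case by simp
next
  case (Suc n)
  have "(1 + real n) powr (- \<kappa>) \<le> (real (Suc n) powr (1 - \<kappa>) - real n powr (1 - \<kappa>)) / (1 - \<kappa>)"
  proof (cases "n = 0")
    case True
    then show ?thesis using assms by (simp add: field_simps)
  next
    case False
    have "\<exists>z. real n < z \<and> z < real n + 1 \<and> (real n + 1) powr (1 - \<kappa>) - real n powr (1 - \<kappa>)
        = (real n + 1 - real n) * ((1 - \<kappa>) * z powr (1 - \<kappa> - 1))"
      using False by (intro MVT2 has_real_derivative_powr) auto
    then obtain z where z: "real n < z" "z < real n + 1"
      "(real n + 1) powr (1 - \<kappa>) - real n powr (1 - \<kappa>) = (1 - \<kappa>) * z powr (- \<kappa>)"
      by auto
    have "(1 + real n) powr (- \<kappa>) \<le> z powr (- \<kappa>)"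
      using z False assms by (intro powr_mono2') auto
    also have "\<dots> = ((real n + 1) powr (1 - \<kappa>) - real n powr (1 - \<kappa>)) / (1 - \<kappa>)"
      using z(3) assms by simp
    finally show ?thesis by (simp add: add.commute)
  qed
  with Suc.IH show ?case
    by (simp add: diff_divide_distrib)
qed

text \<open>For fixed \<open>i\<close> each distance \<open>|i - j|\<close> occurs at most twice,
  once on either side of \<open>i\<close>, so a row is at most twice the one-sided sum.\<close>

lemma double_sum_powr_le:
  fixes \<kappa> :: real
  assumes "0 < \<kappa>" "\<kappa> < 1"
  shows "(\<Sum>i<n. \<Sum>j<n. (1 + \<bar>real i - real j\<bar>) powr (- \<kappa>)) \<le> 2 / (1 - \<kappa>) * real n powr (2 - \<kappa>)"
proof -
  let ?g = "\<lambda>k::nat. (1 + real k) powr (- \<kappa>)"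
  have row: "(\<Sum>j<n. (1 + \<bar>real i - real j\<bar>) powr (- \<kappa>)) \<le> 2 * (\<Sum>k<n. ?g k)" if "i < n" for i
  proof -
    have split: "{..<n} = {..i} \<union> {i<..<n}" using that by auto
    have "(\<Sum>j<n. (1 + \<bar>real i - real j\<bar>) powr (- \<kappa>))
        = (\<Sum>j\<in>{..i}. (1 + \<bar>real i - real j\<bar>) powr (- \<kappa>)) + (\<Sum>j\<in>{i<..<n}. (1 + \<bar>real i - real j\<bar>) powr (- \<kappa>))"
      unfolding split by (intro sum.union_disjoint) auto
    also have "(\<Sum>j\<in>{..i}. (1 + \<bar>real i - real j\<bar>) powr (- \<kappa>)) = (\<Sum>j\<in>{..i}. ?g (i - j))"
      by (intro sum.cong) (auto simp: of_nat_diff)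
    also have "\<dots> = (\<Sum>k\<in>(\<lambda>j. i - j) ` {..i}. ?g k)"
      by (subst sum.reindex) (auto simp: inj_on_def)
    also have "\<dots> \<le> (\<Sum>k<n. ?g k)"
      using that by (intro sum_mono2) auto
    also have "(\<Sum>j\<in>{i<..<n}. (1 + \<bar>real i - real j\<bar>) powr (- \<kappa>)) = (\<Sum>j\<in>{i<..<n}. ?g (j - i))"
      by (intro sum.cong) (auto simp: of_nat_diff)
    also have "\<dots> = (\<Sum>k\<in>(\<lambda>j. j - i) ` {i<..<n}. ?g k)"
      by (subst sum.reindex) (auto simp: inj_on_def)
    also have "\<dots> \<le> (\<Sum>k<n. ?g k)"
      by (intro sum_mono2) auto
    finally show ?thesis by simp
  qed
  have "(\<Sum>i<n. \<Sum>j<n. (1 + \<bar>real i - real j\<bar>) powr (- \<kappa>)) \<le> (\<Sum>i<n. 2 * (\<Sum>k<n. ?g k))"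
    by (intro sum_mono row) simp
  also have "\<dots> = 2 * real n * (\<Sum>k<n. ?g k)" by simp
  also have "\<dots> \<le> 2 * real n * (real n powr (1 - \<kappa>) / (1 - \<kappa>))"
    by (intro mult_left_mono sum_powr_le assms) auto
  also have "\<dots> = 2 / (1 - \<kappa>) * (real n powr 1 * real n powr (1 - \<kappa>))" by simp
  also have "\<dots> = 2 / (1 - \<kappa>) * real n powr (2 - \<kappa>)"
    unfolding powr_add[symmetric] by simp
  finally show ?thesis .
qed

text \<open>Expand the integral of the squared deviation of \<open>g\<close> from its mean. The
  factor \<open>measure M (space M)\<close> is present because orbit measures are not
  normalized.\<close>

lemma (in finite_measure) square_integral_le:
  fixes g :: "'a \<Rightarrow> real"
  assumes "integrable M g" "integrable M (\<lambda>x. (g x)\<^sup>2)"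
  shows "(\<integral>x. g x \<partial>M)\<^sup>2 \<le> measure M (space M) * (\<integral>x. (g x)\<^sup>2 \<partial>M)"
proof (cases "measure M (space M) = 0")
  case True
  then have "AE x in M. g x = 0"
    by (intro AE_I'[of "space M"]) (auto simp: null_sets_def emeasure_eq_measure)
  then have "(\<integral>x. g x \<partial>M) = 0"
    by (rule integral_eq_zero_AE)
  then show ?thesis using True by simp
next
  case False
  let ?m = "measure M (space M)" and ?t = "(\<integral>x. g x \<partial>M) / measure M (space M)"
  have "0 \<le> (\<integral>x. (g x - ?t)\<^sup>2 \<partial>M)" by simp
  also have "\<dots> = (\<integral>x. (g x)\<^sup>2 - 2 * ?t * g x + ?t\<^sup>2 \<partial>M)"
    by (intro Bochner_Integration.integral_cong) (auto simp: power2_diff algebra_simps)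
  also have "\<dots> = (\<integral>x. (g x)\<^sup>2 \<partial>M) - 2 * ?t * (\<integral>x. g x \<partial>M) + ?t\<^sup>2 * ?m"
    using assms by simp
  also have "\<dots> = (\<integral>x. (g x)\<^sup>2 \<partial>M) - (\<integral>x. g x \<partial>M)\<^sup>2 / ?m"
    using False by (simp add: power2_eq_square)
  finally have "(\<integral>x. g x \<partial>M)\<^sup>2 / ?m \<le> (\<integral>x. (g x)\<^sup>2 \<partial>M)" by simp
  moreover have "?m > 0"
    using False by (simp add: zero_less_measure_iff)
  ultimately show ?thesis
    by (simp add: pos_divide_le_eq mult.commute)
qed

text \<open>\<open>measure\<close> takes the value 0 when the total mass is infinite, so a nonzero
  value certifies finiteness. In the remaining case \<open>quotient_mean\<close> divides by 0 and is
  itself 0, which explains the case distinctions below.\<close>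

lemma finite_measure_of_measure:
  assumes "measure m (space m) \<noteq> 0"
  shows "finite_measure m"
  using assms by (intro finite_measureI) (auto simp: measure_def)

section \<open>Correlations of translates and means over a quotient\<close>

context discrete_quotient
begin

lemma some_in_rcoset:
  assumes "c \<in> rcosets \<Delta>"
  shows "(SOME u. u \<in> c) \<in> c"
  using assms mem_self by (metis in_rcosetsE someI)

lemma some_rcoset:
  assumes inv: "\<And>d x. d \<in> \<Delta> \<Longrightarrow> x \<in> carrier G \<Longrightarrow> \<phi> (d \<otimes> x) = \<phi> x" and x: "x \<in> carrier G"
  shows "\<phi> (SOME u. u \<in> \<Delta> #> x) = \<phi> x"
proof -
  have "(SOME u. u \<in> \<Delta> #> x) \<in> \<Delta> #> x"
    using some_in_rcoset rcosetsI' x by blast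
  then obtain d where "d \<in> \<Delta>" "(SOME u. u \<in> \<Delta> #> x) = d \<otimes> x"
    by (auto simp: r_coset_def)
  then show ?thesis using inv x by simp
qed

lemma continuous_on_rmult:
  assumes "continuous_on (carrier G) (\<lambda>x. f (\<Delta> #> x))" "u \<in> carrier G"
  shows "continuous_on (carrier G) (\<lambda>x. f ((\<Delta> #> x) #> u))"
proof -
  have "continuous_on (carrier G) (\<lambda>x. f (\<Delta> #> (x \<otimes> u)))"
    using assms(2) by (intro continuous_on_compose2[OF assms(1) continuous_rmult_on]) auto
  then show ?thesis
    using assms(2) by (simp add: rcoset_rmult cong: continuous_on_cong)
qed

context
  fixes h :: "'g measure" and m :: "'g set measure"
  assumes h: "haar_measure G h" and m: "quotient_measure G \<Delta> h m"
begin

lemma integrable_bounded: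
  fixes f :: "'g set \<Rightarrow> complex"
  assumes fin: "finite_measure m" and cont: "continuous_on (carrier G) (\<lambda>x. f (\<Delta> #> x))"
    and bound: "\<And>x. x \<in> carrier G \<Longrightarrow> norm (f (\<Delta> #> x)) \<le> a"
  shows "integrable m f"
proof (rule finite_measure.integrable_const_bound[OF fin])
  show "AE c in m. norm (f c) \<le> a"
    using bound by (intro AE_I2) (auto simp: space_m[OF h m] elim!: in_rcosetsE)
  show "f \<in> borel_measurable m"
    unfolding measurable_cong_sets[OF sets_m[OF h m] refl] by (rule measurable_from_coset_borel[OF cont])
qed

text \<open>Substituting \<open>c #> v\<close> for \<open>c\<close> leaves the integral unchanged
  and moves both translations onto the first factor.\<close>

lemma inner_L2_translate:
  assumes "continuous_on (carrier G) (\<lambda>x. f (\<Delta> #> x))" "u \<in> carrier G" "v \<in> carrier G"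
  shows "inner_L2 m (translate G u f) (translate G v f) = inner_L2 m (translate G (inv v \<otimes> u) f) f"
proof -
  let ?k = "\<lambda>c. f (c #> (inv v \<otimes> u)) * cnj (f c)"
  have k: "continuous_on (carrier G) (\<lambda>x. ?k (\<Delta> #> x))"
    using assms by (intro continuous_on_mult continuous_on_cnj continuous_on_rmult) auto
  have "?k (c #> v) = translate G u f c * cnj (translate G v f c)" if "c \<in> space m" for c
  proof -
    have "(c #> v) #> (inv v \<otimes> u) = c #> (v \<otimes> (inv v \<otimes> u))"
      using that rcoset_subset[of c] assms by (intro coset_mult_assoc) (auto simp: space_m[OF h m])
    also have "v \<otimes> (inv v \<otimes> u) = u"
      using assms by (simp add: m_assoc[symmetric])
    finally show ?thesis by (simp add: translate_def)
  qed
  then have "inner_L2 m (translate G u f) (translate G v f) = (\<integral>c. ?k (c #> v) \<partial>m)"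
    unfolding inner_L2_def by (intro Bochner_Integration.integral_cong) auto
  also have "\<dots> = inner_L2 m (translate G (inv v \<otimes> u) f) f"
    unfolding integral_rmult[OF h m assms(3) k] by (simp add: inner_L2_def translate_def)
  finally show ?thesis .
qed

text \<open>Expanding the square gives correlations weighted by \<open>c i * cnj (c j)\<close>, of
  modulus 1. Their phases vanish under the triangle inequality, which is why no dependence on the
  character survives.\<close>

lemma inner_L2_average_le:
  fixes n :: nat
  assumes fin: "finite_measure m" and cont: "continuous_on (carrier G) (\<lambda>x. f (\<Delta> #> x))"
    and bound: "\<And>x. x \<in> carrier G \<Longrightarrow> norm (f (\<Delta> #> x)) \<le> a"
    and u: "\<And>j. u j \<in> carrier G" and c: "\<And>j. norm (c j) = 1"
    and F: "F = (\<lambda>y. (\<Sum>j<n. c j * f (y #> u j)) / of_nat n)"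
  shows "norm (\<integral>y. F y * cnj (F y) \<partial>m)
    \<le> (\<Sum>i<n. \<Sum>j<n. norm (inner_L2 m (translate G (inv (u j) \<otimes> u i) f) f)) / (real n)\<^sup>2"
proof -
  let ?k = "\<lambda>i j y. f (y #> u i) * cnj (f (y #> u j))"
  have int: "integrable m (?k i j)" for i j
  proof (rule integrable_bounded[OF fin])
    show "continuous_on (carrier G) (\<lambda>x. ?k i j (\<Delta> #> x))"
      using u cont by (intro continuous_on_mult continuous_on_cnj continuous_on_rmult)
    show "norm (?k i j (\<Delta> #> x)) \<le> a * a" if "x \<in> carrier G" for x
      using bound[of "x \<otimes> u i"] bound[of "x \<otimes> u j"] that u
      by (auto simp: norm_mult rcoset_rmult intro!: mult_mono order_trans[OF norm_ge_zero])
  qed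
  have "F y * cnj (F y) = (\<Sum>i<n. \<Sum>j<n. (c i * cnj (c j)) * ?k i j y) / of_nat n ^ 2" for y
    by (simp add: F sum_product power2_eq_square mult_ac)
  then have "(\<integral>y. F y * cnj (F y) \<partial>m) = (\<Sum>i<n. \<Sum>j<n. (c i * cnj (c j)) * (\<integral>y. ?k i j y \<partial>m)) / of_nat n ^ 2"
    using int by simp
  also have "\<dots> = (\<Sum>i<n. \<Sum>j<n. (c i * cnj (c j)) * inner_L2 m (translate G (inv (u j) \<otimes> u i) f) f) / of_nat n ^ 2"
    unfolding inner_L2_translate[OF cont u u, symmetric] by (simp add: inner_L2_def translate_def)
  also have "norm \<dots> \<le> (\<Sum>i<n. \<Sum>j<n. norm ((c i * cnj (c j)) * inner_L2 m (translate G (inv (u j) \<otimes> u i) f) f)) / (real n)\<^sup>2"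
    unfolding norm_divide norm_power norm_of_nat
    by (intro divide_right_mono order_trans[OF norm_sum] sum_mono norm_sum) auto
  finally show ?thesis
    using c by (simp add: norm_mult)
qed

lemma integrable_quotient:
  assumes fin: "finite_measure m" and cont: "continuous_on (carrier G) \<phi>"
    and inv: "\<And>d x. d \<in> \<Delta> \<Longrightarrow> x \<in> carrier G \<Longrightarrow> \<phi> (d \<otimes> x) = \<phi> x"
    and bound: "\<And>x. x \<in> carrier G \<Longrightarrow> norm (\<phi> x) \<le> a"
  shows "integrable m (\<lambda>c. \<phi> (SOME u. u \<in> c) :: complex)"
  using cont bound
  by (intro integrable_bounded[OF fin, where a = a]) (simp_all add: some_rcoset[of \<phi>, OF inv] cong: continuous_on_cong)

text \<open>Multiplying the chosen representative of \<open>c\<close> by \<open>u\<close> gives some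
  representative of \<open>c #> u\<close>; by invariance of \<open>\<phi>\<close> any one will do,
  and the measure is right invariant.\<close>

lemma quotient_mean_rmult:
  assumes cont: "continuous_on (carrier G) \<phi>"
    and inv: "\<And>d x. d \<in> \<Delta> \<Longrightarrow> x \<in> carrier G \<Longrightarrow> \<phi> (d \<otimes> x) = \<phi> x"
    and u: "u \<in> carrier G"
  shows "quotient_mean m (\<lambda>x. \<phi> (x \<otimes> u)) = quotient_mean m \<phi>"
proof -
  have "\<phi> ((SOME x. x \<in> c) \<otimes> u) = \<phi> (SOME x. x \<in> c #> u)" if c: "c \<in> space m" for c
  proof -
    obtain x where x: "x \<in> carrier G" "c = \<Delta> #> x"
      using c in_rcosetsE by (metis space_m[OF h m])
    have "\<phi> ((SOME y. y \<in> \<Delta> #> x) \<otimes> u) = \<phi> (x \<otimes> u)"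
      by (rule some_rcoset[of "\<lambda>y. \<phi> (y \<otimes> u)", OF _ x(1)]) (simp add: m_assoc inv u \<Delta>_carrier)
    then show ?thesis
      using x u by (simp add: rcoset_rmult some_rcoset[of \<phi>, OF inv])
  qed
  then have "(\<integral>c. \<phi> ((SOME x. x \<in> c) \<otimes> u) \<partial>m) = (\<integral>c. \<phi> (SOME x. x \<in> c #> u) \<partial>m)"
    by (intro Bochner_Integration.integral_cong) auto
  also have "\<dots> = (\<integral>c. \<phi> (SOME x. x \<in> c) \<partial>m)"
    using cont by (intro integral_rmult[OF h m u]) (simp add: some_rcoset[of \<phi>, OF inv] cong: continuous_on_cong)
  finally show ?thesis by (simp add: quotient_mean_def)
qed

lemma quotient_mean_cong:
  assumes "\<And>x. x \<in> carrier G \<Longrightarrow> \<phi> x = \<phi>' x"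
  shows "quotient_mean m \<phi> = quotient_mean m \<phi>'"
proof -
  have "(SOME x. x \<in> c) \<in> carrier G" if "c \<in> space m" for c
    using that some_in_rcoset[of c] rcoset_subset[of c] by (auto simp: space_m[OF h m])
  then have "(\<integral>c. \<phi> (SOME x. x \<in> c) \<partial>m) = (\<integral>c. \<phi>' (SOME x. x \<in> c) \<partial>m)"
    using assms by (intro Bochner_Integration.integral_cong) auto
  then show ?thesis by (simp add: quotient_mean_def)
qed

lemma quotient_mean_average:
  fixes n :: nat
  assumes cont: "continuous_on (carrier G) \<phi>"
    and inv: "\<And>d x. d \<in> \<Delta> \<Longrightarrow> x \<in> carrier G \<Longrightarrow> \<phi> (d \<otimes> x) = \<phi> x"
    and bound: "\<And>x. x \<in> carrier G \<Longrightarrow> norm (\<phi> x) \<le> a"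
    and u: "\<And>j. u j \<in> carrier G" and n: "n > 0"
  shows "quotient_mean m (\<lambda>x. (\<Sum>j<n. \<phi> (x \<otimes> u j)) / of_nat n) = quotient_mean m \<phi>"
proof (cases "measure m (space m) = 0")
  case True
  then show ?thesis by (simp add: quotient_mean_def)
next
  case False
  have "integrable m (\<lambda>c. \<phi> ((SOME x. x \<in> c) \<otimes> u j))" for j
  proof (rule integrable_quotient[OF finite_measure_of_measure[OF False], of "\<lambda>x. \<phi> (x \<otimes> u j)" a])
    show "continuous_on (carrier G) (\<lambda>x. \<phi> (x \<otimes> u j))"
      using u by (intro continuous_on_compose2[OF cont continuous_rmult_on]) auto
  qed (use inv bound u \<Delta>_carrier in \<open>simp_all add: m_assoc\<close>)
  then have "quotient_mean m (\<lambda>x. (\<Sum>j<n. \<phi> (x \<otimes> u j)) / of_nat n)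
      = (\<Sum>j<n. quotient_mean m (\<lambda>x. \<phi> (x \<otimes> u j))) / of_nat n"
    by (simp add: quotient_mean_def sum_divide_distrib mult.commute)
  then show ?thesis
    using n by (simp add: quotient_mean_rmult[OF cont inv u])
qed

lemma norm_quotient_mean_square_le:
  assumes cont: "continuous_on (carrier G) \<phi>" "continuous_on (carrier G) \<psi>"
    and inv: "\<And>d x. d \<in> \<Delta> \<Longrightarrow> x \<in> carrier G \<Longrightarrow> \<phi> (d \<otimes> x) = \<phi> x"
      "\<And>d x. d \<in> \<Delta> \<Longrightarrow> x \<in> carrier G \<Longrightarrow> \<psi> (d \<otimes> x) = \<psi> x"
    and bound: "\<And>x. x \<in> carrier G \<Longrightarrow> norm (\<phi> x) \<le> a"
    and \<psi>: "\<And>x. x \<in> carrier G \<Longrightarrow> norm (\<psi> x) = 1"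
  shows "(norm (quotient_mean m (\<lambda>x. \<phi> x * \<psi> x)))\<^sup>2 \<le> norm (quotient_mean m (\<lambda>x. \<phi> x * cnj (\<phi> x)))"
proof (cases "measure m (space m) = 0")
  case True
  then show ?thesis by (simp add: quotient_mean_def)
next
  case False
  let ?M = "measure m (space m)"
  have M: "?M > 0" using False by (simp add: zero_less_measure_iff)
  note fin = finite_measure_of_measure[OF False]
  interpret finite_measure m by (rule fin)
  let ?p = "\<lambda>c. SOME x. x \<in> c"
  have p: "?p c \<in> carrier G" if "c \<in> space m" for c
    using that some_in_rcoset[of c] rcoset_subset[of c] by (auto simp: space_m[OF h m])
  have i1: "integrable m (\<lambda>c. \<phi> (?p c))"
    using cont inv bound by (intro integrable_quotient[OF fin]) auto
  have i2: "integrable m (\<lambda>c. \<phi> (?p c) * cnj (\<phi> (?p c)))"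
    using cont inv bound
    by (intro integrable_quotient[OF fin, where \<phi> = "\<lambda>x. \<phi> x * cnj (\<phi> x)" and a = "a * a"] continuous_on_mult continuous_on_cnj)
      (auto simp: norm_mult intro!: mult_mono order_trans[OF norm_ge_zero])
  have sq: "\<phi> (?p c) * cnj (\<phi> (?p c)) = of_real ((norm (\<phi> (?p c)))\<^sup>2)" for c
    by (rule complex_norm_square[symmetric])
  have i3: "integrable m (\<lambda>c. (norm (\<phi> (?p c)))\<^sup>2)"
    using i2 unfolding sq by (simp only: complex_of_real_integrable_eq)
  have "norm (\<integral>c. \<phi> (?p c) * \<psi> (?p c) \<partial>m) \<le> (\<integral>c. norm (\<phi> (?p c) * \<psi> (?p c)) \<partial>m)"
    by (rule integral_norm_bound)
  also have "\<dots> = (\<integral>c. norm (\<phi> (?p c)) \<partial>m)"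
    using p \<psi> by (intro Bochner_Integration.integral_cong) (auto simp: norm_mult)
  finally have "(norm (\<integral>c. \<phi> (?p c) * \<psi> (?p c) \<partial>m))\<^sup>2 \<le> (\<integral>c. norm (\<phi> (?p c)) \<partial>m)\<^sup>2"
    by (intro power_mono) auto
  also have "\<dots> \<le> ?M * (\<integral>c. (norm (\<phi> (?p c)))\<^sup>2 \<partial>m)"
    by (rule square_integral_le[OF integrable_norm[OF i1] i3])
  finally have *: "(norm (\<integral>c. \<phi> (?p c) * \<psi> (?p c) \<partial>m))\<^sup>2 \<le> ?M * (\<integral>c. (norm (\<phi> (?p c)))\<^sup>2 \<partial>m)" .
  have "(\<integral>c. \<phi> (?p c) * cnj (\<phi> (?p c)) \<partial>m) = of_real (\<integral>c. (norm (\<phi> (?p c)))\<^sup>2 \<partial>m)"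
    unfolding sq by (rule integral_of_real[OF i3])
  then have "norm (quotient_mean m (\<lambda>x. \<phi> x * cnj (\<phi> x))) = (\<integral>c. (norm (\<phi> (?p c)))\<^sup>2 \<partial>m) / ?M"
    using M by (simp add: quotient_mean_def norm_divide)
  moreover have "(norm (quotient_mean m (\<lambda>x. \<phi> x * \<psi> x)))\<^sup>2 = (norm (\<integral>c. \<phi> (?p c) * \<psi> (?p c) \<partial>m))\<^sup>2 / ?M\<^sup>2"
    using M by (simp add: quotient_mean_def norm_divide power_divide)
  moreover have "?M * (\<integral>c. (norm (\<phi> (?p c)))\<^sup>2 \<partial>m) / ?M\<^sup>2 = (\<integral>c. (norm (\<phi> (?p c)))\<^sup>2 \<partial>m) / ?M"
    using M by (simp add: power2_eq_square[of ?M])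
  ultimately show ?thesis
    using divide_right_mono[OF *, of "?M\<^sup>2"] by simp
qed

end

end

section \<open>Growth of derivatives under translation, and transfer between cosets and the
  group\<close>

context lie_grp
begin

lemma deriv_bounded_translate_Exp:
  assumes B: "independent B" "span B = UNIV" and deg: "Ad_exp_degree G E d'" "d' \<le> d"
  obtains C where "C \<ge> 1"
    "\<And>s k a F. deriv_bounded G B k a F \<Longrightarrow>
      deriv_bounded G B k ((C * (1 + \<bar>s\<bar>) ^ d) ^ k * a) (\<lambda>x. F (x \<otimes> Exp G (s *\<^sub>R E)))"
proof -
  obtain A :: "nat \<Rightarrow> 'l \<Rightarrow> 'l" where A: "\<And>s X. Ad G (Exp G (s *\<^sub>R E)) X = (\<Sum>i\<le>d'. s ^ i *\<^sub>R A i X)"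
    using deg(1) by (auto simp: Ad_exp_degree_def)
  have fin: "finite B"
    using B(1) by (rule independent_imp_finite)
  let ?r = "\<lambda>X b. representation B X b"
  \<comment> \<open>Total size, in coordinates with respect to \<open>B\<close>, of all coefficients
    of the polynomial \<open>s \<mapsto> Ad (Exp (s E))\<close>; the summand 1 ensures
    \<open>C \<ge> 1\<close>. No \<open>s\<close> enters.\<close>
  define C where "C = 1 + (\<Sum>X\<in>B. \<Sum>i\<le>d'. \<Sum>b\<in>B. \<bar>?r (A i X) b\<bar>)"
  have C: "C \<ge> 1"
    unfolding C_def by (simp add: sum_nonneg)
  show ?thesis
  proof (rule that[OF C])
    fix s k a F assume F: "deriv_bounded G B k a F"
    let ?h = "Exp G (s *\<^sub>R E)"
    have inv: "inv ?h = Exp G ((- s) *\<^sub>R E)"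
      by (simp add: Exp_uminus)
    have s1: "1 \<le> (1 + \<bar>s\<bar>) ^ d" by (rule one_le_power) simp
    show "deriv_bounded G B k ((C * (1 + \<bar>s\<bar>) ^ d) ^ k * a) (\<lambda>x. F (x \<otimes> ?h))"
    proof (rule deriv_bounded_rmult[OF fin _ _ _ F, where c = "\<lambda>X b. ?r (Ad G (inv ?h) X) b"])
      show "1 \<le> C * (1 + \<bar>s\<bar>) ^ d"
        using mult_mono[OF C s1] C by simp
      show "Ad G (inv ?h) X = (\<Sum>b\<in>B. ?r (Ad G (inv ?h) X) b *\<^sub>R b)" for X
        using B fin by (simp add: real_vector.sum_representation_eq)
      fix X assume X: "X \<in> B"
      have r: "?r (Ad G (inv ?h) X) b = (\<Sum>i\<le>d'. (- s) ^ i * ?r (A i X) b)" for b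
        unfolding inv A using B
        by (simp add: real_vector.representation_sum real_vector.representation_scale)
      have "(\<Sum>b\<in>B. \<bar>?r (Ad G (inv ?h) X) b\<bar>) \<le> (\<Sum>b\<in>B. \<Sum>i\<le>d'. (1 + \<bar>s\<bar>) ^ d * \<bar>?r (A i X) b\<bar>)"
      proof (intro sum_mono)
        fix b
        have "\<bar>?r (Ad G (inv ?h) X) b\<bar> \<le> (\<Sum>i\<le>d'. \<bar>(- s) ^ i * ?r (A i X) b\<bar>)"
          unfolding r by (rule sum_abs)
        also have "\<dots> \<le> (\<Sum>i\<le>d'. (1 + \<bar>s\<bar>) ^ d * \<bar>?r (A i X) b\<bar>)"
        proof (intro sum_mono)
          fix i assume "i \<in> {..d'}"
          \<comment> \<open>Every power that occurs has \<open>i \<le> d' \<le> d\<close>; the base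
            \<open>1 + |s|\<close> is at least 1, so one factor dominates them all, also for small
            \<open>s\<close>.\<close>
          then have "\<bar>s\<bar> ^ i \<le> (1 + \<bar>s\<bar>) ^ d"
            using deg(2) by (intro order_trans[OF power_mono power_increasing]) auto
          then show "\<bar>(- s) ^ i * ?r (A i X) b\<bar> \<le> (1 + \<bar>s\<bar>) ^ d * \<bar>?r (A i X) b\<bar>"
            by (simp add: abs_mult power_abs mult_right_mono)
        qed
        finally show "\<bar>?r (Ad G (inv ?h) X) b\<bar> \<le> (\<Sum>i\<le>d'. (1 + \<bar>s\<bar>) ^ d * \<bar>?r (A i X) b\<bar>)" .
      qed
      also have "\<dots> = (1 + \<bar>s\<bar>) ^ d * (\<Sum>i\<le>d'. \<Sum>b\<in>B. \<bar>?r (A i X) b\<bar>)"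
        by (subst sum.swap) (simp add: sum_distrib_left)
      also have "\<dots> \<le> (1 + \<bar>s\<bar>) ^ d * C"
      proof (intro mult_left_mono)
        have "(\<Sum>i\<le>d'. \<Sum>b\<in>B. \<bar>?r (A i X) b\<bar>) \<le> (\<Sum>X\<in>B. \<Sum>i\<le>d'. \<Sum>b\<in>B. \<bar>?r (A i X) b\<bar>)"
          using X fin by (intro member_le_sum) (auto intro: sum_nonneg)
        then show "(\<Sum>i\<le>d'. \<Sum>b\<in>B. \<bar>?r (A i X) b\<bar>) \<le> C" by (simp add: C_def)
      qed simp
      finally show "(\<Sum>b\<in>B. \<bar>?r (Ad G (inv ?h) X) b\<bar>) \<le> C * (1 + \<bar>s\<bar>) ^ d"
        by (simp add: mult.commute)
    qed
  qed
qed

lemma coset_rmult: "(\<Gamma> #> g) #> h = \<Gamma> #> (g \<otimes> h)"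
  by (rule coset_mult_assoc) auto

lemma foldr_right_deriv:
  "foldr (right_deriv G) w f (\<Gamma> #> g) = foldr (lie_deriv G) w (\<lambda>g. f (\<Gamma> #> g)) g"
  by (induction w arbitrary: g) (simp_all add: right_deriv_def lie_deriv_def coset_rmult)

lemma smooth_functions_iff: "f \<in> smooth_functions G \<Gamma> \<longleftrightarrow> smooth_fun G (\<lambda>g. f (\<Gamma> #> g))"
  by (simp add: smooth_functions_def)

lemma rcosets_eq: "rcosets \<Gamma> = range (\<lambda>g. \<Gamma> #> g)"
  by (auto simp: RCOSETS_def)

text \<open>Each supremum is one term of the nonnegative sum. Finiteness is essential here, because
  \<open>enn2real\<close> would turn an infinite norm into the false bound 0.\<close>

lemma sobolev_sup_imp_deriv_bounded:
  assumes "finite B" and f: "f \<in> smooth_functions G \<Gamma>" and S: "sobolev_sup G \<Gamma> B d f \<noteq> \<infinity>"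
  shows "deriv_bounded G B d (enn2real (sobolev_sup G \<Gamma> B d f)) (\<lambda>g. f (\<Gamma> #> g))"
proof (rule monomial_le_imp_deriv_bounded)
  fix w g assume w: "set w \<subseteq> B" "length w \<le> d"
  let ?T = "\<lambda>w. SUP x\<in>rcosets \<Gamma>. ennreal (norm (foldr (right_deriv G) w f x))"
  have "ennreal (norm (foldr (right_deriv G) w f (\<Gamma> #> g))) \<le> ?T w"
    by (rule SUP_upper) (simp add: rcosets_eq)
  also have "?T w \<le> sobolev_sup G \<Gamma> B d f"
    unfolding sobolev_sup_def using w finite_lists_length_le[OF assms(1), of d]
    by (intro member_le_sum) auto
  finally have "enn2real (ennreal (norm (foldr (right_deriv G) w f (\<Gamma> #> g)))) \<le> enn2real (sobolev_sup G \<Gamma> B d f)"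
    using S by (intro enn2real_mono) (auto simp: top.not_eq_extremum)
  then show "norm (foldr (lie_deriv G) w (\<lambda>g. f (\<Gamma> #> g)) g) \<le> enn2real (sobolev_sup G \<Gamma> B d f)"
    by (simp add: foldr_right_deriv)
qed (use f in \<open>simp add: smooth_functions_iff\<close>)

text \<open>The converse passage costs the number of words, since \<open>sobolev_sup\<close> adds
  the suprema.\<close>

lemma deriv_bounded_imp_sobolev_sup_le:
  assumes F: "deriv_bounded G B d a (\<lambda>g. f (\<Gamma> #> g))"
  shows "sobolev_sup G \<Gamma> B d f \<le> ennreal (real (card {w. set w \<subseteq> B \<and> length w \<le> d}) * a)"
proof -
  have "sobolev_sup G \<Gamma> B d f \<le> of_nat (card {w. set w \<subseteq> B \<and> length w \<le> d}) * ennreal a"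
    unfolding sobolev_sup_def
  proof (intro sum_bounded_above SUP_least)
    fix w x assume "w \<in> {w. set w \<subseteq> B \<and> length w \<le> d}" "x \<in> rcosets \<Gamma>"
    then show "ennreal (norm (foldr (right_deriv G) w f x)) \<le> ennreal a"
      using deriv_bounded_imp_monomial_le[OF F] by (auto simp: rcosets_eq foldr_right_deriv intro!: ennreal_leI)
  qed
  then show ?thesis
    using deriv_bounded_nonneg[OF F] by (simp add: ennreal_mult ennreal_of_nat_eq_real_of_nat)
qed

lemma discrete_nhd:
  assumes "subgroup \<Gamma> G" "discrete \<Gamma>"
  shows "\<exists>O'. open O' \<and> O' \<inter> \<Gamma> = {\<one>}"
  using discreteD[OF assms(2) subgroup.one_closed[OF assms(1)]] by (auto simp: isolated_in_def)

lemma discrete_quotient_self: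
  assumes "subgroup \<Gamma> G" "discrete \<Gamma>"
  shows "discrete_quotient G \<Gamma>"
  by (intro discrete_quotient.intro discrete_quotient_axioms.intro is_group continuous_mult continuous_inv
      discrete_nhd assms)

text \<open>The stabilizer is the set of \<open>u\<close> in \<open>U\<close> with
  \<open>g u (inv g)\<close> in \<open>\<Gamma>\<close>. Conjugating a neighbourhood that isolates
  the identity in \<open>\<Gamma>\<close> therefore isolates it in the stabilizer.\<close>

lemma discrete_quotient_orbit:
  assumes \<Gamma>: "subgroup \<Gamma> G" "discrete \<Gamma>" and U: "subgroup U G"
  shows "discrete_quotient (G\<lparr>carrier := U\<rparr>) (orbit_stabilizer G U (\<Gamma> #> g))"
proof -
  let ?D = "orbit_stabilizer G U (\<Gamma> #> g)"
  interpret GU: group "G\<lparr>carrier := U\<rparr>"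
    by (rule subgroup_imp_group[OF U])
  have D: "subgroup ?D G"
  proof (rule subgroupI)
    show "?D \<noteq> {}"
      using subgroup.one_closed[OF U] by (auto simp: orbit_stabilizer_def coset_rmult intro!: exI[of _ \<one>])
    show "inv u \<in> ?D" if "u \<in> ?D" for u
    proof -
      have u: "u \<in> U" "\<Gamma> #> (g \<otimes> u) = \<Gamma> #> g"
        using that by (auto simp: orbit_stabilizer_def coset_rmult)
      have "\<Gamma> #> (g \<otimes> inv u) = (\<Gamma> #> (g \<otimes> u)) #> inv u"
        by (simp add: coset_rmult u(2))
      also have "\<dots> = \<Gamma> #> g"
        by (simp add: coset_rmult m_assoc)
      finally show ?thesis
        using u(1) subgroup.m_inv_closed[OF U] by (simp add: orbit_stabilizer_def coset_rmult)
    qed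
    show "u \<otimes> v \<in> ?D" if "u \<in> ?D" "v \<in> ?D" for u v
    proof -
      have uv: "u \<in> U" "(\<Gamma> #> g) #> u = \<Gamma> #> g" "v \<in> U" "(\<Gamma> #> g) #> v = \<Gamma> #> g"
        using that by (auto simp: orbit_stabilizer_def)
      then have "(\<Gamma> #> g) #> (u \<otimes> v) = \<Gamma> #> g"
        by (simp add: coset_rmult m_assoc) (metis coset_rmult m_assoc in_carrier)
      then show ?thesis
        using uv subgroup.m_closed[OF U] by (simp add: orbit_stabilizer_def)
    qed
  qed simp
  show ?thesis
  proof (intro discrete_quotient.intro discrete_quotient_axioms.intro GU.is_group)
    show "continuous_on (carrier (G\<lparr>carrier := U\<rparr>) \<times> carrier (G\<lparr>carrier := U\<rparr>)) (\<lambda>p. fst p \<otimes>\<^bsub>G\<lparr>carrier := U\<rparr>\<^esub> snd p)"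
      using continuous_mult by simp
    have "continuous_on U (\<lambda>x. inv\<^bsub>G\<lparr>carrier := U\<rparr>\<^esub> x) \<longleftrightarrow> continuous_on U (\<lambda>x. inv x)"
      by (intro continuous_on_cong refl m_inv_consistent[OF U])
    then show "continuous_on (carrier (G\<lparr>carrier := U\<rparr>)) (\<lambda>x. inv\<^bsub>G\<lparr>carrier := U\<rparr>\<^esub> x)"
      using continuous_inv by simp
    show "subgroup ?D (G\<lparr>carrier := U\<rparr>)"
      by (rule subgroup_incl[OF D U]) (auto simp: orbit_stabilizer_def)
    obtain N where N: "open N" "N \<inter> \<Gamma> = {\<one>}"
      using discrete_nhd[OF \<Gamma>] by blast
    let ?O = "(\<lambda>u. g \<otimes> u \<otimes> inv g) -` N"
    have "continuous_on UNIV (\<lambda>u. g \<otimes> u \<otimes> inv g)"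
      by (rule smooth_map_continuous[OF smooth_map_compose[OF topological_atlas topological_atlas topological_atlas
              smooth_map_lmult smooth_map_rmult]])
    then have "open ?O" using N(1) by (intro open_vimage)
    moreover have "?O \<inter> ?D = {\<one>}"
    proof (intro equalityI subsetI)
      fix u assume u: "u \<in> ?O \<inter> ?D"
      then have "\<Gamma> #> (g \<otimes> u) = \<Gamma> #> g"
        by (simp add: orbit_stabilizer_def coset_rmult)
      then have "g \<otimes> u \<in> \<Gamma> #> g"
        using rcos_self[OF in_carrier \<Gamma>(1), of "g \<otimes> u"] by simp
      then have "g \<otimes> u \<otimes> inv g \<in> \<Gamma>"
        using subgroup.rcos_module_imp[OF \<Gamma>(1) is_group] by simp
      then have "g \<otimes> u \<otimes> inv g = \<one>"
        using u N(2) by blast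
      then have "g \<otimes> u = g"
        by (metis in_carrier inv_equality inv_inv m_closed inv_closed)
      then show "u \<in> {\<one>}"
        by (simp add: l_cancel_one)
    next
      fix u assume "u \<in> {\<one>}"
      then show "u \<in> ?O \<inter> ?D"
        using N(2) subgroup.one_closed[OF U] by (auto simp: orbit_stabilizer_def coset_rmult)
    qed
    ultimately show "\<exists>O'. open O' \<and> O' \<inter> ?D = {\<one>\<^bsub>G\<lparr>carrier := U\<rparr>\<^esub>}"
      by auto
  qed
qed

text \<open>A non-measurable set has \<open>emeasure\<close> zero, so invariance of a Haar measure on \<open>U\<close>
  forces \<open>U v\<close> to be a measurable subset of \<open>U\<close>.\<close>

lemma haar_measure_imp_subgroup:
  assumes h: "haar_measure (G\<lparr>carrier := U\<rparr>) h" and U: "\<one> \<in> U" "\<And>u. u \<in> U \<Longrightarrow> inv u \<in> U"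
  shows "subgroup U G"
proof (rule subgroupI)
  show "u \<otimes> v \<in> U" if uv: "u \<in> U" "v \<in> U" for u v
  proof -
    have sets: "sets h = sets (restrict_space borel U)"
      using h by (simp add: haar_measure_def)
    then have space: "space h = U"
      using sets_eq_imp_space_eq[OF sets] by (simp add: space_restrict_space)
    have "emeasure h (U #>\<^bsub>G\<lparr>carrier := U\<rparr>\<^esub> v) = emeasure h U"
      using h uv(2) sets.top[of h] unfolding haar_measure_def space by simp
    also have "\<dots> \<noteq> 0"
      using h by (simp add: haar_measure_def)
    finally have "U #>\<^bsub>G\<lparr>carrier := U\<rparr>\<^esub> v \<in> sets h"
      using emeasure_notin_sets by blast
    then have "U #>\<^bsub>G\<lparr>carrier := U\<rparr>\<^esub> v \<subseteq> U"
      using sets.sets_into_space space by blast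
    then show ?thesis
      using uv by (auto simp: r_coset_def)
  qed
qed (use U in auto)

end

section \<open>Decay of twisted means\<close>

text \<open>Optimization in \<open>n\<close>. With
  \<open>L = exp (\<kappa>\<^sub>2 * T / (p + \<kappa>))\<close> both error terms equal
  \<open>L powr (- \<kappa>)\<close>; rounding \<open>L\<close> up at most doubles it because
  \<open>L \<ge> 1\<close>, and this costs the factor \<open>2 ^ p\<close>.\<close>

lemma decay_of_all_averages:
  fixes \<kappa> \<kappa>\<^sub>2 \<kappa>\<^sub>3 K T a y :: real and p :: nat
  assumes \<kappa>: "0 < \<kappa>" "0 < \<kappa>\<^sub>2" "\<kappa>\<^sub>3 \<le> \<kappa> * \<kappa>\<^sub>2 / (2 * (real p + \<kappa>))"
    and pos: "0 \<le> T" "0 \<le> K" "0 \<le> a"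
    and y: "\<And>n::nat. n \<ge> 1 \<Longrightarrow> y\<^sup>2 \<le> K * (real n powr (- \<kappa>) + exp (- \<kappa>\<^sub>2 * T) * real n ^ p) * a\<^sup>2"
  shows "y \<le> sqrt (K * (1 + 2 ^ p)) * exp (- T * \<kappa>\<^sub>3) * a"
proof -
  define q where "q = real p + \<kappa>"
  have q: "q > 0" using \<kappa> by (simp add: q_def)
  define L where "L = exp (\<kappa>\<^sub>2 * T / q)"
  have L: "1 \<le> L" using \<kappa> pos q by (simp add: L_def)
  define n where "n = nat \<lceil>L\<rceil>"
  have n: "L \<le> real n" "real n \<le> 2 * L" "n \<ge> 1"
    using L unfolding n_def by linarith+
  let ?e = "exp (- \<kappa> * \<kappa>\<^sub>2 * T / q)"
  have "real n powr (- \<kappa>) \<le> L powr (- \<kappa>)"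
    using n L \<kappa> by (intro powr_mono2') auto
  also have "\<dots> = ?e" by (simp add: L_def powr_def)
  finally have 1: "real n powr (- \<kappa>) \<le> ?e" .
  have "exp (- \<kappa>\<^sub>2 * T) * real n ^ p \<le> exp (- \<kappa>\<^sub>2 * T) * (2 * L) ^ p"
    using n by (intro mult_left_mono power_mono) auto
  also have "\<dots> = 2 ^ p * exp (- \<kappa>\<^sub>2 * T + real p * (\<kappa>\<^sub>2 * T / q))"
    by (simp only: L_def power_mult_distrib exp_of_nat_mult[symmetric] exp_add mult_ac)
  also have "- \<kappa>\<^sub>2 * T + real p * (\<kappa>\<^sub>2 * T / q) = - \<kappa> * \<kappa>\<^sub>2 * T / q"
    using q by (simp add: field_simps) (simp add: q_def algebra_simps)
  finally have 2: "exp (- \<kappa>\<^sub>2 * T) * real n ^ p \<le> 2 ^ p * ?e" .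
  have "y\<^sup>2 \<le> K * (real n powr (- \<kappa>) + exp (- \<kappa>\<^sub>2 * T) * real n ^ p) * a\<^sup>2"
    by (rule y[OF n(3)])
  also have "\<dots> \<le> K * (?e + 2 ^ p * ?e) * a\<^sup>2"
    using 1 2 pos by (intro mult_right_mono mult_left_mono add_mono) auto
  also have "\<dots> = K * (1 + 2 ^ p) * ?e * a\<^sup>2" by (simp add: algebra_simps)
  \<comment> \<open>The exponent is written as a double because the square root is taken at the end;
    this is where the 2 in the bound on \<open>\<kappa>\<^sub>3\<close> is spent.\<close>
  also have "\<dots> \<le> K * (1 + 2 ^ p) * exp (2 * (- T * \<kappa>\<^sub>3)) * a\<^sup>2"
  proof -
    have "2 * \<kappa>\<^sub>3 \<le> 2 * (\<kappa> * \<kappa>\<^sub>2 / (2 * (real p + \<kappa>)))"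
      using \<kappa>(3) by (rule mult_left_mono) simp
    also have "\<dots> = \<kappa> * \<kappa>\<^sub>2 / q"
      using q by (simp add: q_def field_simps)
    finally have "T * (2 * \<kappa>\<^sub>3) \<le> T * (\<kappa> * \<kappa>\<^sub>2 / q)"
      using pos by (intro mult_left_mono) auto
    then have "?e \<le> exp (2 * (- T * \<kappa>\<^sub>3))"
      by (simp add: mult_ac)
    then show ?thesis
      using pos by (intro mult_right_mono mult_left_mono) auto
  qed
  also have "\<dots> = (sqrt (K * (1 + 2 ^ p)) * exp (- T * \<kappa>\<^sub>3) * a)\<^sup>2"
    unfolding exp_double using pos by (simp add: power_mult_distrib)
  finally have "y\<^sup>2 \<le> (sqrt (K * (1 + 2 ^ p)) * exp (- T * \<kappa>\<^sub>3) * a)\<^sup>2" .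
  then show ?thesis
    by (rule power2_le_imp_le) (use pos in simp)
qed

text \<open>The admissible bound is continuous in the mixing exponent, so a strict inequality at
  \<open>\<kappa>\<^sub>1\<close> persists slightly to its left.\<close>

lemma exists_smaller_exponent:
  fixes \<kappa>\<^sub>1 \<kappa>\<^sub>2 \<kappa>\<^sub>3 p :: real
  assumes "0 < \<kappa>\<^sub>1" "0 < \<kappa>\<^sub>2" "0 \<le> p" "\<kappa>\<^sub>3 < \<kappa>\<^sub>1 * \<kappa>\<^sub>2 / (2 * (p + \<kappa>\<^sub>1))"
  obtains \<kappa> where "0 < \<kappa>" "\<kappa> < \<kappa>\<^sub>1" "\<kappa>\<^sub>3 \<le> \<kappa> * \<kappa>\<^sub>2 / (2 * (p + \<kappa>))"
proof -
  let ?h = "\<lambda>\<kappa>. \<kappa> * \<kappa>\<^sub>2 / (2 * (p + \<kappa>))"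
  have "(?h \<longlongrightarrow> ?h \<kappa>\<^sub>1) (at_left \<kappa>\<^sub>1)"
    using assms by (intro tendsto_intros) auto
  then have "\<forall>\<^sub>F \<kappa> in at_left \<kappa>\<^sub>1. \<kappa>\<^sub>3 < ?h \<kappa>"
    using assms(4) by (rule order_tendstoD)
  moreover have "\<forall>\<^sub>F \<kappa> in at_left \<kappa>\<^sub>1. 0 < \<kappa> \<and> \<kappa> < \<kappa>\<^sub>1"
    using eventually_at_left_real[OF assms(1)] by eventually_elim auto
  ultimately have "\<forall>\<^sub>F \<kappa> in at_left \<kappa>\<^sub>1. 0 < \<kappa> \<and> \<kappa> < \<kappa>\<^sub>1 \<and> \<kappa>\<^sub>3 < ?h \<kappa>"
    by eventually_elim auto
  from eventually_happens'[OF trivial_limit_at_left_real this] obtain \<kappa>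
    where "0 < \<kappa>" "\<kappa> < \<kappa>\<^sub>1" "\<kappa>\<^sub>3 < ?h \<kappa>" by blast
  then show ?thesis
    by (intro that[of \<kappa>]) simp_all
qed

text \<open>The estimate for one fixed \<open>n\<close>. Mixing and equidistribution enter through
  real bounds \<open>a\<close> and \<open>b\<close> on derivatives, which keeps extended reals out
  of the argument; \<open>e\<close> stands for the equidistribution error, including the cost of
  returning to \<open>sobolev_sup\<close>.\<close>

lemma (in lie_grp) twisted_mean_square_le:
  fixes mG mT :: "'g set measure" and n d deg :: nat
  assumes \<Gamma>: "subgroup \<Gamma> G" "discrete \<Gamma>" and U: "subgroup U G"
    and hG: "haar_measure G hG" and mG: "quotient_measure G \<Gamma> hG mG" "finite_measure mG"
    and hU: "haar_measure (G\<lparr>carrier := U\<rparr>) hU"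
    and mT: "quotient_measure (G\<lparr>carrier := U\<rparr>) (orbit_stabilizer G U (\<Gamma> #> g)) hU mT"
    and \<psi>: "unitary_character (G\<lparr>carrier := U\<rparr>) \<psi>" "\<And>\<delta>. \<delta> \<in> orbit_stabilizer G U (\<Gamma> #> g) \<Longrightarrow> \<psi> \<delta> = 1"
    and E: "\<And>s::real. Exp G (s *\<^sub>R E) \<in> U"
    and f: "deriv_bounded G B d a (\<lambda>g. f (\<Gamma> #> g))"
    and C: "C \<ge> 1"
      "\<And>s k a F. deriv_bounded G B k a F \<Longrightarrow>
        deriv_bounded G B k ((C * (1 + \<bar>s\<bar>) ^ deg) ^ k * a) (\<lambda>x. F (x \<otimes> Exp G (s *\<^sub>R E)))"
    and \<kappa>: "0 < \<kappa>" "\<kappa> < 1"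
    and mixing: "\<And>s::real. norm (inner_L2 mG (translate G (Exp G (s *\<^sub>R E)) f) f) \<le> A * (1 + \<bar>s\<bar>) powr (- \<kappa>) * a\<^sup>2"
    and A: "0 \<le> A"
    and equi: "\<And>k b. deriv_bounded G B d b (\<lambda>g. k (\<Gamma> #> g)) \<Longrightarrow>
        norm (quotient_mean mT (\<lambda>u. k ((\<Gamma> #> g) #> u)) - (\<integral>y. k y \<partial>mG)) \<le> e * b"
    and n: "n \<ge> 1"
  shows "(norm (quotient_mean mT (\<lambda>u. f ((\<Gamma> #> g) #> u) * \<psi> u)))\<^sup>2
    \<le> 2 * A / (1 - \<kappa>) * real n powr (- \<kappa>) * a\<^sup>2 + e * (2 ^ d * (C * real n ^ deg) ^ (2 * d) * a\<^sup>2)"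
proof -
  interpret Q: discrete_quotient G \<Gamma>
    by (rule discrete_quotient_self[OF \<Gamma>])
  let ?GU = "G\<lparr>carrier := U\<rparr>" and ?D = "orbit_stabilizer G U (\<Gamma> #> g)" and ?x = "\<Gamma> #> g"
  interpret R: discrete_quotient ?GU ?D
    by (rule discrete_quotient_orbit[OF \<Gamma> U])
  have \<psi>': "continuous_on U \<psi>" "\<And>u. u \<in> U \<Longrightarrow> norm (\<psi> u) = 1"
    "\<And>u v. u \<in> U \<Longrightarrow> v \<in> U \<Longrightarrow> \<psi> (u \<otimes> v) = \<psi> u * \<psi> v"
    using \<psi>(1) by (auto simp: unitary_character_def)
  define u where "u = (\<lambda>j::nat. Exp G (real j *\<^sub>R E))"
  have u: "u j \<in> U" for j by (simp add: u_def E)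
  define b where "b = (C * real n ^ deg) ^ d * a"
  have a: "0 \<le> a" using deriv_bounded_nonneg[OF f] .
  define F where "F = (\<lambda>y. (\<Sum>j<n. \<psi> (u j) * f (y #> u j)) / of_nat n)"
  have cont: "continuous_on S (\<lambda>g. k (\<Gamma> #> g))" if "deriv_bounded G B d c (\<lambda>g. k (\<Gamma> #> g))" for k c S
    using smooth_map_continuous[OF deriv_bounded_smooth[OF that]] by (rule continuous_on_subset) simp
  have contU: "continuous_on U (\<lambda>u. k (?x #> u))" if "deriv_bounded G B d c (\<lambda>g. k (\<Gamma> #> g))" for k c
  proof -
    have "continuous_on U (\<lambda>u. k (\<Gamma> #> (g \<otimes> u)))"
      using smooth_map_continuous[OF smooth_fun_lmult[OF deriv_bounded_smooth[OF that]]]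
      by (rule continuous_on_subset) simp
    then show ?thesis by (simp add: coset_rmult)
  qed
  \<comment> \<open>Functions read along the orbit are invariant under the stabilizer, as the lemmas
    on quotient means require; the same holds for \<open>\<psi>\<close> because it is trivial
    there.\<close>
  have stab: "k (?x #> (\<delta> \<otimes> v)) = k (?x #> v)" if "\<delta> \<in> ?D" for k :: "'g set \<Rightarrow> complex" and \<delta> v
  proof -
    have "?x #> (\<delta> \<otimes> v) = (?x #> \<delta>) #> v"
      by (simp add: coset_rmult m_assoc)
    then show ?thesis using that by (simp add: orbit_stabilizer_def)
  qed
  have stab\<psi>: "\<psi> (\<delta> \<otimes> v) = \<psi> v" if "\<delta> \<in> ?D" "v \<in> U" for \<delta> v
    using that \<psi>(2) \<psi>'(3)[of \<delta> v] by (simp add: orbit_stabilizer_def)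
  have F: "deriv_bounded G B d b (\<lambda>g. F (\<Gamma> #> g))"
  proof -
    have "deriv_bounded G B d (norm (\<psi> (u j)) * b) (\<lambda>g. \<psi> (u j) * f (\<Gamma> #> (g \<otimes> u j)))" if "j < n" for j
    proof (rule deriv_bounded_cmult)
      have "deriv_bounded G B d ((C * (1 + \<bar>real j\<bar>) ^ deg) ^ d * a) (\<lambda>g. f (\<Gamma> #> (g \<otimes> u j)))"
        unfolding u_def by (rule C(2)[OF f])
      \<comment> \<open>The index starts at 0, so \<open>1 + j \<le> n\<close> for every
        \<open>j < n\<close>, and the bound involves exactly \<open>n ^ deg\<close>.\<close>
      moreover have "(C * (1 + \<bar>real j\<bar>) ^ deg) ^ d * a \<le> b"
        unfolding b_def using that C(1) a
        by (intro mult_right_mono power_mono mult_left_mono) auto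
      ultimately show "deriv_bounded G B d b (\<lambda>g. f (\<Gamma> #> (g \<otimes> u j)))"
        by (rule deriv_bounded_mono)
    qed
    then have "deriv_bounded G B d (\<Sum>j<n. norm (\<psi> (u j)) * b) (\<lambda>g. \<Sum>j<n. \<psi> (u j) * f (\<Gamma> #> (g \<otimes> u j)))"
      by (intro deriv_bounded_sum) auto
    then have "deriv_bounded G B d (norm (1 / of_nat n :: complex) * (\<Sum>j<n. norm (\<psi> (u j)) * b))
        (\<lambda>g. 1 / of_nat n * (\<Sum>j<n. \<psi> (u j) * f (\<Gamma> #> (g \<otimes> u j))))"
      by (rule deriv_bounded_cmult)
    then show ?thesis
      using n u by (simp add: F_def coset_rmult \<psi>'(2) norm_divide)
  qed
  define k where "k = (\<lambda>y. F y * cnj (F y))"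
  have k: "deriv_bounded G B d (2 ^ d * (b * b)) (\<lambda>g. k (\<Gamma> #> g))"
    unfolding k_def by (intro deriv_bounded_mult deriv_bounded_cnj F)
  \<comment> \<open>The whole integrand, character included, is averaged over right translates;
    multiplicativity then turns \<open>\<psi> (v u\<^sub>j)\<close> into
    \<open>\<psi> v * \<psi> (u\<^sub>j)\<close>, which produces the coefficients in
    \<open>F\<close>.\<close>
  have "quotient_mean mT (\<lambda>v. f (?x #> v) * \<psi> v)
      = quotient_mean mT (\<lambda>v. (\<Sum>j<n. f (?x #> (v \<otimes> u j)) * \<psi> (v \<otimes> u j)) / of_nat n)"
    using R.quotient_mean_average[OF hU mT, of "\<lambda>v. f (?x #> v) * \<psi> v" a u n]
      contU[OF f] \<psi>'(1,2) u n stab stab\<psi> deriv_bounded_norm_le[OF f]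
    by (simp add: continuous_on_mult norm_mult coset_rmult)
  also have "\<dots> = quotient_mean mT (\<lambda>v. F (?x #> v) * \<psi> v)"
    using u by (intro R.quotient_mean_cong[OF hU mT])
      (simp add: F_def \<psi>'(3) sum_distrib_left sum_distrib_right coset_rmult m_assoc mult_ac)
  finally have "(norm (quotient_mean mT (\<lambda>v. f (?x #> v) * \<psi> v)))\<^sup>2 = (norm (quotient_mean mT (\<lambda>v. F (?x #> v) * \<psi> v)))\<^sup>2"
    by simp
  also have "\<dots> \<le> norm (quotient_mean mT (\<lambda>v. k (?x #> v)))"
    unfolding k_def
    using R.norm_quotient_mean_square_le[OF hU mT, of "\<lambda>v. F (?x #> v)" \<psi> b]
      contU[OF F] \<psi>'(1,2) stab stab\<psi> deriv_bounded_norm_le[OF F]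
    by (simp add: coset_rmult)
  also have "\<dots> \<le> norm (\<integral>y. k y \<partial>mG) + e * (2 ^ d * (b * b))"
    using equi[OF k] norm_triangle_sub[of "quotient_mean mT (\<lambda>v. k (?x #> v))" "\<integral>y. k y \<partial>mG"] by linarith
  also have "norm (\<integral>y. k y \<partial>mG) \<le> 2 * A / (1 - \<kappa>) * real n powr (- \<kappa>) * a\<^sup>2"
  proof -
    have "norm (\<integral>y. k y \<partial>mG)
        \<le> (\<Sum>i<n. \<Sum>j<n. norm (inner_L2 mG (translate G (inv (u j) \<otimes> u i) f) f)) / (real n)\<^sup>2"
      unfolding k_def
      by (rule Q.inner_L2_average_le[OF hG mG(1) mG(2) cont[OF f] deriv_bounded_norm_le[OF f], where c = "\<lambda>j. \<psi> (u j)"])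
        (simp_all add: F_def \<psi>'(2) u)
    also have "\<dots> \<le> (\<Sum>i<n. \<Sum>j<n. A * (1 + \<bar>real i - real j\<bar>) powr (- \<kappa>) * a\<^sup>2) / (real n)\<^sup>2"
    proof (intro divide_right_mono sum_mono)
      fix i j
      \<comment> \<open>All \<open>u\<^sub>j\<close> lie on one one-parameter subgroup, so every
        correlation is an instance of mixing at time \<open>i - j\<close>.\<close>
      have "inv (u j) \<otimes> u i = Exp G ((real i - real j) *\<^sub>R E)"
        using Exp_add[of "- real j" "real i" E] by (simp add: u_def Exp_uminus add.commute)
      then show "norm (inner_L2 mG (translate G (inv (u j) \<otimes> u i) f) f) \<le> A * (1 + \<bar>real i - real j\<bar>) powr (- \<kappa>) * a\<^sup>2"
        using mixing[of "real i - real j"] by simp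
    qed simp
    also have "\<dots> = A * a\<^sup>2 * (\<Sum>i<n. \<Sum>j<n. (1 + \<bar>real i - real j\<bar>) powr (- \<kappa>)) / (real n)\<^sup>2"
      by (simp add: sum_distrib_left mult_ac)
    also have "\<dots> \<le> A * a\<^sup>2 * (2 / (1 - \<kappa>) * real n powr (2 - \<kappa>)) / (real n)\<^sup>2"
      using A by (intro divide_right_mono mult_left_mono double_sum_powr_le \<kappa>) auto
    \<comment> \<open>The \<open>(real n)\<^sup>2\<close> cancels the normalization of the average,
      leaving the gain \<open>n powr (- \<kappa>)\<close>.\<close>
    also have "real n powr (2 - \<kappa>) = real n powr (- \<kappa>) * (real n)\<^sup>2"
      using n powr_add[of "real n" 2 "- \<kappa>"] by (simp add: powr_numeral)
    also have "A * a\<^sup>2 * (2 / (1 - \<kappa>) * (real n powr (- \<kappa>) * (real n)\<^sup>2)) / (real n)\<^sup>2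
        = 2 * A / (1 - \<kappa>) * real n powr (- \<kappa>) * a\<^sup>2"
      using n by simp
    finally show ?thesis .
  qed
  also have "b * b = (C * real n ^ deg) ^ (2 * d) * a\<^sup>2"
    by (simp only: b_def power2_eq_square mult_2 mult_2_right power_add mult_ac)
  finally show ?thesis by (simp add: mult_ac)
qed

theorem theorem3p4:
  fixes G :: "('g::{t2_space,second_countable_topology}, 'l::euclidean_space) lie_structure"
    and \<Gamma> K U :: "'g set" and N :: "'l \<Rightarrow> real" and H :: 'l and \<uu> B :: "'l set"
    and hG hU :: "'g measure" and mG :: "'g set measure"
    and x\<^sub>0 :: "'g set" and x :: "real \<Rightarrow> 'g set" and \<Delta> :: "real \<Rightarrow> 'g set"
    and mU :: "real \<Rightarrow> 'g set measure"
    and \<mu> :: "real \<Rightarrow> ('g \<Rightarrow> complex) \<Rightarrow> ('g set \<Rightarrow> complex) \<Rightarrow> complex"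
    and \<nu> :: "real \<Rightarrow> ('g set \<Rightarrow> complex) \<Rightarrow> complex"
    and S :: "('g set \<Rightarrow> complex) \<Rightarrow> ennreal"
    and \<kappa>\<^sub>1 \<kappa>\<^sub>2 :: real and deg_o :: nat
  assumes G: "semisimple_lie_group G" "connected (carrier G)"
    and \<Gamma>: "lattice_subgroup G \<Gamma>"
    and K: "maximal_compact_subgroup G K"
    and N: "is_norm N"
    and H: "semisimple_element G H"
    and \<uu>_def: "\<uu> = neg_root_sum G H"
    and U_def: "U = Exp G ` \<uu>"
    and hG: "haar_measure G hG"
    and mG: "quotient_measure G \<Gamma> hG mG" "emeasure mG (space mG) = 1"
    and hU: "haar_measure (G\<lparr>carrier := U\<rparr>) hU"
    and x\<^sub>0: "x\<^sub>0 \<in> rcosets\<^bsub>G\<^esub> \<Gamma>"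
    and orbit_compact: "compactin (coset_topology G \<Gamma>) ((\<lambda>u. x\<^sub>0 #>\<^bsub>G\<^esub> u) ` U)"
    and x_def: "\<And>t. x t = x\<^sub>0 #>\<^bsub>G\<^esub> Exp G (t *\<^sub>R H)"
    and \<Delta>_def: "\<And>t. \<Delta> t = orbit_stabilizer G U (x t)"
    and mU: "\<And>T. T \<ge> 0 \<Longrightarrow> quotient_measure (G\<lparr>carrier := U\<rparr>) (\<Delta> T) hU (mU T)"
    and \<mu>_def: "\<And>T \<psi> f. \<mu> T \<psi> f = quotient_mean (mU T) (\<lambda>u. f (x T #>\<^bsub>G\<^esub> u) * \<psi> u)"
    and \<nu>_def: "\<And>T f. \<nu> T f = quotient_mean (mU T) (\<lambda>u. f (x T #>\<^bsub>G\<^esub> u))"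
    and B: "independent B" "span B = UNIV"
    and S_def: "\<And>f. S f = sobolev_sup G \<Gamma> B (subgroup_dim G K) f"
    and \<kappa>: "0 < \<kappa>\<^sub>1" "\<kappa>\<^sub>1 \<le> 1" "0 < \<kappa>\<^sub>2"
    and mixing: "\<exists>C>0. \<forall>f\<in>smooth_functions G \<Gamma>. \<forall>g\<in>smooth_functions G \<Gamma>. \<forall>E\<in>\<uu>. N E = 1 \<longrightarrow>
        (\<forall>s::real. ennreal (norm (inner_L2 mG (translate G (Exp G (s *\<^sub>R E)) f) g
                              - (\<integral>y. f y \<partial>mG) * cnj (\<integral>y. g y \<partial>mG)))
                   \<le> ennreal (C * (1 + \<bar>s\<bar>) powr (- \<kappa>\<^sub>1)) * S f * S g)"
    and equidistribution: "\<exists>C>0. \<forall>f\<in>smooth_functions G \<Gamma>. \<forall>T\<ge>0.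
        ennreal (norm (\<nu> T f - (\<integral>y. f y \<partial>mG))) \<le> ennreal (C * exp (- \<kappa>\<^sub>2 * T)) * S f"
    and deg_o: "max_Ad_exp_degree G \<uu> deg_o"
  shows "let decay = (\<lambda>\<kappa>\<^sub>3::real. \<exists>C>0. \<forall>f\<in>smooth_functions G \<Gamma>. (\<integral>y. f y \<partial>mG) = 0 \<longrightarrow>
               (\<forall>T\<ge>0. \<forall>\<psi>. unitary_character (G\<lparr>carrier := U\<rparr>) \<psi> \<and> (\<forall>\<delta>\<in>\<Delta> T. \<psi> \<delta> = 1) \<longrightarrow>
                  ennreal (norm (\<mu> T \<psi> f)) \<le> ennreal (C * exp (- T * \<kappa>\<^sub>3)) * S f))
         in (\<forall>\<kappa>\<^sub>3 < \<kappa>\<^sub>1 * \<kappa>\<^sub>2 / (2 * (2 * real deg_o * real (subgroup_dim G K) + \<kappa>\<^sub>1)). decay \<kappa>\<^sub>3)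
            \<and> (\<exists>\<kappa>\<^sub>3>0. decay \<kappa>\<^sub>3)"
proof -
  interpret lie_grp G
    using G(1) by (intro lie_grp.intro) (simp add: semisimple_lie_group_def)
  have \<Gamma>': "subgroup \<Gamma> G" "discrete \<Gamma>"
    using \<Gamma> by (simp_all add: lattice_subgroup_def)
  have sub: "subspace \<uu>"
    unfolding \<uu>_def neg_root_sum_def by (rule subspace_span)
  have Exp_U: "Exp G X \<in> U" if "X \<in> \<uu>" for X
    using that by (simp add: U_def)
  \<comment> \<open>\<open>U\<close> is given as the image of a linear subspace, which yields the
    identity and inverses; closure under products comes from the Haar measure
    \<open>hU\<close>.\<close>
  have U: "subgroup U G"
  proof (rule haar_measure_imp_subgroup[OF hU])
    show "\<one>\<^bsub>G\<^esub> \<in> U"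
      using Exp_U[OF subspace_0[OF sub]] by simp
    show "inv\<^bsub>G\<^esub> u \<in> U" if "u \<in> U" for u
      using that subspace_neg[OF sub] by (auto simp: U_def Exp_uminus)
  qed
  obtain g\<^sub>0 where g\<^sub>0: "x\<^sub>0 = \<Gamma> #>\<^bsub>G\<^esub> g\<^sub>0"
    using x\<^sub>0 by (auto simp: RCOSETS_def)
  define g where "g = (\<lambda>T. g\<^sub>0 \<otimes>\<^bsub>G\<^esub> Exp G (T *\<^sub>R H))"
  have x: "x T = \<Gamma> #>\<^bsub>G\<^esub> g T" for T
    by (simp add: x_def g\<^sub>0 g_def coset_rmult)
  have mT: "quotient_measure (G\<lparr>carrier := U\<rparr>) (orbit_stabilizer G U (\<Gamma> #>\<^bsub>G\<^esub> g T)) hU (mU T)" if "T \<ge> 0" for T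
    using mU[OF that] by (simp add: \<Delta>_def x)
  have fin: "finite B"
    using B(1) by (rule independent_imp_finite)
  have mG_fin: "finite_measure mG"
    using mG(2) by (intro finite_measureI) simp
  let ?d = "subgroup_dim G K"
  let ?W = "real (card {w. set w \<subseteq> B \<and> length w \<le> ?d})"
  let ?bound = "\<kappa>\<^sub>1 * \<kappa>\<^sub>2 / (2 * (2 * real deg_o * real ?d + \<kappa>\<^sub>1))"
  \<comment> \<open>Mixing is specialized to a function paired with itself; mean zero removes the
    product of integrals.\<close>
  obtain C\<^sub>1 where C\<^sub>1: "C\<^sub>1 > 0"
    "\<And>f E s. f \<in> smooth_functions G \<Gamma> \<Longrightarrow> E \<in> \<uu> \<Longrightarrow> N E = 1 \<Longrightarrow> (\<integral>y. f y \<partial>mG) = 0 \<Longrightarrow>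
      ennreal (norm (inner_L2 mG (translate G (Exp G (s *\<^sub>R E)) f) f))
        \<le> ennreal (C\<^sub>1 * (1 + \<bar>s\<bar>) powr (- \<kappa>\<^sub>1)) * S f * S f"
    using mixing by (metis (no_types, lifting) complex_cnj_zero diff_zero mult_zero_left)
  obtain C\<^sub>2 where C\<^sub>2: "C\<^sub>2 > 0"
    "\<And>f T. f \<in> smooth_functions G \<Gamma> \<Longrightarrow> T \<ge> 0 \<Longrightarrow>
      ennreal (norm (\<nu> T f - (\<integral>y. f y \<partial>mG))) \<le> ennreal (C\<^sub>2 * exp (- \<kappa>\<^sub>2 * T)) * S f"
    using equidistribution by blast
  have main: "\<exists>C>0. \<forall>f\<in>smooth_functions G \<Gamma>. (\<integral>y. f y \<partial>mG) = 0 \<longrightarrow>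
      (\<forall>T\<ge>0. \<forall>\<psi>. unitary_character (G\<lparr>carrier := U\<rparr>) \<psi> \<and> (\<forall>\<delta>\<in>\<Delta> T. \<psi> \<delta> = 1) \<longrightarrow>
        ennreal (norm (\<mu> T \<psi> f)) \<le> ennreal (C * exp (- T * \<kappa>\<^sub>3)) * S f)"
    if \<kappa>\<^sub>3: "\<kappa>\<^sub>3 < ?bound" for \<kappa>\<^sub>3
  proof (cases "\<uu> = {0}")
    case True
    \<comment> \<open>The mixing hypothesis is vacuous, but \<open>\<psi>\<close> is trivial and \<open>\<mu> = \<nu>\<close>.\<close>
    then have U1: "U = {\<one>\<^bsub>G\<^esub>}" by (simp add: U_def)
    \<comment> \<open>The factor multiplying \<open>\<kappa>\<^sub>2\<close> in
      \<open>?bound\<close> is at most 1/2, so plain equidistribution already decays fast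
      enough.\<close>
    have "?bound \<le> \<kappa>\<^sub>2"
      using \<kappa> by (simp add: divide_le_eq)
    then have "\<kappa>\<^sub>3 \<le> \<kappa>\<^sub>2" using \<kappa>\<^sub>3 by simp
    have "ennreal (norm (\<mu> T \<psi> f)) \<le> ennreal (C\<^sub>2 * exp (- T * \<kappa>\<^sub>3)) * S f"
      if f: "f \<in> smooth_functions G \<Gamma>" "(\<integral>y. f y \<partial>mG) = 0" and T: "T \<ge> 0"
        and \<psi>: "unitary_character (G\<lparr>carrier := U\<rparr>) \<psi>" "\<forall>\<delta>\<in>\<Delta> T. \<psi> \<delta> = 1" for f T \<psi>
    proof -
      interpret R: discrete_quotient "G\<lparr>carrier := U\<rparr>" "orbit_stabilizer G U (\<Gamma> #>\<^bsub>G\<^esub> g T)"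
        by (rule discrete_quotient_orbit[OF \<Gamma>' U])
      have "\<one>\<^bsub>G\<^esub> \<in> \<Delta> T"
        by (simp add: \<Delta>_def orbit_stabilizer_def U1 x coset_rmult)
      then have "\<mu> T \<psi> f = \<nu> T f"
        unfolding \<mu>_def \<nu>_def using \<psi>(2) by (intro R.quotient_mean_cong[OF hU mT[OF T]]) (simp add: U1)
      then have "ennreal (norm (\<mu> T \<psi> f)) \<le> ennreal (C\<^sub>2 * exp (- \<kappa>\<^sub>2 * T)) * S f"
        using C\<^sub>2(2)[OF f(1) T] f(2) by simp
      also have "\<dots> \<le> ennreal (C\<^sub>2 * exp (- T * \<kappa>\<^sub>3)) * S f"
        using C\<^sub>2(1) T mult_right_mono[OF \<open>\<kappa>\<^sub>3 \<le> \<kappa>\<^sub>2\<close> T]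
        by (intro mult_right_mono ennreal_leI mult_left_mono) (auto simp: mult.commute)
      finally show ?thesis .
    qed
    then show ?thesis using C\<^sub>2(1) by blast
  next
    case False
    then obtain E\<^sub>0 where E\<^sub>0: "E\<^sub>0 \<in> \<uu>" "E\<^sub>0 \<noteq> 0"
      using subspace_0[OF sub] by blast
    \<comment> \<open>Normalized because mixing is stated for directions of norm 1.\<close>
    define E where "E = (1 / N E\<^sub>0) *\<^sub>R E\<^sub>0"
    have "N E\<^sub>0 > 0"
      using N E\<^sub>0(2) unfolding is_norm_def by (metis order_le_less)
    have E: "E \<in> \<uu>" "N E = 1"
    proof -
      have "N E = \<bar>1 / N E\<^sub>0\<bar> * N E\<^sub>0"
        using N unfolding is_norm_def E_def by blast
      then show "N E = 1" using \<open>N E\<^sub>0 > 0\<close> by simp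
    qed (simp add: E_def subspace_scale[OF sub E\<^sub>0(1)])
    have sE: "Exp G (s *\<^sub>R E) \<in> U" for s
      by (intro Exp_U subspace_scale[OF sub] E)
    \<comment> \<open>From \<open>\<kappa>' < \<kappa>\<^sub>1 \<le> 1\<close> the power sums have
      the finite constant \<open>2 / (1 - \<kappa>')\<close>.\<close>
    obtain \<kappa>' where \<kappa>': "0 < \<kappa>'" "\<kappa>' < \<kappa>\<^sub>1" "\<kappa>\<^sub>3 \<le> \<kappa>' * \<kappa>\<^sub>2 / (2 * (2 * real deg_o * real ?d + \<kappa>'))"
      by (rule exists_smaller_exponent[OF \<kappa>(1,3) _ \<kappa>\<^sub>3]) auto
    obtain d' where d': "Ad_exp_degree G E d'" "d' \<le> deg_o"
      using deg_o E(1) by (auto simp: max_Ad_exp_degree_def)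
    obtain C where C: "C \<ge> 1"
      "\<And>s k a F. deriv_bounded G B k a F \<Longrightarrow>
        deriv_bounded G B k ((C * (1 + \<bar>s\<bar>) ^ deg_o) ^ k * a) (\<lambda>x. F (x \<otimes>\<^bsub>G\<^esub> Exp G (s *\<^sub>R E)))"
      using deriv_bounded_translate_Exp[OF B d'] by blast
    \<comment> \<open>The first summand is the mixing constant after the double sum. In the second,
      \<open>?W\<close> counts monomials, \<open>2 ^ ?d\<close> is the Leibniz factor for
      \<open>F * cnj F\<close>, and \<open>C ^ (2 * ?d)\<close> comes from translating both factors.
      Nothing here involves \<open>f\<close>, \<open>T\<close> or \<open>\<psi>\<close>.\<close>
    define L where "L = 2 * C\<^sub>1 / (1 - \<kappa>') + C\<^sub>2 * ?W * 2 ^ ?d * C ^ (2 * ?d)"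
    define p where "p = deg_o * (2 * ?d)"
    have L: "L > 0" "2 * C\<^sub>1 / (1 - \<kappa>') \<le> L" "C\<^sub>2 * ?W * 2 ^ ?d * C ^ (2 * ?d) \<le> L"
      using C\<^sub>1(1) C\<^sub>2(1) C(1) \<kappa>' \<kappa>(2) by (auto simp: L_def intro!: add_pos_nonneg)
    have pos: "sqrt (L * (1 + 2 ^ p)) > 0"
      using L(1) by (simp add: add_pos_pos)
    have "ennreal (norm (\<mu> T \<psi> f)) \<le> ennreal (sqrt (L * (1 + 2 ^ p)) * exp (- T * \<kappa>\<^sub>3)) * S f"
      if f: "f \<in> smooth_functions G \<Gamma>" "(\<integral>y. f y \<partial>mG) = 0" and T: "T \<ge> 0"
        and \<psi>: "unitary_character (G\<lparr>carrier := U\<rparr>) \<psi>" "\<forall>\<delta>\<in>\<Delta> T. \<psi> \<delta> = 1" for f T \<psi>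
    proof (cases "S f = \<infinity>")
      case True
      \<comment> \<open>Strict positivity matters: in \<open>ennreal\<close> the product of 0 and
        infinity is 0, so only a nonzero constant makes the right-hand side infinite.\<close>
      have "0 < sqrt (L * (1 + 2 ^ p)) * exp (- T * \<kappa>\<^sub>3)"
        using pos by (rule mult_pos_pos) simp
      then have "ennreal (sqrt (L * (1 + 2 ^ p)) * exp (- T * \<kappa>\<^sub>3)) \<noteq> 0"
        by (simp only: ennreal_eq_0_iff not_le)
      then show ?thesis using True by (simp del: ennreal_eq_0_iff)
    next
      case False
      define a where "a = enn2real (S f)"
      have a: "S f = ennreal a" "0 \<le> a"
        using False by (simp_all add: a_def top.not_eq_extremum)
      have fa: "deriv_bounded G B ?d a (\<lambda>g. f (\<Gamma> #>\<^bsub>G\<^esub> g))"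
        using sobolev_sup_imp_deriv_bounded[OF fin f(1)] False unfolding a_def S_def by blast
      have mix: "norm (inner_L2 mG (translate G (Exp G (s *\<^sub>R E)) f) f) \<le> C\<^sub>1 * (1 + \<bar>s\<bar>) powr (- \<kappa>') * a\<^sup>2" for s
      proof -
        have "ennreal (norm (inner_L2 mG (translate G (Exp G (s *\<^sub>R E)) f) f))
            \<le> ennreal (C\<^sub>1 * (1 + \<bar>s\<bar>) powr (- \<kappa>\<^sub>1) * a * a)"
          using C\<^sub>1(2)[OF f(1) E f(2), of s] C\<^sub>1(1) a by (simp add: ennreal_mult)
        then have "norm (inner_L2 mG (translate G (Exp G (s *\<^sub>R E)) f) f) \<le> C\<^sub>1 * (1 + \<bar>s\<bar>) powr (- \<kappa>\<^sub>1) * a * a"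
          using C\<^sub>1(1) a by (subst (asm) ennreal_le_iff) auto
        \<comment> \<open>The base is at least 1, so lowering the exponent from
          \<open>\<kappa>\<^sub>1\<close> to \<open>\<kappa>'\<close> only weakens the
          bound.\<close>
        also have "\<dots> \<le> C\<^sub>1 * (1 + \<bar>s\<bar>) powr (- \<kappa>') * a * a"
          using C\<^sub>1(1) a(2) \<kappa>' by (intro mult_right_mono mult_left_mono powr_mono) auto
        finally show ?thesis by (simp add: power2_eq_square mult.assoc)
      qed
      have equi: "norm (quotient_mean (mU T) (\<lambda>u. k ((\<Gamma> #>\<^bsub>G\<^esub> g T) #>\<^bsub>G\<^esub> u)) - (\<integral>y. k y \<partial>mG))
          \<le> C\<^sub>2 * exp (- \<kappa>\<^sub>2 * T) * ?W * b"
        if k: "deriv_bounded G B ?d b (\<lambda>g. k (\<Gamma> #>\<^bsub>G\<^esub> g))" for k b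
      proof -
        have b: "0 \<le> b" using deriv_bounded_nonneg[OF k] .
        have "k \<in> smooth_functions G \<Gamma>"
          using deriv_bounded_smooth[OF k] by (simp add: smooth_functions_iff)
        then have "ennreal (norm (\<nu> T k - (\<integral>y. k y \<partial>mG))) \<le> ennreal (C\<^sub>2 * exp (- \<kappa>\<^sub>2 * T)) * S k"
          by (rule C\<^sub>2(2)[OF _ T])
        also have "\<dots> \<le> ennreal (C\<^sub>2 * exp (- \<kappa>\<^sub>2 * T)) * ennreal (?W * b)"
          unfolding S_def by (intro mult_left_mono deriv_bounded_imp_sobolev_sup_le[OF k]) simp
        also have "\<dots> = ennreal (C\<^sub>2 * exp (- \<kappa>\<^sub>2 * T) * (?W * b))"
          using C\<^sub>2(1) b by (intro ennreal_mult[symmetric]) auto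
        finally have "norm (\<nu> T k - (\<integral>y. k y \<partial>mG)) \<le> C\<^sub>2 * exp (- \<kappa>\<^sub>2 * T) * (?W * b)"
          using C\<^sub>2(1) b by (subst (asm) ennreal_le_iff) auto
        then show ?thesis
          by (simp add: \<nu>_def x mult.assoc)
      qed
      have "norm (\<mu> T \<psi> f) \<le> sqrt (L * (1 + 2 ^ p)) * exp (- T * \<kappa>\<^sub>3) * a"
      proof (rule decay_of_all_averages[OF \<kappa>'(1) \<kappa>(3) _ T _ a(2)])
        show "\<kappa>\<^sub>3 \<le> \<kappa>' * \<kappa>\<^sub>2 / (2 * (real p + \<kappa>'))"
          using \<kappa>'(3) by (simp add: p_def mult_ac)
        show "0 \<le> L" using L(1) by simp
        fix n :: nat assume n: "n \<ge> 1"
        have "(norm (\<mu> T \<psi> f))\<^sup>2 \<le> 2 * C\<^sub>1 / (1 - \<kappa>') * real n powr (- \<kappa>') * a\<^sup>2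
            + C\<^sub>2 * exp (- \<kappa>\<^sub>2 * T) * ?W * (2 ^ ?d * (C * real n ^ deg_o) ^ (2 * ?d) * a\<^sup>2)"
          unfolding \<mu>_def x using C\<^sub>1(1) \<kappa>' \<kappa>(2) \<psi>(2)
          by (intro twisted_mean_square_le[OF \<Gamma>' U hG mG(1) mG_fin hU mT[OF T] \<psi>(1) _ sE fa C _ _ mix _ equi n])
            (auto simp: \<Delta>_def x)
        also have "\<dots> = (2 * C\<^sub>1 / (1 - \<kappa>')) * (real n powr (- \<kappa>') * a\<^sup>2)
            + (C\<^sub>2 * ?W * 2 ^ ?d * C ^ (2 * ?d)) * (exp (- \<kappa>\<^sub>2 * T) * real n ^ p * a\<^sup>2)"
          by (simp only: power_mult_distrib p_def power_mult mult_ac)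
        also have "\<dots> \<le> L * (real n powr (- \<kappa>') * a\<^sup>2) + L * (exp (- \<kappa>\<^sub>2 * T) * real n ^ p * a\<^sup>2)"
          using L by (intro add_mono mult_right_mono) auto
        also have "\<dots> = L * (real n powr (- \<kappa>') + exp (- \<kappa>\<^sub>2 * T) * real n ^ p) * a\<^sup>2"
          by (simp add: algebra_simps)
        finally show "(norm (\<mu> T \<psi> f))\<^sup>2 \<le> L * (real n powr (- \<kappa>') + exp (- \<kappa>\<^sub>2 * T) * real n ^ p) * a\<^sup>2" .
      qed
      then have "ennreal (norm (\<mu> T \<psi> f)) \<le> ennreal (sqrt (L * (1 + 2 ^ p)) * exp (- T * \<kappa>\<^sub>3) * a)"
        by (rule ennreal_leI)
      also have "\<dots> = ennreal (sqrt (L * (1 + 2 ^ p)) * exp (- T * \<kappa>\<^sub>3)) * S f"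
        unfolding a(1) using L(1) a(2) by (intro ennreal_mult) auto
      finally show ?thesis .
    qed
    then show ?thesis using pos by blast
  qed
  have pos: "?bound > 0"
    using \<kappa> by (intro divide_pos_pos mult_pos_pos add_nonneg_pos) auto
  \<comment> \<open>Any value strictly between 0 and the positive threshold serves for the
    existential claim.\<close>
  obtain \<kappa>\<^sub>3 where "0 < \<kappa>\<^sub>3" "\<kappa>\<^sub>3 < ?bound"
    using dense[OF pos] by blast
  with main show ?thesis
    unfolding Let_def by blast
qed

end
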